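(* Let $X$ be a Borel right process with Lusin state space $E$. Suppose that $a \in E$ is such that (i) $\mathbb{P}^a\{K_a < \infty\} = 1$, (ii) $\mathbb{P}^a\{T_a = 0\} = 1$, (iii) $\mathbb{P}^x\{T_a < \infty\} > 0$ for all $x \in E$. For $x \in E$ let $\bar{\mathbb{P}}^x$ be the Campbell measure, on $\Omega \times \mathbb{R}_+$, associated under $\mathbb{P}^x$ with the local time of $X$ at $a$ (regarded as a random measure on $\mathbb{R}_+$). If $Z$ is a nonnegative $\mathcal{F}_t$-measurable random variable for some $t \ge 0$, then for every $x\in E$ $$\bar{\mathbb{P}}^x[Z\, \mathbf{1}\{\xi > t\}] = \frac{1}{\mathbb{P}^x\{T_a<\infty\}}\, \mathbb{P}^x\left[Z\, \mathbb{P}^{X_t}\{T_a<\infty\}\right].$$ Moreover, for every $x \in E$, the distribution of $(X_t)_{0 \le t < \xi}$ under $\bar{\mathbb{P}}^x$ is the same as the distribution of $(X_t)_{0 \le t < K_a}$ under $\mathbb{P}^x$ conditional on $\{T_a < \infty\}$.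
   Context: Setting. $X=((X_t), \Omega, \mathcal{F}, \mathbb{P}^x, (\theta_t),(\mathcal{F}_t))$ is a right process with state space $E_\partial = E\cup\{\partial\}$, where $E$ is a Lusin topological space with Borel field $\mathcal{E}$ and $\partial$ is an adjoined cemetery state; it is a Borel right process if its semigroup $(P_t)$ maps nonnegative $\mathcal{E}$-measurable functions to $\mathcal{E}$-measurable functions. The canonical setting is used: $\Omega$ is the space of right-continuous $\omega:\mathbb{R}_+\to E_\partial$ with $\omega(t)=\partial$ for all $t\ge\zeta(\omega):=\inf\{t\ge 0:\omega(t)=\partial\}$, $X_t(\omega)=\omega(t)$, $(\theta_t\omega)(s)=\omega(s+t)$, and $\mathbb{P}^x\{X_0=x\}=1$. With $\mathcal{F}^0_t=\sigma\{X_s:0\le s\le t\}$, the $\sigma$-fields $\mathcal F$ and $\mathcal F_t$ are the usual completions: $\mathcal{F}=\bigcap_\mu\mathcal{F}^\mu$ and $\mathcal{F}_t=\bigcap_\mu(\mathcal{F}_t^0\vee\mathcal{N}^\mu)$, over initial laws $\mu$ on $E$, where $\mathcal{F}^\mu$ is the $\mathbb{P}^\mu$-completion of $\mathcal{F}^0=\bigcup_t \mathcal F_t^0$ and $\mathcal{N}^\mu$ its $\mathbb{P}^\mu$-null sets. $\mathbb{P}^x[\cdot]$ also denotes expectation. $T_a := \inf\{t > 0 : X_t = a\}$ and $K_a := \sup\{t \ge 0 : X_t = a\}$, with $\inf\emptyset=+\infty$ and $\sup\emptyset=0$. Local time at $a$: the perfect continuous homogeneous additive functional $L=(L_t)_{t\ge0}$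 with $\mathbb{P}^x[e^{-T_a}]=\mathbb{P}^x[\int_0^\infty e^{-s}\,dL_s]$ for all $x\in E$. Its set of points of increase is the closed random set $\{t\ge 0:X_t=a\}$, and any such functional growing only on this set is a multiple of $L$. As a random measure, $M((s,t])=L_t-L_s$, $M(\{0\})=0$. Campbell measure: for a random measure $M$ on $\mathbb{R}_+$ with $0<\mathbb{P}^x[M(\mathbb{R}_+)]<\infty$, $\bar{\mathbb{P}}^x$ is the probability measure on $\Omega\times\mathbb{R}_+$ with $\bar{\mathbb{P}}^x(A\times B)=\mathbb{P}^x[\mathbf{1}_A M(B)]/\mathbb{P}^x[M(\mathbb{R}_+)]$. The random variable $\xi:\Omega\times\mathbb{R}_+\to\mathbb{R}_+$ is $\xi(\omega,t)=t$, and random variables on $\Omega$ are regarded as random variables on $\Omega\times\mathbb{R}_+$ in the obvious way. *)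

theory Defs
  imports "HOL-Probability.Probability"
begin

text \<open>A Lusin space is a space homeomorphic to a Borel subset of a compact metric space. Every
  compact metric space embeds in the Hilbert cube, so the carrier type \<open>nat \<Rightarrow> real\<close> for the compact
  space is no restriction.\<close>

definition lusin_space :: "'a topology \<Rightarrow> bool" where
  "lusin_space X \<longleftrightarrow>
     (\<exists>(K :: (nat \<Rightarrow> real) topology) B. compact_space K \<and> metrizable_space K \<and>
        B \<in> sigma_sets (topspace K) {U. openin K U} \<and>
        X homeomorphic_space subtopology K B)"


section \<open>The canonical path space\<close>

text \<open>The space with cemetery is \<open>'a option\<close>, where \<open>None\<close> is the cemetery, an isolated point.
  Right-continuity of the paths below does not depend on the choice of neighbourhoods of \<open>None\<close>,
  because a path stays at \<open>None\<close> once it is there.\<close>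

instantiation option :: (topological_space) topological_space
begin

definition open_option :: "'a option set \<Rightarrow> bool" where
  "open_option U \<longleftrightarrow> open (Some -` U)"

instance
proof
  show "open (UNIV :: 'a option set)"
    by (simp add: open_option_def)
  show "open (S \<inter> T)" if "open S" "open T" for S T :: "'a option set"
    using that by (simp add: open_option_def open_Int)
  show "open (\<Union> K)" if "\<forall>S\<in>K. open S" for K :: "'a option set set"
    using that by (auto simp: open_option_def vimage_Union)
qed

end

text \<open>Functions on the state space are extended by \<open>0\<close> at the cemetery.\<close>

definition ext0 :: "('a \<Rightarrow> ennreal) \<Rightarrow> 'a option \<Rightarrow> ennreal" where
  "ext0 f y = (case y of None \<Rightarrow> 0 | Some x \<Rightarrow> f x)"

type_synonym 'a path = "real \<Rightarrow> 'a option"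

text \<open>In \<open>ennreal\<close> one has \<open>Inf {} = \<infinity>\<close> and \<open>Sup {} = 0\<close>, which are the conventions for
  \<open>\<zeta>\<close>, \<open>T\<^sub>a\<close> and \<open>K\<^sub>a\<close>.\<close>

definition lifetime :: "'a path \<Rightarrow> ennreal" where
  "lifetime \<omega> = Inf {ennreal t | t. 0 \<le> t \<and> \<omega> t = None}"

definition hitting_time :: "'a \<Rightarrow> 'a path \<Rightarrow> ennreal" where
  "hitting_time a \<omega> = Inf {ennreal t | t. 0 < t \<and> \<omega> t = Some a}"

definition last_exit :: "'a \<Rightarrow> 'a path \<Rightarrow> ennreal" where
  "last_exit a \<omega> = Sup {ennreal t | t. 0 \<le> t \<and> \<omega> t = Some a}"

text \<open>Paths are functions on \<open>{0..}\<close>; being extensional, they carry no information at negative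
  arguments.\<close>

definition paths :: "'a::topological_space path set" where
  "paths = {\<omega> \<in> extensional {0..}.
     (\<forall>t\<ge>0. continuous (at_right t) \<omega>) \<and>
     (\<forall>t\<ge>0. lifetime \<omega> \<le> ennreal t \<longrightarrow> \<omega> t = None)}"

definition shift :: "real \<Rightarrow> 'a path \<Rightarrow> 'a path" where
  "shift t \<omega> = (\<lambda>s\<in>{0..}. \<omega> (s + t))"

definition kill :: "ennreal \<Rightarrow> 'a path \<Rightarrow> 'a path" where
  "kill r \<omega> = (\<lambda>t\<in>{0..}. if ennreal t < r then \<omega> t else None)"

definition raw_events :: "'a::topological_space path measure" where
  "raw_events = sigma paths {{\<omega> \<in> paths. \<omega> s \<in> B} | s B. 0 \<le> s \<and> B \<in> sets borel}"

definition raw_filtration :: "real \<Rightarrow> 'a::topological_space path measure" where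
  "raw_filtration t =
     sigma paths {{\<omega> \<in> paths. \<omega> s \<in> B} | s B. 0 \<le> s \<and> s \<le> t \<and> B \<in> sets borel}"


section \<open>Laws and completed filtration\<close>

text \<open>A process is given by the family \<open>P\<close> of its laws on \<open>raw_events\<close>, indexed by the starting
  point.\<close>

definition initial_laws :: "'a::topological_space measure set" where
  "initial_laws = {\<mu>. prob_space \<mu> \<and> sets \<mu> = sets borel}"

definition universally_measurable :: "('a::topological_space \<Rightarrow> ennreal) \<Rightarrow> bool" where
  "universally_measurable f \<longleftrightarrow> (\<forall>\<mu>\<in>initial_laws. f \<in> borel_measurable (completion \<mu>))"

text \<open>The law under an initial law \<open>\<mu>\<close>. The completion is there because \<open>x \<mapsto> P x A\<close> is only
  universally measurable for a general right process.\<close>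

definition law_init ::
  "('a::topological_space \<Rightarrow> 'a path measure) \<Rightarrow> 'a measure \<Rightarrow> 'a path measure" where
  "law_init P \<mu> =
     measure_of paths (sets raw_events) (\<lambda>A. \<integral>\<^sup>+ x. emeasure (P x) A \<partial>completion \<mu>)"

text \<open>The completed law started at a point of the extended state space; from the cemetery, the path
  stays there.\<close>

definition law ::
  "('a::topological_space \<Rightarrow> 'a path measure) \<Rightarrow> 'a option \<Rightarrow> 'a path measure" where
  "law P y = completion (case y of
       None \<Rightarrow> return raw_events (\<lambda>t\<in>{0..}. None)
     | Some x \<Rightarrow> P x)"

definition events :: "('a::topological_space \<Rightarrow> 'a path measure) \<Rightarrow> 'a path measure" where
  "events P = sigma paths (\<Inter>\<mu>\<in>initial_laws. sets (completion (law_init P \<mu>)))"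

definition completed_filtration ::
  "('a::topological_space \<Rightarrow> 'a path measure) \<Rightarrow> real \<Rightarrow> 'a path measure" where
  "completed_filtration P t = sigma paths
     (\<Inter>\<mu>\<in>initial_laws.
        sigma_sets paths (sets (raw_filtration t) \<union> null_sets (completion (law_init P \<mu>))))"


section \<open>Right processes\<close>

definition semigroup ::
  "('a::topological_space \<Rightarrow> 'a path measure) \<Rightarrow> real \<Rightarrow> ('a \<Rightarrow> ennreal) \<Rightarrow> 'a \<Rightarrow> ennreal" where
  "semigroup P t f x = (\<integral>\<^sup>+ \<omega>. ext0 f (\<omega> t) \<partial>law P (Some x))"

definition excessive ::
  "('a::topological_space \<Rightarrow> 'a path measure) \<Rightarrow> real \<Rightarrow> ('a \<Rightarrow> ennreal) \<Rightarrow> bool" where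
  "excessive P \<alpha> f \<longleftrightarrow>
     universally_measurable f \<and>
     (\<forall>x. \<forall>t\<ge>0. ennreal (exp (- \<alpha> * t)) * semigroup P t f x \<le> f x) \<and>
     (\<forall>x. ((\<lambda>t. ennreal (exp (- \<alpha> * t)) * semigroup P t f x) \<longlongrightarrow> f x) (at_right 0))"

text \<open>The definition of a right process in Sharpe's book: a normal Markov process with
  right-continuous paths, along which every \<open>\<alpha>\<close>-excessive function (\<open>\<alpha> > 0\<close>) is almost surely
  right-continuous. The strong Markov property is a consequence.\<close>

definition right_process :: "('a::topological_space \<Rightarrow> 'a path measure) \<Rightarrow> bool" where
  "right_process P \<longleftrightarrow>
     (\<forall>x. prob_space (P x) \<and> sets (P x) = sets raw_events) \<and>
     (\<forall>x. AE \<omega> in P x. \<omega> 0 = Some x) \<and>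
     (\<forall>t\<ge>0. \<forall>f\<in>borel_measurable borel. universally_measurable (semigroup P t f)) \<and>
     (\<forall>x. \<forall>s\<ge>0. \<forall>t\<ge>0. \<forall>A\<in>sets (raw_filtration s). \<forall>f\<in>borel_measurable borel.
        (\<integral>\<^sup>+ \<omega>. indicator A \<omega> * ext0 f (\<omega> (s + t)) \<partial>law P (Some x)) =
        (\<integral>\<^sup>+ \<omega>. indicator A \<omega> * ext0 (semigroup P t f) (\<omega> s) \<partial>law P (Some x))) \<and>
     (\<forall>\<alpha>>0. \<forall>f. excessive P \<alpha> f \<longrightarrow>
        (\<forall>\<mu>\<in>initial_laws. AE \<omega> in law_init P \<mu>.
           \<forall>t\<ge>0. continuous (at_right t) (\<lambda>s. ext0 f (\<omega> s))))"

definition borel_right_process :: "('a::topological_space \<Rightarrow> 'a path measure) \<Rightarrow> bool" where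
  "borel_right_process P \<longleftrightarrow> right_process P \<and>
     (\<forall>t\<ge>0. \<forall>f\<in>borel_measurable borel. semigroup P t f \<in> borel_measurable borel)"


section \<open>Local time and Campbell measure\<close>

text \<open>Perfect means that the exceptional set for the additivity does not depend on the times.
  As usual for additive functionals of a process with finite lifetime, \<open>L\<close> does not grow after
  \<open>\<zeta>\<close>; without this the potential would not determine the local time.\<close>

definition perfect_continuous_additive_functional ::
  "('a::topological_space \<Rightarrow> 'a path measure) \<Rightarrow> (real \<Rightarrow> 'a path \<Rightarrow> real) \<Rightarrow> bool" where
  "perfect_continuous_additive_functional P L \<longleftrightarrow>
     (\<forall>t\<ge>0. L t \<in> borel_measurable (completed_filtration P t)) \<and>
     (\<exists>\<Lambda>\<in>sets (events P). (\<forall>x. emeasure (law P (Some x)) \<Lambda> = 1) \<and>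
        (\<forall>\<omega>\<in>\<Lambda>.
           L 0 \<omega> = 0 \<and>
           mono_on {0..} (\<lambda>t. L t \<omega>) \<and>
           continuous_on {0..} (\<lambda>t. L t \<omega>) \<and>
           (\<forall>s\<ge>0. \<forall>t\<ge>s. lifetime \<omega> \<le> ennreal s \<longrightarrow> L t \<omega> = L s \<omega>) \<and>
           (\<forall>s\<ge>0. \<forall>t\<ge>0. L (s + t) \<omega> = L s \<omega> + L t (shift s \<omega>))))"

text \<open>The measure on \<open>{0..}\<close> with \<open>M {s<..t} = L t \<omega> - L s \<omega>\<close> and \<open>M {0} = 0\<close>.\<close>

definition functional_measure :: "(real \<Rightarrow> 'a path \<Rightarrow> real) \<Rightarrow> 'a path \<Rightarrow> real measure" where
  "functional_measure L \<omega> = restrict_space (interval_measure (\<lambda>t. L (max 0 t) \<omega>)) {0..}"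

definition exp_neg :: "ennreal \<Rightarrow> ennreal" where
  "exp_neg r = (if r = \<infinity> then 0 else ennreal (exp (- enn2real r)))"

definition local_time ::
  "('a::topological_space \<Rightarrow> 'a path measure) \<Rightarrow> 'a \<Rightarrow> (real \<Rightarrow> 'a path \<Rightarrow> real) \<Rightarrow> bool" where
  "local_time P a L \<longleftrightarrow>
     perfect_continuous_additive_functional P L \<and>
     (\<forall>x. (\<integral>\<^sup>+ \<omega>. exp_neg (hitting_time a \<omega>) \<partial>law P (Some x)) =
          (\<integral>\<^sup>+ \<omega>. (\<integral>\<^sup>+ s. ennreal (exp (- s)) \<partial>functional_measure L \<omega>) \<partial>law P (Some x)))"

text \<open>\<open>F\<close> is the \<open>\<sigma>\<close>-field on the first factor, \<open>Q\<close> the underlying probability measure, which may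
  live on a larger \<open>\<sigma>\<close>-field. A measure as described exists only if \<open>M\<close> has positive finite mean
  total mass.\<close>

definition campbell_measure ::
  "'w measure \<Rightarrow> 'w measure \<Rightarrow> ('w \<Rightarrow> real measure) \<Rightarrow> ('w \<times> real) measure" where
  "campbell_measure F Q M = (THE R.
     prob_space R \<and> sets R = sets (F \<Otimes>\<^sub>M restrict_space borel {0..}) \<and>
     (\<forall>A\<in>sets F. \<forall>B\<in>sets (restrict_space borel {0..}).
        emeasure R (A \<times> B) =
          (\<integral>\<^sup>+ \<omega>. indicator A \<omega> * emeasure (M \<omega>) B \<partial>Q) / (\<integral>\<^sup>+ \<omega>. emeasure (M \<omega>) {0..} \<partial>Q)))"

end

theory Submission
  imports Defs
begin

text \<open>
  Everything rests on one identity: under \<open>P x\<close> the mean total local time is \<open>c * h x\<close>, where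
  \<open>h x\<close> is the probability of hitting \<open>a\<close> from \<open>x\<close> and \<open>c\<close> is a constant in \<open>[1, \<infinity>)\<close>
  (\<open>potential_0_eq\<close>). Given this identity, both claims are instances of the Markov property at a
  fixed time \<open>t\<close>. The mass that the local time gives to \<open>(t, \<infinity>)\<close> is the total mass for the path
  after \<open>t\<close>, so that its mean against \<open>Z\<close> is the mean of \<open>Z * c * h (X\<^sub>t)\<close>, and \<open>c\<close> cancels in the
  Campbell measure (\<open>campbell_law_tail\<close>). The last exit exceeds \<open>t\<close> if and only if the path after \<open>t\<close>
  hits \<open>a\<close>, so that the mean of \<open>Z\<close> on this event is the mean of \<open>Z * h (X\<^sub>t)\<close> as well
  (\<open>last_exit_tail\<close>). The events that a random time exceeds \<open>t\<close> and that the path up to \<open>t\<close> has a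
  given property form a generator, stable under intersection, of what can be seen of the path
  killed at that time; hence the two laws of killed paths agree (\<open>killed_campbell_law\<close>).

  For the identity, consider the mean \<open>v \<alpha> x\<close> of the integral of \<open>exp (- \<alpha> s)\<close> against the local
  time. The function \<open>v \<alpha>\<close> is \<open>\<alpha>\<close>-excessive and bounded, so that it is right-continuous along the
  paths; therefore the Markov property at grid points that tend to the hitting time from above
  passes to the limit (\<open>strong_markov_tail\<close>): the mean of the discounted growth after the hitting time \<open>T\<close> is
  \<open>v \<alpha> a\<close> times the mean of \<open>exp (- \<alpha> T)\<close>. For \<open>\<alpha> = 1\<close> the normalisation of the local time says
  that \<open>v 1 x\<close> is the mean of \<open>exp (- T)\<close>, in particular \<open>v 1 a = 1\<close>, because \<open>a\<close> is regular. So
  the growth after \<open>T\<close> is all the growth there is (\<open>no_growth_before_hitting\<close>), and \<open>v \<alpha> x\<close> is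
  \<open>v \<alpha> a\<close> times the mean of \<open>exp (- \<alpha> T)\<close>, for every \<open>\<alpha> > 0\<close>. By transience there is a time \<open>t\<close>
  after which a path from \<open>a\<close> returns to \<open>a\<close> with probability at most \<open>1/2\<close>; this gives
  \<open>v \<alpha> a \<le> exp t + v \<alpha> a / 2\<close>, a bound that is uniform in \<open>\<alpha>\<close> (\<open>potential_bound_uniform\<close>), and \<open>\<alpha>\<close>
  can tend to \<open>0\<close>.

  The hitting time is an infimum over uncountably many times, and the paths need not have left
  limits. It is nevertheless almost surely equal to a stopping time, in the wide sense, of the
  uncompleted filtration: this time is found as an essentially maximal one below the hitting time
  (\<open>debut_optional\<close>). Integrals against the local time are written as Lebesgue integrals over the
  levels that it reaches (\<open>growth_integral\<close>), which reduces joint measurability, the effect of a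
  time shift and the existence of the Campbell measure to facts on Lebesgue measure.
\<close>


section \<open>The state space with its cemetery\<close>

lemma open_vimage_Some: "open U \<Longrightarrow> open (Some -` U)"
  by (simp add: open_option_def)

lemma open_image_Some: "open U \<Longrightarrow> open (Some ` U)"
  by (simp add: open_option_def inj_vimage_image_eq)

lemma open_singleton_None: "open {None :: 'a::topological_space option}"
proof -
  have "Some -` {None} = ({} :: 'a set)" by auto
  then show ?thesis by (simp add: open_option_def)
qed

lemma Some_borel_measurable[measurable]: "Some \<in> borel \<rightarrow>\<^sub>M borel"
  by (rule borel_measurable_continuous_onI)
    (auto simp: continuous_on_open_vimage open_vimage_Some)

lemma singleton_None_borel[measurable]: "{None} \<in> sets (borel :: 'a::topological_space option measure)"
  using open_singleton_None by (rule borel_open)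

lemma image_Some_borel[measurable]:
  assumes "B \<in> sets (borel :: 'a::topological_space measure)"
  shows "Some ` B \<in> sets borel"
proof -
  have "B \<in> sigma_sets UNIV {S :: 'a set. open S}"
    using assms by (simp add: borel_def)
  then show ?thesis
  proof induction
    case (Basic U)
    then show ?case by (auto intro: borel_open open_image_Some)
  next
    case (Compl U)
    have "Some ` (UNIV - U) = UNIV - (Some ` U \<union> {None})"
    proof (rule set_eqI)
      show "z \<in> Some ` (UNIV - U) \<longleftrightarrow> z \<in> UNIV - (Some ` U \<union> {None})" for z
        by (cases z) auto
    qed
    moreover have "UNIV - (Some ` U \<union> {None}) \<in> sets borel"
      using Compl by (intro sets.Diff sets.Un) auto
    ultimately show ?case by simp
  next
    case (Union U)
    then show ?case by (auto simp: image_UN)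
  qed simp
qed

lemma ext0_None[simp]: "ext0 f None = 0"
  and ext0_Some[simp]: "ext0 f (Some x) = f x"
  by (simp_all add: ext0_def)

lemma ext0_borel_measurable[measurable]:
  assumes f: "f \<in> borel_measurable borel"
  shows "ext0 f \<in> borel_measurable (borel :: 'a::topological_space option measure)"
proof (rule measurableI)
  fix V :: "ennreal set" assume V: "V \<in> sets borel"
  have "f -` V \<in> sets borel"
    using measurable_sets[OF f V] by simp
  then have "Some ` (f -` V) \<in> sets borel" by (rule image_Some_borel)
  moreover have "ext0 f -` V \<inter> space borel =
      Some ` (f -` V) \<union> (if 0 \<in> V then {None} else {})"
    (is "?l = ?r")
  proof (rule set_eqI)
    show "z \<in> ?l \<longleftrightarrow> z \<in> ?r" for z by (cases z) auto
  qed
  moreover have "Some ` (f -` V) \<union> {None} \<in> sets borel"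
    using \<open>Some ` (f -` V) \<in> sets borel\<close> by (intro sets.Un) auto
  ultimately show "ext0 f -` V \<inter> space borel \<in> sets borel" by simp
qed simp


section \<open>Paths\<close>

lemma path_None_iff:
  assumes "\<omega> \<in> paths" "0 \<le> t"
  shows "\<omega> t = None \<longleftrightarrow> lifetime \<omega> \<le> ennreal t"
proof
  assume "\<omega> t = None"
  with \<open>0 \<le> t\<close> show "lifetime \<omega> \<le> ennreal t"
    unfolding lifetime_def by (intro Inf_lower) auto
next
  assume "lifetime \<omega> \<le> ennreal t"
  with assms show "\<omega> t = None" by (auto simp: paths_def)
qed

lemma path_absorbed:
  assumes "\<omega> \<in> paths" "0 \<le> s" "s \<le> t" "\<omega> s = None"
  shows "\<omega> t = None"
proof -
  have "lifetime \<omega> \<le> ennreal s" using path_None_iff[of \<omega> s] assms by simp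
  also have "\<dots> \<le> ennreal t" using assms by (intro ennreal_leI)
  finally show ?thesis using path_None_iff[of \<omega> t] assms by simp
qed

text \<open>The lifetime is an infimum; by right-continuity, an absorbed path is already at the cemetery at
  this infimum.\<close>

lemma pathsI:
  assumes ext: "\<omega> \<in> extensional {0..}"
    and cont: "\<And>t. 0 \<le> t \<Longrightarrow> continuous (at_right t) \<omega>"
    and absorbed: "\<And>s t. 0 \<le> s \<Longrightarrow> s \<le> t \<Longrightarrow> \<omega> s = None \<Longrightarrow> \<omega> t = None"
  shows "\<omega> \<in> paths"
proof -
  have "\<omega> t = None" if t: "0 \<le> t" "lifetime \<omega> \<le> ennreal t" for t
  proof (rule ccontr)
    assume "\<omega> t \<noteq> None"
    have "open (range Some :: 'a option set)"
      by (simp add: open_option_def vimage_def)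
    moreover have "\<omega> t \<in> range Some"
      using \<open>\<omega> t \<noteq> None\<close> by (cases "\<omega> t") auto
    ultimately have "\<forall>\<^sub>F s in at_right t. \<omega> s \<in> range Some"
      using cont[OF t(1)] unfolding continuous_within by (rule topological_tendstoD[rotated])
    then obtain b where b: "t < b" "\<And>s. t < s \<Longrightarrow> s < b \<Longrightarrow> \<omega> s \<in> range Some"
      unfolding eventually_at_right_field by blast
    have "lifetime \<omega> < ennreal b"
      using t b by (intro le_less_trans[OF t(2)] ennreal_lessI) auto
    then obtain s where s: "0 \<le> s" "\<omega> s = None" "ennreal s < ennreal b"
      unfolding lifetime_def by (auto simp: Inf_less_iff)
    then have "s < b" using ennreal_less_iff by blast
    show False
    proof (cases "s \<le> t")
      case True
      with absorbed[of s t] s \<open>\<omega> t \<noteq> None\<close> show False by auto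
    next
      case False
      with b(2)[of s] s \<open>s < b\<close> show False by auto
    qed
  qed
  with ext cont show ?thesis by (auto simp: paths_def)
qed

lemma dead_path: "(\<lambda>t\<in>{0..}. None) \<in> paths"
proof (rule pathsI)
  fix t :: real assume "0 \<le> t"
  have "\<forall>\<^sub>F s in at_right t. (\<lambda>t\<in>{0..}. None) s = (None :: 'a option)"
    using eventually_at_right_less[of t] by eventually_elim (use \<open>0 \<le> t\<close> in auto)
  then show "continuous (at_right t) (\<lambda>t\<in>{0..}. None :: 'a option)"
    unfolding continuous_within
    using \<open>0 \<le> t\<close> by (intro tendsto_eventually) simp
qed auto

lemma shift_apply: "0 \<le> s \<Longrightarrow> shift t \<omega> s = \<omega> (s + t)"
  by (simp add: shift_def)

lemma shift_paths:
  assumes "\<omega> \<in> paths" "0 \<le> t"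
  shows "shift t \<omega> \<in> paths"
proof (rule pathsI)
  show "shift t \<omega> \<in> extensional {0..}" by (simp add: shift_def)
next
  fix s :: real assume s: "0 \<le> s"
  have "continuous (at_right (s + t)) \<omega>"
    using assms s by (auto simp: paths_def)
  then have lim: "(\<omega> \<longlongrightarrow> \<omega> (s + t)) (at_right (s + t))"
    by (simp add: continuous_within)
  have "filterlim (\<lambda>u. u + t) (at_right (s + t)) (at_right s)"
    by (auto simp: filterlim_at eventually_at_filter intro!: tendsto_eq_intros)
  from filterlim_compose[OF lim this]
  have "((\<lambda>u. \<omega> (u + t)) \<longlongrightarrow> \<omega> (s + t)) (at_right s)" .
  moreover have "\<forall>\<^sub>F u in at_right s. \<omega> (u + t) = shift t \<omega> u"
    using eventually_at_right_less[of s] by eventually_elim (use s in \<open>simp add: shift_apply\<close>)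
  ultimately have "(shift t \<omega> \<longlongrightarrow> \<omega> (s + t)) (at_right s)"
    by (rule Lim_transform_eventually)
  then show "continuous (at_right s) (shift t \<omega>)"
    using s by (simp add: continuous_within shift_apply)
next
  fix r s :: real assume "0 \<le> r" "r \<le> s" "shift t \<omega> r = None"
  then show "shift t \<omega> s = None"
    using path_absorbed[OF assms(1), of "r + t" "s + t"] assms(2) by (simp add: shift_apply)
qed

lemma shift_of_dead:
  assumes "\<omega> \<in> paths" "0 \<le> t" "\<omega> t = None"
  shows "shift t \<omega> = (\<lambda>t\<in>{0..}. None)"
  using path_absorbed[OF assms(1) assms(2) _ assms(3)]
  by (auto simp: shift_def fun_eq_iff restrict_def)

lemma kill_apply: "0 \<le> t \<Longrightarrow> kill r \<omega> t = (if ennreal t < r then \<omega> t else None)"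
  by (simp add: kill_def)

lemma kill_paths:
  assumes "\<omega> \<in> paths"
  shows "kill r \<omega> \<in> paths"
proof (rule pathsI)
  show "kill r \<omega> \<in> extensional {0..}" by (simp add: kill_def)
next
  fix t :: real assume t: "0 \<le> t"
  have lim: "(\<omega> \<longlongrightarrow> \<omega> t) (at_right t)"
    using assms t by (auto simp: paths_def continuous_within)
  show "continuous (at_right t) (kill r \<omega>)"
  proof (cases "ennreal t < r")
    case True
    then obtain b where b: "ennreal t < b" "b < r" using dense by blast
    then have "b \<noteq> \<infinity>" by auto
    then obtain b' where b': "b = ennreal b'" "0 \<le> b'" by (cases b) auto
    with b(1) t have "t < b'" by (simp add: ennreal_less_iff)
    then have "\<forall>\<^sub>F u in at_right t. u < b'" by (rule eventually_at_rightI[rotated]) auto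
    then have "\<forall>\<^sub>F u in at_right t. \<omega> u = kill r \<omega> u"
      using eventually_at_right_less[of t]
    proof eventually_elim
      case (elim u)
      have "ennreal u \<le> ennreal b'" using elim by (intro ennreal_leI) simp
      then have "ennreal u < r" by (rule le_less_trans[OF _ b(2)[unfolded b'(1)]])
      with elim t show ?case by (simp add: kill_apply)
    qed
    from Lim_transform_eventually[OF lim this] show ?thesis
      using t True by (simp add: continuous_within kill_apply)
  next
    case False
    have "\<forall>\<^sub>F u in at_right t. kill r \<omega> u = None"
      using eventually_at_right_less[of t]
    proof eventually_elim
      case (elim u)
      have "ennreal t \<le> ennreal u" using elim by (intro ennreal_leI) simp
      with False have "\<not> ennreal u < r" by auto
      with elim t show ?case by (simp add: kill_apply)
    qed
    then show ?thesis
      using t False by (auto simp: continuous_within kill_apply intro: tendsto_eventually)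
  qed
next
  fix s t :: real assume "0 \<le> s" "s \<le> t" "kill r \<omega> s = None"
  moreover have "ennreal t < r \<Longrightarrow> ennreal s < r"
    using \<open>s \<le> t\<close> by (meson ennreal_leI le_less_trans)
  ultimately show "kill r \<omega> t = None"
    using path_absorbed[OF assms, of s t] by (auto simp: kill_apply split: if_splits)
qed

lemma space_raw_events[simp]: "space raw_events = paths"
  and space_raw_filtration[simp]: "space (raw_filtration t) = paths"
  by (auto simp: raw_events_def raw_filtration_def space_measure_of_conv)

lemma sets_raw_events:
  "sets raw_events = sigma_sets paths {{\<omega> \<in> paths. \<omega> s \<in> B} | s B. 0 \<le> s \<and> B \<in> sets borel}"
  unfolding raw_events_def by (rule sets_measure_of) auto

lemma sets_raw_filtration:
  "sets (raw_filtration t) =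
     sigma_sets paths {{\<omega> \<in> paths. \<omega> s \<in> B} | s B. 0 \<le> s \<and> s \<le> t \<and> B \<in> sets borel}"
  unfolding raw_filtration_def by (rule sets_measure_of) auto

lemma coordinate_raw_filtration:
  assumes "0 \<le> s" "s \<le> t"
  shows "(\<lambda>\<omega>. \<omega> s) \<in> raw_filtration t \<rightarrow>\<^sub>M borel"
proof (rule measurableI)
  fix B :: "'a option set" assume "B \<in> sets borel"
  moreover have "(\<lambda>\<omega>. \<omega> s) -` B \<inter> space (raw_filtration t) = {\<omega> \<in> paths. \<omega> s \<in> B}" by auto
  ultimately show "(\<lambda>\<omega>. \<omega> s) -` B \<inter> space (raw_filtration t) \<in> sets (raw_filtration t)"
    using assms by (auto simp: sets_raw_filtration intro!: sigma_sets.Basic)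
qed simp

lemma coordinate_raw_events[measurable]:
  assumes "0 \<le> s"
  shows "(\<lambda>\<omega>. \<omega> s) \<in> raw_events \<rightarrow>\<^sub>M borel"
proof (rule measurableI)
  fix B :: "'a option set" assume "B \<in> sets borel"
  moreover have "(\<lambda>\<omega>. \<omega> s) -` B \<inter> space raw_events = {\<omega> \<in> paths. \<omega> s \<in> B}" by auto
  ultimately show "(\<lambda>\<omega>. \<omega> s) -` B \<inter> space raw_events \<in> sets raw_events"
    using assms by (auto simp: sets_raw_events intro!: sigma_sets.Basic)
qed simp

lemma raw_filtration_subset_raw_events: "sets (raw_filtration t) \<subseteq> sets raw_events"
  unfolding sets_raw_filtration sets_raw_events by (rule sigma_sets_mono') auto

lemma raw_filtration_mono: "s \<le> t \<Longrightarrow> sets (raw_filtration s) \<subseteq> sets (raw_filtration t)"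
  unfolding sets_raw_filtration by (rule sigma_sets_mono') force

lemma measurable_into_raw_events:
  assumes "f \<in> space M \<rightarrow> paths"
    and "\<And>s. 0 \<le> s \<Longrightarrow> (\<lambda>x. f x s) \<in> M \<rightarrow>\<^sub>M borel"
  shows "f \<in> M \<rightarrow>\<^sub>M raw_events"
  unfolding raw_events_def
proof (rule measurable_measure_of)
  fix A assume "A \<in> {{\<omega> \<in> paths. \<omega> s \<in> B} | s B. 0 \<le> s \<and> B \<in> sets (borel :: 'b option measure)}"
  then obtain s B where *: "A = {\<omega> \<in> paths. \<omega> s \<in> B}" "0 \<le> s" "B \<in> sets borel" by auto
  have "f -` A \<inter> space M = (\<lambda>x. f x s) -` B \<inter> space M"
    using assms(1) * by auto
  with assms(2)[OF *(2)] *(3) show "f -` A \<inter> space M \<in> sets M"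
    by (simp add: measurable_sets)
qed (use assms in auto)

lemma shift_raw_events[measurable]: "0 \<le> t \<Longrightarrow> shift t \<in> raw_events \<rightarrow>\<^sub>M raw_events"
  by (rule measurable_into_raw_events) (auto intro: shift_paths simp: shift_apply)


section \<open>The Markov property for events of the future\<close>

definition cylinder :: "real set \<Rightarrow> (real \<Rightarrow> 'a::topological_space set) \<Rightarrow> 'a path set" where
  "cylinder J B = {\<omega> \<in> paths. \<forall>s\<in>J. \<omega> s \<in> Some ` B s}"

lemma cylinder_raw_filtration:
  assumes "finite J" "J \<subseteq> {0..t}" "\<And>s. s \<in> J \<Longrightarrow> B s \<in> sets borel"
  shows "cylinder J B \<in> sets (raw_filtration t)"
proof -
  have "cylinder J B = space (raw_filtration t) \<inter> (\<Inter>s\<in>J. {\<omega> \<in> space (raw_filtration t). \<omega> s \<in> Some ` B s})"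
    by (auto simp: cylinder_def)
  moreover have "{\<omega> \<in> space (raw_filtration t). \<omega> s \<in> Some ` B s} \<in> sets (raw_filtration t)" if "s \<in> J" for s
  proof -
    have "(\<lambda>\<omega>. \<omega> s) -` (Some ` B s) \<inter> space (raw_filtration t) \<in> sets (raw_filtration t)"
      by (rule measurable_sets[OF coordinate_raw_filtration])
        (use that assms in \<open>auto intro: image_Some_borel\<close>)
    moreover have "(\<lambda>\<omega>. \<omega> s) -` (Some ` B s) \<inter> space (raw_filtration t) =
      {\<omega> \<in> space (raw_filtration t). \<omega> s \<in> Some ` B s}" by auto
    ultimately show ?thesis by simp
  qed
  ultimately show ?thesis
    using assms(1) by (cases "J = {}") (auto intro!: sets.Int sets.finite_INT
        intro: sets.top[of "raw_filtration t", simplified])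
qed

lemma sets_raw_events_cylinder:
  "sets raw_events = sigma_sets paths
     {cylinder J B | J B. finite J \<and> J \<subseteq> {0..} \<and> (\<forall>s\<in>J. B s \<in> sets (borel :: 'a::topological_space measure))}"
    (is "_ = sigma_sets paths ?C")
proof
  interpret sigma_algebra paths "sigma_sets paths ?C"
    by (rule sigma_algebra_sigma_sets) (auto simp: cylinder_def)
  show "sets raw_events \<subseteq> sigma_sets paths ?C"
    unfolding sets_raw_events
  proof (rule sigma_sets_mono, safe)
    fix s :: real and B :: "'a option set" assume s: "0 \<le> s" and B: "B \<in> sets borel"
    have "Some -` B \<in> sets borel"
      using measurable_sets[OF Some_borel_measurable B] by simp
    then have "cylinder {s} (\<lambda>_. Some -` B) \<in> ?C" "cylinder {s} (\<lambda>_. UNIV) \<in> ?C"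
      using s by (auto intro!: exI[of _ "{s}"])
    then have "cylinder {s} (\<lambda>_. Some -` B) \<union>
        (if None \<in> B then paths - cylinder {s} (\<lambda>_. UNIV) else {}) \<in> sigma_sets paths ?C"
      by (intro Un) (auto intro: sigma_sets.Basic sigma_sets.Empty compl_sets)
    moreover have "{\<omega> \<in> paths. \<omega> s \<in> B} = cylinder {s} (\<lambda>_. Some -` B) \<union>
        (if None \<in> B then paths - cylinder {s} (\<lambda>_. UNIV) else {})" (is "?l = ?r")
    proof (rule set_eqI)
      show "\<omega> \<in> ?l \<longleftrightarrow> \<omega> \<in> ?r" for \<omega>
        by (cases "\<omega> s") (auto simp: cylinder_def)
    qed
    ultimately show "{\<omega> \<in> paths. \<omega> s \<in> B} \<in> sigma_sets paths ?C" by simp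
  qed
  show "sigma_sets paths ?C \<subseteq> sets raw_events"
  proof -
    have "?C \<subseteq> sets raw_events"
    proof safe
      fix J and B :: "real \<Rightarrow> 'a set"
      assume J: "finite J" "J \<subseteq> {0..}" "\<forall>s\<in>J. B s \<in> sets borel"
      have "J \<subseteq> {0..Max (insert 0 J)}" using J by auto
      then show "cylinder J B \<in> sets raw_events"
        using J cylinder_raw_filtration[of J _ B] raw_filtration_subset_raw_events by blast
    qed
    then show ?thesis using sets.sigma_sets_subset[of ?C raw_events] by simp
  qed
qed

lemma cylinder_Pow:
  "{cylinder J B | J B. finite J \<and> J \<subseteq> {0..} \<and> (\<forall>s\<in>J. B s \<in> sets (borel :: 'a::topological_space measure))} \<subseteq> Pow paths"
  by (auto simp: cylinder_def)

lemma Int_stable_cylinder: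
  "Int_stable {cylinder J B | J B. finite J \<and> J \<subseteq> {0..} \<and> (\<forall>s\<in>J. B s \<in> sets (borel :: 'a::topological_space measure))}"
proof (rule Int_stableI, safe)
  fix J K and B C :: "real \<Rightarrow> 'a set"
  assume J: "finite J" "J \<subseteq> {0..}" "\<forall>s\<in>J. B s \<in> sets borel"
    and K: "finite K" "K \<subseteq> {0..}" "\<forall>s\<in>K. C s \<in> sets borel"
  let ?D = "\<lambda>s. (if s \<in> J then B s else UNIV) \<inter> (if s \<in> K then C s else UNIV)"
  have "cylinder J B \<inter> cylinder K C = cylinder (J \<union> K) ?D"
    (is "?l = ?r")
  proof (rule set_eqI)
    have [simp]: "Some ` (B \<inter> C) = Some ` B \<inter> Some ` C" for B C :: "'a set"
      by auto
    show "\<omega> \<in> ?l \<longleftrightarrow> \<omega> \<in> ?r" for \<omega>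
      by (auto simp: cylinder_def simp del: image_Int)
  qed
  moreover have "\<forall>s\<in>J \<union> K. ?D s \<in> sets borel" using J K by auto
  ultimately show "\<exists>J' B'. cylinder J B \<inter> cylinder K C = cylinder J' B' \<and>
      finite J' \<and> J' \<subseteq> {0..} \<and> (\<forall>s\<in>J'. B' s \<in> sets borel)"
    using J K by (intro exI[of _ "J \<union> K"] exI[of _ ?D]) auto
qed

lemma shift_raw_filtration:
  assumes "0 \<le> t" "t + b \<le> u"
  shows "shift t \<in> raw_filtration u \<rightarrow>\<^sub>M raw_filtration b"
  unfolding raw_filtration_def[of b]
proof (rule measurable_measure_of)
  show "shift t \<in> space (raw_filtration u) \<rightarrow> paths" using assms by (auto intro: shift_paths)
  fix A assume "A \<in> {{\<omega> \<in> paths. \<omega> s \<in> B} | s B. 0 \<le> s \<and> s \<le> b \<and> B \<in> sets (borel :: 'a option measure)}"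
  then obtain s B where *: "A = {\<omega> \<in> paths. \<omega> s \<in> B}" "0 \<le> s" "s \<le> b" "B \<in> sets borel" by auto
  have "shift t -` A \<inter> space (raw_filtration u) = (\<lambda>\<omega>. \<omega> (s + t)) -` B \<inter> space (raw_filtration u)"
    using * assms by (auto simp: shift_apply shift_paths)
  also have "\<dots> \<in> sets (raw_filtration u)"
    using * assms by (intro measurable_sets[OF coordinate_raw_filtration]) auto
  finally show "shift t -` A \<inter> space (raw_filtration u) \<in> sets (raw_filtration u)" .
qed auto

lemma future_event_raw_events:
  fixes A C :: "'a::topological_space path set"
  assumes "0 \<le> t" "A \<in> sets (raw_filtration t)" "C \<in> sets raw_events"
  shows "{\<omega> \<in> A. \<omega> t \<noteq> None \<and> shift t \<omega> \<in> C} \<in> sets raw_events"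
proof -
  have "{\<omega> \<in> A. \<omega> t \<noteq> None \<and> shift t \<omega> \<in> C} =
    A \<inter> ((\<lambda>\<omega>. \<omega> t) -` (- {None}) \<inter> space raw_events) \<inter> (shift t -` C \<inter> space raw_events)"
    using sets.sets_into_space[OF assms(2)] by auto
  moreover have "A \<in> sets raw_events"
    using assms(2) raw_filtration_subset_raw_events by auto
  moreover have "(\<lambda>\<omega>. \<omega> t) -` (- {None}) \<inter> space raw_events \<in> sets (raw_events :: 'a path measure)"
    by (rule measurable_sets[OF coordinate_raw_events[OF assms(1)]])
      (auto intro: borel_comp singleton_None_borel)
  moreover have "shift t -` C \<inter> space raw_events \<in> sets raw_events"
    by (rule measurable_sets[OF shift_raw_events[OF assms(1)] assms(3)])
  ultimately show ?thesis by simp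
qed

locale borel_right =
  fixes P :: "'a::topological_space \<Rightarrow> 'a path measure"
  assumes process: "borel_right_process P"
begin

lemma right_process: "right_process P"
  using process by (simp add: borel_right_process_def)

lemma prob_space_P: "prob_space (P x)"
  and sets_P[simp, measurable_cong]: "sets (P x) = sets raw_events"
  and start: "AE \<omega> in P x. \<omega> 0 = Some x"
  using right_process by (auto simp: right_process_def)

lemma space_P[simp]: "space (P x) = paths"
  using sets_eq_imp_space_eq[OF sets_P] by simp

lemma emeasure_P_paths[simp]: "emeasure (P x) paths = 1"
  using prob_space.emeasure_space_1[OF prob_space_P[of x]] by simp

lemma raw_filtration_P[intro]: "A \<in> sets (raw_filtration t) \<Longrightarrow> A \<in> sets (P x)"
  using raw_filtration_subset_raw_events by auto

lemma law_Some: "law P (Some x) = completion (P x)"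
  by (simp add: law_def)

lemma semigroup_eq: "semigroup P t f x = (\<integral>\<^sup>+ \<omega>. ext0 f (\<omega> t) \<partial>P x)"
  by (simp add: semigroup_def law_Some nn_integral_completion)

lemma semigroup_borel:
  "0 \<le> t \<Longrightarrow> f \<in> borel_measurable borel \<Longrightarrow> semigroup P t f \<in> borel_measurable borel"
  using process by (simp add: borel_right_process_def)

lemma markov_one_time:
  assumes "0 \<le> s" "0 \<le> t" "A \<in> sets (raw_filtration s)" "f \<in> borel_measurable borel"
  shows "(\<integral>\<^sup>+ \<omega>. indicator A \<omega> * ext0 f (\<omega> (s + t)) \<partial>P x) =
         (\<integral>\<^sup>+ \<omega>. indicator A \<omega> * ext0 (semigroup P t f) (\<omega> s) \<partial>P x)"
  using right_process assms unfolding right_process_def law_Some nn_integral_completion by blast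

text \<open>The integrand carries a function of one further coordinate beyond the times of the cylinder.
  This makes the induction over the largest time work: the Markov property at the largest time of
  the cylinder moves that function back to this time.\<close>

lemma markov_cylinder:
  assumes "finite J" "J \<subseteq> {0..}" "\<And>s. s \<in> J \<Longrightarrow> B s \<in> sets borel"
    and "\<And>s. s \<in> J \<Longrightarrow> s \<le> m" "0 \<le> m" "f \<in> borel_measurable borel"
  shows "(\<lambda>y. \<integral>\<^sup>+ \<omega>. indicator (cylinder J B) \<omega> * ext0 f (\<omega> m) \<partial>P y) \<in> borel_measurable borel \<and>
    (\<forall>x. \<forall>t\<ge>0. \<forall>A\<in>sets (raw_filtration t).
      (\<integral>\<^sup>+ \<omega>. indicator A \<omega> * indicator (cylinder J B) (shift t \<omega>) * ext0 f (\<omega> (t + m)) \<partial>P x) =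
      (\<integral>\<^sup>+ \<omega>. indicator A \<omega> * ext0 (\<lambda>y. \<integral>\<^sup>+ \<omega>. indicator (cylinder J B) \<omega> * ext0 f (\<omega> m) \<partial>P y) (\<omega> t) \<partial>P x))"
  using assms
proof (induction J arbitrary: m f rule: finite_linorder_max_induct)
  case empty
  have eq: "(\<lambda>y. \<integral>\<^sup>+ \<omega>. indicator (cylinder {} B) \<omega> * ext0 f (\<omega> m) \<partial>P y) = semigroup P m f"
    unfolding semigroup_eq by (intro ext nn_integral_cong) (simp add: cylinder_def)
  have "(\<integral>\<^sup>+ \<omega>. indicator A \<omega> * indicator (cylinder {} B) (shift t \<omega>) * ext0 f (\<omega> (t + m)) \<partial>P x) =
      (\<integral>\<^sup>+ \<omega>. indicator A \<omega> * ext0 f (\<omega> (t + m)) \<partial>P x)" if "0 \<le> t" for A x t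
    using that by (auto simp: cylinder_def shift_paths intro!: nn_integral_cong)
  then show ?case
    unfolding eq using empty by (simp add: semigroup_borel markov_one_time)
next
  case (insert b J)
  let ?C = "cylinder (insert b J) B"
  let ?g = "\<lambda>z. indicator (B b) z * semigroup P (m - b) f z"
  have b: "0 \<le> b" "b \<le> m" "B b \<in> sets borel" using insert.prems by auto
  have g: "?g \<in> borel_measurable borel"
    using b insert.prems by (intro borel_measurable_times_ennreal semigroup_borel) auto
  have IH: "(\<lambda>y. \<integral>\<^sup>+ \<omega>. indicator (cylinder J B) \<omega> * ext0 ?g (\<omega> b) \<partial>P y) \<in> borel_measurable borel \<and>
    (\<forall>x. \<forall>t\<ge>0. \<forall>A\<in>sets (raw_filtration t).
      (\<integral>\<^sup>+ \<omega>. indicator A \<omega> * indicator (cylinder J B) (shift t \<omega>) * ext0 ?g (\<omega> (t + b)) \<partial>P x) =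
      (\<integral>\<^sup>+ \<omega>. indicator A \<omega> * ext0 (\<lambda>y. \<integral>\<^sup>+ \<omega>. indicator (cylinder J B) \<omega> * ext0 ?g (\<omega> b) \<partial>P y) (\<omega> t) \<partial>P x))"
    using insert g b by (intro insert.IH) (auto intro: less_imp_le)
  have C: "?C \<in> sets (raw_filtration b)"
  proof (rule cylinder_raw_filtration)
    show "insert b J \<subseteq> {0..b}"
      using insert.prems(1) insert.hyps(2) by force
  qed (use insert in auto)
  have ext: "indicator (Some ` B b) z * ext0 (semigroup P (m - b) f) z = ext0 ?g z" for z
    by (cases z) (auto simp: indicator_def)
  have split: "indicator ?C \<omega> = (indicator (cylinder J B) \<omega> * indicator (Some ` B b) (\<omega> b) :: ennreal)" for \<omega>
    by (auto simp: cylinder_def indicator_def)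
  have one: "(\<integral>\<^sup>+ \<omega>. indicator ?C \<omega> * ext0 f (\<omega> m) \<partial>P y) =
      (\<integral>\<^sup>+ \<omega>. indicator (cylinder J B) \<omega> * ext0 ?g (\<omega> b) \<partial>P y)" for y
    using markov_one_time[of b "m - b" ?C f y] b C insert.prems
    by (simp add: split mult.assoc ext)
  have two: "(\<integral>\<^sup>+ \<omega>. indicator A \<omega> * indicator ?C (shift t \<omega>) * ext0 f (\<omega> (t + m)) \<partial>P x) =
      (\<integral>\<^sup>+ \<omega>. indicator A \<omega> * indicator (cylinder J B) (shift t \<omega>) * ext0 ?g (\<omega> (t + b)) \<partial>P x)"
    if t: "0 \<le> t" and A: "A \<in> sets (raw_filtration t)" for x t A
  proof -
    let ?A = "A \<inter> (shift t -` ?C \<inter> space (raw_filtration (t + b)))"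
    have A_eq: "indicator ?A \<omega> = (indicator A \<omega> * indicator ?C (shift t \<omega>) :: ennreal)" if "\<omega> \<in> paths" for \<omega>
      using that by (auto simp: indicator_def)
    have "?A \<in> sets (raw_filtration (t + b))"
      using A C t b raw_filtration_mono[of t "t + b"] shift_raw_filtration[of t b "t + b"]
      by (intro sets.Int measurable_sets[of _ _ "raw_filtration b"]) auto
    from markov_one_time[OF _ _ this, of "m - b" f x]
    have "(\<integral>\<^sup>+ \<omega>. indicator ?A \<omega> * ext0 f (\<omega> (t + m)) \<partial>P x) =
        (\<integral>\<^sup>+ \<omega>. indicator ?A \<omega> * ext0 (semigroup P (m - b) f) (\<omega> (t + b)) \<partial>P x)"
      using t b insert.prems by (simp add: add.assoc)
    also have "(\<integral>\<^sup>+ \<omega>. indicator ?A \<omega> * ext0 f (\<omega> (t + m)) \<partial>P x) =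
        (\<integral>\<^sup>+ \<omega>. indicator A \<omega> * indicator ?C (shift t \<omega>) * ext0 f (\<omega> (t + m)) \<partial>P x)"
      by (intro nn_integral_cong) (simp only: A_eq space_P)
    also have "(\<integral>\<^sup>+ \<omega>. indicator ?A \<omega> * ext0 (semigroup P (m - b) f) (\<omega> (t + b)) \<partial>P x) =
        (\<integral>\<^sup>+ \<omega>. indicator A \<omega> * indicator (cylinder J B) (shift t \<omega>) * ext0 ?g (\<omega> (t + b)) \<partial>P x)"
    proof (intro nn_integral_cong)
      fix \<omega> assume "\<omega> \<in> space (P x)"
      then have \<omega>: "\<omega> \<in> paths" by simp
      show "indicator ?A \<omega> * ext0 (semigroup P (m - b) f) (\<omega> (t + b)) =
        indicator A \<omega> * indicator (cylinder J B) (shift t \<omega>) * ext0 ?g (\<omega> (t + b))"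
        unfolding A_eq[OF \<omega>] split ext[symmetric]
        using b by (simp add: shift_apply add.commute[of b t] mult_ac)
    qed
    finally show ?thesis .
  qed
  show ?case unfolding one using IH two by simp
qed

lemma markov_cylinder_event:
  assumes J: "finite J" "J \<subseteq> {0..}" "\<forall>s\<in>J. B s \<in> sets borel"
  shows "(\<lambda>y. emeasure (P y) (cylinder J B)) \<in> borel_measurable borel \<and>
    (\<forall>x. \<forall>t\<ge>0. \<forall>A\<in>sets (raw_filtration t).
      emeasure (P x) {\<omega> \<in> A. \<omega> t \<noteq> None \<and> shift t \<omega> \<in> cylinder J B} =
      (\<integral>\<^sup>+ \<omega>. indicator A \<omega> * ext0 (\<lambda>y. emeasure (P y) (cylinder J B)) (\<omega> t) \<partial>P x))"
proof -
  define C where "C = cylinder J B"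
  have C_raw: "C \<in> sets raw_events"
    unfolding sets_raw_events_cylinder C_def using J by (intro sigma_sets.Basic) blast
  have meas: "{\<omega> \<in> A. \<omega> t \<noteq> None \<and> shift t \<omega> \<in> C} \<in> sets (P x)"
    if "0 \<le> t" "A \<in> sets (raw_filtration t)" for x t A
    using future_event_raw_events[OF that C_raw] by simp
  have "(\<lambda>y. emeasure (P y) C) \<in> borel_measurable borel \<and>
    (\<forall>x. \<forall>t\<ge>0. \<forall>A\<in>sets (raw_filtration t).
      emeasure (P x) {\<omega> \<in> A. \<omega> t \<noteq> None \<and> shift t \<omega> \<in> C} =
      (\<integral>\<^sup>+ \<omega>. indicator A \<omega> * ext0 (\<lambda>y. emeasure (P y) C) (\<omega> t) \<partial>P x))"
  proof (cases "J = {}")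
    case True
    then have [simp]: "C = paths" by (simp add: C_def cylinder_def)
    have "emeasure (P x) {\<omega> \<in> A. \<omega> t \<noteq> None \<and> shift t \<omega> \<in> C} =
        (\<integral>\<^sup>+ \<omega>. indicator A \<omega> * ext0 (\<lambda>y. emeasure (P y) C) (\<omega> t) \<partial>P x)"
      if t: "0 \<le> t" "A \<in> sets (raw_filtration t)" for x t A
      unfolding nn_integral_indicator[OF meas[OF that], symmetric]
      using t by (intro nn_integral_cong) (auto simp: indicator_def shift_paths ext0_def split: option.splits)
    then show ?thesis by simp
  next
    case False
    define m where "m = Max J"
    have m: "m \<in> J" "\<And>s. s \<in> J \<Longrightarrow> s \<le> m" using J False by (auto simp: m_def)
    then have "0 \<le> m" using J by auto
    have ind: "indicator C \<omega> * ext0 (\<lambda>_. 1) (\<omega> m) = (indicator C \<omega> :: ennreal)" for \<omega>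
      using m(1) by (auto simp: C_def cylinder_def indicator_def)
    have *: "(\<integral>\<^sup>+ \<omega>. indicator C \<omega> * ext0 (\<lambda>_. 1) (\<omega> m) \<partial>P y) = emeasure (P y) C" for y
      unfolding ind using C_raw by (intro nn_integral_indicator) simp
    have mc: "(\<lambda>y. emeasure (P y) C) \<in> borel_measurable borel \<and>
      (\<forall>x. \<forall>t\<ge>0. \<forall>A\<in>sets (raw_filtration t).
        (\<integral>\<^sup>+ \<omega>. indicator A \<omega> * indicator C (shift t \<omega>) * ext0 (\<lambda>_. 1) (\<omega> (t + m)) \<partial>P x) =
        (\<integral>\<^sup>+ \<omega>. indicator A \<omega> * ext0 (\<lambda>y. emeasure (P y) C) (\<omega> t) \<partial>P x))"
      by (rule markov_cylinder[of J B m "\<lambda>_. 1", folded C_def, unfolded *]) (use J m \<open>0 \<le> m\<close> in auto)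
    have "emeasure (P x) {\<omega> \<in> A. \<omega> t \<noteq> None \<and> shift t \<omega> \<in> C} =
        (\<integral>\<^sup>+ \<omega>. indicator A \<omega> * ext0 (\<lambda>y. emeasure (P y) C) (\<omega> t) \<partial>P x)"
      if t: "0 \<le> t" "A \<in> sets (raw_filtration t)" for x t A
    proof -
      have "emeasure (P x) {\<omega> \<in> A. \<omega> t \<noteq> None \<and> shift t \<omega> \<in> C} =
        (\<integral>\<^sup>+ \<omega>. indicator {\<omega> \<in> A. \<omega> t \<noteq> None \<and> shift t \<omega> \<in> C} \<omega> \<partial>P x)"
        using meas[OF t] by simp
      also have "\<dots> = (\<integral>\<^sup>+ \<omega>. indicator A \<omega> * indicator C (shift t \<omega>) * ext0 (\<lambda>_. 1) (\<omega> (t + m)) \<partial>P x)"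
      proof (intro nn_integral_cong)
        fix \<omega> assume "\<omega> \<in> space (P x)"
        then have \<omega>: "\<omega> \<in> paths" by simp
        have alive: "\<omega> (t + m) \<noteq> None" "\<omega> t \<noteq> None" if "shift t \<omega> \<in> C"
        proof -
          have "shift t \<omega> m \<noteq> None" using that m(1) by (auto simp: C_def cylinder_def)
          then show "\<omega> (t + m) \<noteq> None" using \<open>0 \<le> m\<close> by (simp add: shift_apply add.commute)
          then show "\<omega> t \<noteq> None" using path_absorbed[OF \<omega> t(1), of "t + m"] \<open>0 \<le> m\<close>
            by (cases "\<omega> t") auto
        qed
        show "indicator {\<omega> \<in> A. \<omega> t \<noteq> None \<and> shift t \<omega> \<in> C} \<omega> =
            indicator A \<omega> * indicator C (shift t \<omega>) * ext0 (\<lambda>_. 1 :: ennreal) (\<omega> (t + m))"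
        proof (cases "shift t \<omega> \<in> C")
          case True
          with alive obtain y z where "\<omega> (t + m) = Some y" "\<omega> t = Some z" by blast
          with True show ?thesis by (simp add: indicator_def)
        qed simp
      qed
      also have "\<dots> = (\<integral>\<^sup>+ \<omega>. indicator A \<omega> * ext0 (\<lambda>y. emeasure (P y) C) (\<omega> t) \<partial>P x)"
        by (rule mc[THEN conjunct2, rule_format, OF t])
      finally show ?thesis .
    qed
    then show ?thesis by (intro conjI[OF conjunct1[OF mc]] allI impI ballI)
  qed
  then show ?thesis unfolding C_def .
qed

end


section \<open>Completed events\<close>

lemma borel_measurable_completion_cong_AE:
  fixes f g :: "'b \<Rightarrow> ennreal"
  assumes g: "g \<in> borel_measurable (completion M)" and eq: "AE x in M. f x = g x"
  shows "f \<in> borel_measurable (completion M)"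
proof (rule measurableI)
  fix V :: "ennreal set" assume V: "V \<in> sets borel"
  obtain N where N: "N \<in> null_sets M" "{x \<in> space M. f x \<noteq> g x} \<subseteq> N"
    using eq unfolding eventually_ae_filter by auto
  have eq: "f -` V \<inter> space (completion M) =
      (g -` V \<inter> space (completion M) - N) \<union> (f -` V \<inter> space M \<inter> N)"
    using N(2) by auto
  have "g -` V \<inter> space (completion M) \<in> sets (completion M)"
    using measurable_sets[OF g V] .
  moreover have "f -` V \<inter> space M \<inter> N \<in> sets (completion M)"
    by (rule null_sets_completion[OF N(1)]) auto
  moreover have "N \<in> sets (completion M)" using N(1) by auto
  ultimately show "f -` V \<inter> space (completion M) \<in> sets (completion M)"
    unfolding eq by (intro sets.Un sets.Diff)
qed simp

definition alive_or :: "'a \<Rightarrow> 'a option \<Rightarrow> 'a" where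
  "alive_or c z = (case z of None \<Rightarrow> c | Some y \<Rightarrow> y)"

lemma alive_or_measurable[measurable]:
  "alive_or c \<in> borel \<rightarrow>\<^sub>M (borel :: 'a::topological_space measure)"
proof (rule measurableI)
  fix V :: "'a set" assume V: "V \<in> sets borel"
  have eq: "alive_or c -` V \<inter> space borel = Some ` V \<union> (if c \<in> V then {None} else {})"
    (is "?l = ?r")
  proof (rule set_eqI)
    show "z \<in> ?l \<longleftrightarrow> z \<in> ?r" for z by (cases z) (auto simp: alive_or_def)
  qed
  have "(if c \<in> V then {None} else {} :: 'a option set) \<in> sets borel" by auto
  with image_Some_borel[OF V] show "alive_or c -` V \<inter> space borel \<in> sets borel"
    unfolding eq by (rule sets.Un)
qed simp

text \<open>A path that is dead at time \<open>t\<close> counts \<open>0\<close>, in agreement with the extension of functions on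
  the state space by \<open>0\<close>.\<close>

definition future :: "real \<Rightarrow> ('a path \<Rightarrow> ennreal) \<Rightarrow> 'a path \<Rightarrow> ennreal" where
  "future t G \<omega> = (if \<omega> t = None then 0 else G (shift t \<omega>))"

lemma alive_raw_events:
  "0 \<le> t \<Longrightarrow> {\<omega> \<in> paths. \<omega> t \<noteq> None} \<in> sets (raw_events :: 'a::topological_space path measure)"
proof -
  assume t: "0 \<le> t"
  have "(\<lambda>\<omega>. \<omega> t) -` (- {None}) \<inter> space raw_events \<in> sets (raw_events :: 'a path measure)"
    by (rule measurable_sets[OF coordinate_raw_events[OF t]])
      (auto intro: borel_comp singleton_None_borel)
  moreover have "(\<lambda>\<omega>. \<omega> t) -` (- {None}) \<inter> space raw_events = {\<omega> \<in> (paths :: 'a path set). \<omega> t \<noteq> None}"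
    by auto
  ultimately show ?thesis by simp
qed

lemma future_raw_measurable:
  assumes "0 \<le> t" and G: "G \<in> borel_measurable raw_events"
  shows "future t G \<in> borel_measurable (raw_events :: 'a::topological_space path measure)"
proof -
  have "(\<lambda>\<omega>. indicator {\<omega> \<in> paths. \<omega> t \<noteq> None} \<omega> * G (shift t \<omega>)) \<in> borel_measurable raw_events"
    using assms alive_raw_events[of t]
    by (intro borel_measurable_times_ennreal borel_measurable_indicator
        measurable_compose[OF shift_raw_events G]) auto
  moreover have "indicator {\<omega> \<in> paths. \<omega> t \<noteq> None} \<omega> * G (shift t \<omega>) = future t G \<omega>"
    if "\<omega> \<in> space raw_events" for \<omega>
    using that by (auto simp: future_def indicator_def)
  ultimately show ?thesis by (rule measurable_cong[THEN iffD1, rotated])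
qed

context borel_right
begin

lemma P_kernel: "P \<in> borel \<rightarrow>\<^sub>M subprob_algebra raw_events"
proof (rule measurable_subprob_algebra_generated[OF sets_raw_events_cylinder Int_stable_cylinder cylinder_Pow])
  show "subprob_space (P y)" for y by (rule prob_space_imp_subprob_space[OF prob_space_P])
qed (use markov_cylinder_event in auto)

lemma emeasure_P_borel[measurable]:
  "C \<in> sets raw_events \<Longrightarrow> (\<lambda>y. emeasure (P y) C) \<in> borel_measurable borel"
  by (rule measurable_compose[OF P_kernel measurable_emeasure_subprob_algebra])

lemma nn_integral_P_borel:
  "G \<in> borel_measurable raw_events \<Longrightarrow> (\<lambda>y. \<integral>\<^sup>+ \<omega>. G \<omega> \<partial>P y) \<in> borel_measurable borel"
  using measurable_compose[OF P_kernel nn_integral_measurable_subprob_algebra] .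

text \<open>As functions of \<open>G\<close> both sides are integrals against finite measures, which agree on
  cylinders.\<close>

lemma markov_raw:
  assumes t: "0 \<le> t" and A: "A \<in> sets (raw_filtration t)" and G: "G \<in> borel_measurable raw_events"
  shows "(\<integral>\<^sup>+ \<omega>. indicator A \<omega> * future t G \<omega> \<partial>P x) =
         (\<integral>\<^sup>+ \<omega>. indicator A \<omega> * ext0 (\<lambda>y. \<integral>\<^sup>+ \<omega>. G \<omega> \<partial>P y) (\<omega> t) \<partial>P x)"
proof -
  define \<kappa> where "\<kappa> z = (case z of None \<Rightarrow> null_measure raw_events | Some y \<Rightarrow> P y)" for z
  have sets_\<kappa>: "sets (\<kappa> z) = sets raw_events" and em_\<kappa>: "emeasure (\<kappa> z) C = ext0 (\<lambda>y. emeasure (P y) C) z" for z C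
    by (cases z; simp add: \<kappa>_def)+
  have "\<kappa> \<in> borel \<rightarrow>\<^sub>M subprob_algebra raw_events"
  proof (rule measurable_subprob_algebra[OF _ sets_\<kappa>])
    show "subprob_space (\<kappa> z)" for z
      using prob_space_imp_subprob_space[OF prob_space_P] dead_path
      by (cases z) (auto simp: \<kappa>_def intro!: subprob_spaceI)
    show "(\<lambda>z. emeasure (\<kappa> z) C) \<in> borel_measurable borel" if "C \<in> sets raw_events" for C
      unfolding em_\<kappa> by (rule ext0_borel_measurable[OF emeasure_P_borel[OF that]])
  qed
  from measurable_compose[OF coordinate_raw_events[OF t] this]
  have kernel: "(\<lambda>\<omega>. \<kappa> (\<omega> t)) \<in> density (P x) (indicator A) \<rightarrow>\<^sub>M subprob_algebra raw_events"
    by simp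
  have A': "A \<in> sets (P x)" by (rule raw_filtration_P[OF A])
  define alive where "alive = (\<lambda>\<omega>. indicator (A \<inter> {\<omega> \<in> paths. \<omega> t \<noteq> None}) \<omega> :: ennreal)"
  have "A \<inter> {\<omega> \<in> paths. \<omega> t \<noteq> None} \<in> sets (P x)" using A' alive_raw_events[OF t] by auto
  then have alive: "alive \<in> borel_measurable (P x)" unfolding alive_def by simp
  have shift: "shift t \<in> density (P x) alive \<rightarrow>\<^sub>M raw_events"
    using measurable_cong_sets[OF sets_density refl] shift_raw_events[OF t]
      measurable_cong_sets[OF sets_P[of x] refl] by blast
  define \<nu> where "\<nu> = distr (density (P x) alive) raw_events (shift t)"
  define \<nu>' where "\<nu>' = density (P x) (indicator A) \<bind> (\<lambda>\<omega>. \<kappa> (\<omega> t))"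
  have ne: "space (density (P x) (indicator A)) \<noteq> {}" using dead_path by auto
  have int_\<nu>: "(\<integral>\<^sup>+ \<omega>. F \<omega> \<partial>\<nu>) = (\<integral>\<^sup>+ \<omega>. indicator A \<omega> * future t F \<omega> \<partial>P x)"
    if F: "F \<in> borel_measurable raw_events" for F
  proof -
    have "(\<integral>\<^sup>+ \<omega>. F \<omega> \<partial>\<nu>) = (\<integral>\<^sup>+ \<omega>. F (shift t \<omega>) \<partial>density (P x) alive)"
      unfolding \<nu>_def using F by (intro nn_integral_distr shift) simp
    also have "\<dots> = (\<integral>\<^sup>+ \<omega>. alive \<omega> * F (shift t \<omega>) \<partial>P x)"
      using measurable_compose[OF shift_raw_events[OF t] F] by (intro nn_integral_density alive) simp
    also have "\<dots> = (\<integral>\<^sup>+ \<omega>. indicator A \<omega> * future t F \<omega> \<partial>P x)"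
      by (intro nn_integral_cong) (auto simp: alive_def future_def indicator_def)
    finally show ?thesis .
  qed
  have int_\<nu>': "(\<integral>\<^sup>+ \<omega>. F \<omega> \<partial>\<nu>') = (\<integral>\<^sup>+ \<omega>. indicator A \<omega> * ext0 (\<lambda>y. \<integral>\<^sup>+ \<omega>. F \<omega> \<partial>P y) (\<omega> t) \<partial>P x)"
    if F: "F \<in> borel_measurable raw_events" for F
  proof -
    have \<kappa>_int: "(\<integral>\<^sup>+ \<omega>. F \<omega> \<partial>\<kappa> z) = ext0 (\<lambda>y. \<integral>\<^sup>+ \<omega>. F \<omega> \<partial>P y) z" for z
      by (cases z) (simp_all add: \<kappa>_def)
    have "(\<integral>\<^sup>+ \<omega>. F \<omega> \<partial>\<nu>') = (\<integral>\<^sup>+ \<omega>. ext0 (\<lambda>y. \<integral>\<^sup>+ \<omega>. F \<omega> \<partial>P y) (\<omega> t) \<partial>density (P x) (indicator A))"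
      unfolding \<nu>'_def using nn_integral_bind[OF F kernel] by (simp add: \<kappa>_int)
    also have "\<dots> = (\<integral>\<^sup>+ \<omega>. indicator A \<omega> * ext0 (\<lambda>y. \<integral>\<^sup>+ \<omega>. F \<omega> \<partial>P y) (\<omega> t) \<partial>P x)"
      using measurable_compose[OF coordinate_raw_events[OF t] ext0_borel_measurable[OF nn_integral_P_borel[OF F]]] A'
      by (intro nn_integral_density) simp_all
    finally show ?thesis .
  qed
  have "\<nu> = \<nu>'"
  proof (rule measure_eqI_generator_eq[OF Int_stable_cylinder cylinder_Pow, where A="\<lambda>_ :: nat. paths"])
    have sets_\<nu>': "sets \<nu>' = sets raw_events" unfolding \<nu>'_def by (rule sets_bind[OF _ ne]) (rule sets_\<kappa>)
    have "cylinder {} (\<lambda>_. {}) = (paths :: 'a path set)" by (simp add: cylinder_def)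
    then show "range (\<lambda>_. paths) \<subseteq> {cylinder J B | J B. finite J \<and> J \<subseteq> {0..} \<and> (\<forall>s\<in>J. B s \<in> sets (borel :: 'a measure))}"
      by (auto intro!: exI[of _ "{}"])
    show "sets \<nu> = sigma_sets paths {cylinder J B | J B. finite J \<and> J \<subseteq> {0..} \<and> (\<forall>s\<in>J. B s \<in> sets borel)}"
      "sets \<nu>' = sigma_sets paths {cylinder J B | J B. finite J \<and> J \<subseteq> {0..} \<and> (\<forall>s\<in>J. B s \<in> sets borel)}"
      unfolding sets_\<nu>' by (simp_all add: \<nu>_def sets_raw_events_cylinder)
    show "emeasure \<nu> C = emeasure \<nu>' C"
      if cyl: "C \<in> {cylinder J B | J B. finite J \<and> J \<subseteq> {0..} \<and> (\<forall>s\<in>J. B s \<in> sets borel)}" for C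
    proof -
      have C: "C \<in> sets raw_events" unfolding sets_raw_events_cylinder using cyl by (rule sigma_sets.Basic)
      let ?S = "{\<omega> \<in> A. \<omega> t \<noteq> None \<and> shift t \<omega> \<in> C}"
      have ind: "indicator C \<in> borel_measurable raw_events" using C by simp
      have "emeasure \<nu> C = (\<integral>\<^sup>+ \<omega>. indicator C \<omega> \<partial>\<nu>)" using C by (simp add: \<nu>_def)
      also have "\<dots> = (\<integral>\<^sup>+ \<omega>. indicator ?S \<omega> \<partial>P x)"
        unfolding int_\<nu>[OF ind] by (intro nn_integral_cong) (auto simp: future_def indicator_def)
      also have "\<dots> = emeasure (P x) ?S"
        using future_event_raw_events[OF t A C] by (intro nn_integral_indicator) simp
      also have "\<dots> = (\<integral>\<^sup>+ \<omega>. indicator A \<omega> * ext0 (\<lambda>y. emeasure (P y) C) (\<omega> t) \<partial>P x)"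
        using cyl markov_cylinder_event t A by blast
      also have "\<dots> = (\<integral>\<^sup>+ \<omega>. indicator C \<omega> \<partial>\<nu>')" unfolding int_\<nu>'[OF ind] using C by simp
      also have "\<dots> = emeasure \<nu>' C" using C sets_\<nu>' by simp
      finally show ?thesis .
    qed
    have "emeasure \<nu> paths = emeasure (density (P x) alive) paths"
      unfolding \<nu>_def by (subst emeasure_distr[OF shift]) (auto simp: shift_paths t sets.top[of raw_events, simplified] intro!: arg_cong2[where f=emeasure])
    also have "\<dots> = (\<integral>\<^sup>+ \<omega>. alive \<omega> * indicator paths \<omega> \<partial>P x)"
      using sets.top[of "P x"] by (intro emeasure_density[OF alive]) simp
    also have "\<dots> \<le> (\<integral>\<^sup>+ \<omega>. 1 \<partial>P x)"
      by (intro nn_integral_mono) (simp add: alive_def indicator_def)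
    finally have "emeasure \<nu> paths \<le> 1" by simp
    then show "emeasure \<nu> paths \<noteq> \<infinity>" by (auto simp: top_unique)
    show "(\<Union>n::nat. paths) = (paths :: 'a path set)" by simp
  qed
  then show ?thesis using int_\<nu>[OF G] int_\<nu>'[OF G] by simp
qed

lemma law_init_eq_bind:
  assumes "\<mu> \<in> initial_laws"
  shows "law_init P \<mu> = \<mu> \<bind> P"
proof -
  have sets_\<mu>[measurable_cong]: "sets \<mu> = sets borel" and "prob_space \<mu>"
    using assms by (auto simp: initial_laws_def)
  then have ne: "space \<mu> \<noteq> {}" using sets_eq_imp_space_eq[OF sets_\<mu>] by simp
  have kernel: "P \<in> \<mu> \<rightarrow>\<^sub>M subprob_algebra raw_events"
    using P_kernel by (simp cong: measurable_cong_sets add: measurable_cong_sets[OF sets_\<mu> refl])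
  have "sets (\<mu> \<bind> P) = sets raw_events" "space (\<mu> \<bind> P) = paths"
    using sets_bind[OF _ ne, of P raw_events] space_bind[OF _ ne, of P raw_events] sets_P by auto
  then have "\<mu> \<bind> P = measure_of paths (sets raw_events) (emeasure (\<mu> \<bind> P))"
    using measure_of_of_measure[of "\<mu> \<bind> P"] by simp
  also have "\<dots> = law_init P \<mu>"
    unfolding law_init_def
  proof (rule measure_of_eq)
    fix A assume "A \<in> sigma_sets paths (sets (raw_events :: 'a path measure))"
    then have "A \<in> sets raw_events" using sets.sigma_sets_eq[of "raw_events :: 'a path measure"] by simp
    then show "emeasure (\<mu> \<bind> P) A = (\<integral>\<^sup>+ x. emeasure (P x) A \<partial>completion \<mu>)"
      using emeasure_bind[OF ne kernel] by (simp add: nn_integral_completion)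
  qed (use sets.space_closed[of raw_events] in auto)
  finally show ?thesis ..
qed

lemma
  assumes "\<mu> \<in> initial_laws"
  shows sets_law_init: "sets (law_init P \<mu>) = sets raw_events"
    and space_law_init: "space (law_init P \<mu>) = paths"
    and emeasure_law_init:
      "C \<in> sets raw_events \<Longrightarrow> emeasure (law_init P \<mu>) C = (\<integral>\<^sup>+ y. emeasure (P y) C \<partial>\<mu>)"
proof -
  have sets_\<mu>: "sets \<mu> = sets borel" using assms by (auto simp: initial_laws_def)
  then have ne: "space \<mu> \<noteq> {}" using sets_eq_imp_space_eq[OF sets_\<mu>] by simp
  have kernel: "P \<in> \<mu> \<rightarrow>\<^sub>M subprob_algebra raw_events"
    using P_kernel by (simp add: measurable_cong_sets[OF sets_\<mu> refl])
  show "sets (law_init P \<mu>) = sets raw_events" "space (law_init P \<mu>) = paths"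
    using sets_bind[OF _ ne, of P raw_events] space_bind[OF _ ne, of P raw_events]
    by (auto simp: law_init_eq_bind[OF assms])
  show "emeasure (law_init P \<mu>) C = (\<integral>\<^sup>+ y. emeasure (P y) C \<partial>\<mu>)" if "C \<in> sets raw_events"
    using emeasure_bind[OF ne kernel that] by (simp add: law_init_eq_bind[OF assms])
qed

lemma AE_law_init:
  assumes \<mu>: "\<mu> \<in> initial_laws" and ae: "AE \<omega> in law_init P \<mu>. Q \<omega>"
  shows "AE y in \<mu>. AE \<omega> in P y. Q \<omega>"
proof -
  obtain N where N: "N \<in> null_sets (law_init P \<mu>)" "{\<omega> \<in> paths. \<not> Q \<omega>} \<subseteq> N"
    using ae unfolding eventually_ae_filter space_law_init[OF \<mu>] by auto
  then have N_raw: "N \<in> sets raw_events" and "(\<integral>\<^sup>+ y. emeasure (P y) N \<partial>\<mu>) = 0"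
    using sets_law_init[OF \<mu>] emeasure_law_init[OF \<mu>, of N] by (auto simp: null_sets_def)
  moreover have "(\<lambda>y. emeasure (P y) N) \<in> borel_measurable \<mu>"
    using emeasure_P_borel[OF N_raw] \<mu> by (simp add: initial_laws_def measurable_cong_sets[of \<mu> borel])
  ultimately have "AE y in \<mu>. emeasure (P y) N = 0"
    by (simp add: nn_integral_0_iff_AE)
  then show ?thesis
  proof eventually_elim
    case (elim y)
    then have "N \<in> null_sets (P y)" using N_raw by (simp add: null_sets_def)
    then show ?case using N(2) unfolding eventually_ae_filter space_P by auto
  qed
qed

lemma return_initial_laws: "return borel x \<in> initial_laws"
  by (auto simp: initial_laws_def intro!: prob_space_return)

lemma law_init_return: "law_init P (return borel x) = P x"
  using bind_return[OF P_kernel, of x] by (simp add: law_init_eq_bind[OF return_initial_laws])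

text \<open>Null sets of the law of the future after time \<open>t\<close> are controlled through the law of \<open>X\<^sub>t\<close>; if
  the process is dead at time \<open>t\<close>, its position is replaced by the starting point, so that this
  is an initial law.\<close>

definition position_law :: "'a \<Rightarrow> real \<Rightarrow> 'a measure" where
  "position_law x t = distr (P x) borel (\<lambda>\<omega>. alive_or x (\<omega> t))"

lemma position_law_initial_laws:
  assumes "0 \<le> t" shows "position_law x t \<in> initial_laws"
proof -
  interpret prob_space "P x" by (rule prob_space_P)
  show ?thesis
    unfolding initial_laws_def position_law_def using assms
    by (auto intro!: prob_space_distr measurable_compose[OF coordinate_raw_events alive_or_measurable])
qed

lemma AE_position:
  assumes "0 \<le> t" "AE y in position_law x t. Q y"
  shows "AE \<omega> in P x. \<forall>y. \<omega> t = Some y \<longrightarrow> Q y"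
proof -
  have "AE \<omega> in P x. Q (alive_or x (\<omega> t))"
    using assms unfolding position_law_def
    by (intro AE_distrD[of "\<lambda>\<omega>. alive_or x (\<omega> t)" "P x" borel])
      (auto intro!: measurable_compose[OF coordinate_raw_events alive_or_measurable])
  then show ?thesis by eventually_elim (auto simp: alive_or_def)
qed

lemma AE_shift:
  assumes t: "0 \<le> t" and ae: "AE \<omega> in law_init P (position_law x t). Q \<omega>"
  shows "AE \<omega> in P x. \<omega> t \<noteq> None \<longrightarrow> Q (shift t \<omega>)"
proof -
  note \<mu> = position_law_initial_laws[OF t]
  obtain N where N: "N \<in> null_sets (law_init P (position_law x t))" "{\<omega> \<in> paths. \<not> Q \<omega>} \<subseteq> N"
    using ae unfolding eventually_ae_filter space_law_init[OF \<mu>] by auto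
  then have N_raw: "N \<in> sets raw_events" using sets_law_init[OF \<mu>] by auto
  have "AE \<omega> in law_init P (position_law x t). \<omega> \<notin> N" using N(1) by (rule AE_not_in)
  from AE_position[OF t AE_law_init[OF \<mu> this]]
  have "AE \<omega> in P x. ext0 (\<lambda>y. emeasure (P y) N) (\<omega> t) = 0"
  proof eventually_elim
    case (elim \<omega>)
    show ?case
    proof (cases "\<omega> t")
      case (Some y)
      with elim have "AE \<omega> in P y. \<omega> \<notin> N" by blast
      then have "emeasure (P y) N = 0"
        using AE_iff_null_sets[of N "P y"] N_raw by auto
      then show ?thesis using Some by simp
    qed simp
  qed
  then have "(\<integral>\<^sup>+ \<omega>. indicator paths \<omega> * ext0 (\<lambda>y. emeasure (P y) N) (\<omega> t) \<partial>P x) = (\<integral>\<^sup>+ \<omega>. 0 \<partial>P x)"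
    by (intro nn_integral_cong_AE) (auto elim!: eventually_mono)
  moreover have "paths \<in> sets (raw_filtration t)"
    using sets.top[of "raw_filtration t"] by simp
  moreover have ind: "indicator N \<in> borel_measurable raw_events" using N_raw by simp
  ultimately have "(\<integral>\<^sup>+ \<omega>. indicator paths \<omega> * future t (indicator N) \<omega> \<partial>P x) = 0"
    using markov_raw[OF t, of paths "indicator N" x] N_raw by simp
  moreover have "(\<integral>\<^sup>+ \<omega>. indicator paths \<omega> * future t (indicator N) \<omega> \<partial>P x) = (\<integral>\<^sup>+ \<omega>. future t (indicator N) \<omega> \<partial>P x)"
    by (intro nn_integral_cong) simp
  ultimately have "AE \<omega> in P x. future t (indicator N) \<omega> = 0"
    using future_raw_measurable[OF t ind] by (simp add: nn_integral_0_iff_AE)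
  then show ?thesis
    using AE_space[of "P x"]
  proof eventually_elim
    case (elim \<omega>)
    then show ?case using N(2) shift_paths[OF _ t, of \<omega>] by (auto simp: future_def indicator_def split: if_splits)
  qed
qed

lemma universally_measurable_at:
  assumes t: "0 \<le> t" and f: "universally_measurable f"
  shows "(\<lambda>\<omega>. ext0 f (\<omega> t)) \<in> borel_measurable (completion (P x))"
proof -
  note \<mu> = position_law_initial_laws[OF t]
  have "f \<in> borel_measurable (completion (position_law x t))"
    using f \<mu> by (auto simp: universally_measurable_def)
  then obtain g where g: "g \<in> borel_measurable (position_law x t)" "AE y in position_law x t. f y = g y"
    using completion_ex_borel_measurable by blast
  have "g \<in> borel_measurable borel"
    using g(1) by (simp add: position_law_def)
  then have "(\<lambda>\<omega>. ext0 g (\<omega> t)) \<in> borel_measurable (P x)"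
    using t by (intro measurable_compose[OF _ ext0_borel_measurable]) (simp_all add: coordinate_raw_events)
  moreover have "AE \<omega> in P x. ext0 f (\<omega> t) = ext0 g (\<omega> t)"
    using AE_position[OF t g(2)]
  proof eventually_elim
    case (elim \<omega>)
    then show ?case by (cases "\<omega> t") auto
  qed
  ultimately show ?thesis
    by (intro borel_measurable_completion_cong_AE[OF measurable_completion])
qed

lemma space_events[simp]: "space (events P) = paths"
  by (simp add: events_def space_measure_of_conv)

lemma sets_events: "sets (events P) = (\<Inter>\<mu>\<in>initial_laws. sets (completion (law_init P \<mu>)))"
proof -
  let ?I = "\<Inter>\<mu>\<in>initial_laws. sets (completion (law_init P \<mu>))"
  have sub: "?I \<subseteq> Pow paths"
  proof
    fix A assume "A \<in> ?I"
    then have "A \<in> sets (completion (law_init P (return borel undefined)))"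
      using return_initial_laws by blast
    from sets.sets_into_space[OF this] show "A \<in> Pow paths"
      by (simp add: space_law_init[OF return_initial_laws])
  qed
  have "sigma_sets paths ?I \<subseteq> sets (completion (law_init P \<mu>))" if \<mu>: "\<mu> \<in> initial_laws" for \<mu>
    using sets.sigma_sets_subset[of ?I "completion (law_init P \<mu>)"] \<mu>
    by (auto simp: space_law_init[OF \<mu>])
  then have "sigma_sets paths ?I = ?I" by blast
  then show ?thesis unfolding events_def using sub by (subst sets_measure_of) auto
qed

lemma measurable_events_law_init:
  assumes "\<mu> \<in> initial_laws" "f \<in> events P \<rightarrow>\<^sub>M N"
  shows "f \<in> completion (law_init P \<mu>) \<rightarrow>\<^sub>M N"
  using measurable_mono[of N N "events P" "completion (law_init P \<mu>)"] assms
  by (auto simp: sets_events space_law_init)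

lemma measurable_events_P: "f \<in> events P \<rightarrow>\<^sub>M N \<Longrightarrow> f \<in> completion (P x) \<rightarrow>\<^sub>M N"
  using measurable_events_law_init[OF return_initial_laws[of x]] unfolding law_init_return .

lemma sets_events_P:
  assumes "A \<in> sets (events P)" shows "A \<in> sets (completion (P x))"
proof -
  have "A \<in> sets (completion (law_init P (return borel x)))"
    using assms[unfolded sets_events] return_initial_laws by (rule INT_D)
  then show ?thesis by (simp only: law_init_return)
qed

lemma completed_filtration_subset_events:
  "sets (completed_filtration P t) \<subseteq> sets (events P)"
proof -
  let ?I = "\<Inter>\<mu>\<in>initial_laws. sigma_sets paths
    (sets (raw_filtration t) \<union> null_sets (completion (law_init P \<mu>)))"
  have I: "?I \<subseteq> sets (completion (law_init P \<mu>))" if \<mu>: "\<mu> \<in> initial_laws" for \<mu>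
  proof -
    have "sets (raw_filtration t) \<union> null_sets (completion (law_init P \<mu>)) \<subseteq> sets (completion (law_init P \<mu>))"
      using raw_filtration_subset_raw_events[of t] sets_law_init[OF \<mu>] by auto
    from sets.sigma_sets_subset[OF this] \<mu> show ?thesis
      by (auto simp: space_law_init[OF \<mu>])
  qed
  then have "?I \<subseteq> sets (events P)" unfolding sets_events by blast
  moreover from this have "?I \<subseteq> Pow paths"
    using sets.space_closed[of "events P"] by auto
  ultimately show ?thesis
    unfolding completed_filtration_def
    using sets.sigma_sets_subset[of ?I "events P"] by (simp add: sets_measure_of)
qed

lemma space_completed_filtration[simp]: "space (completed_filtration P t) = paths"
  by (simp add: completed_filtration_def space_measure_of_conv)

lemma measurable_completed_filtration_events:
  "f \<in> completed_filtration P t \<rightarrow>\<^sub>M N \<Longrightarrow> f \<in> events P \<rightarrow>\<^sub>M N"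
  using measurable_mono[of N N "completed_filtration P t" "events P"] completed_filtration_subset_events
  by auto

text \<open>The events that agree with an event of the raw filtration up to a \<open>P x\<close>-null set form a
  \<open>\<sigma>\<close>-field, which contains the generator of the completed filtration.\<close>

lemma completed_filtration_raw:
  assumes "A \<in> sets (completed_filtration P t)"
  shows "\<exists>B\<in>sets (raw_filtration t). AE \<omega> in P x. \<omega> \<in> A \<longleftrightarrow> \<omega> \<in> B"
proof -
  let ?I = "\<Inter>\<mu>\<in>initial_laws. sigma_sets paths
    (sets (raw_filtration t) \<union> null_sets (completion (law_init P \<mu>)))"
  let ?G = "sets (raw_filtration t) \<union> null_sets (completion (P x))"
  have I: "?I \<subseteq> sigma_sets paths ?G"
    using INT_lower[OF return_initial_laws[of x],
        of "\<lambda>\<mu>. sigma_sets paths (sets (raw_filtration t) \<union> null_sets (completion (law_init P \<mu>)))"]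
    unfolding law_init_return .
  have G: "?G \<subseteq> Pow paths"
    using sets.space_closed[of "raw_filtration t"] sets.space_closed[of "completion (P x)"] by auto
  interpret sigma_algebra paths "sigma_sets paths ?G"
    using G by (rule sigma_algebra_sigma_sets)
  have "?I \<subseteq> Pow paths" using I space_closed by blast
  then have "A \<in> sigma_sets paths ?I"
    using assms unfolding completed_filtration_def by (simp add: sets_measure_of)
  then have "A \<in> sigma_sets paths ?G"
    using sigma_sets_subset[OF I] by blast
  then show ?thesis
  proof induction
    case (Basic A)
    then show ?case
    proof
      assume "A \<in> null_sets (completion (P x))"
      then have "AE \<omega> in P x. \<omega> \<notin> A"
        using AE_not_in[of A "completion (P x)"] by (simp add: AE_completion_iff)
      then show ?thesis by (intro bexI[of _ "{}"]) auto
    qed (auto intro!: bexI[of _ A])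
  next
    case (Compl A)
    then obtain B where B: "B \<in> sets (raw_filtration t)" "AE \<omega> in P x. \<omega> \<in> A \<longleftrightarrow> \<omega> \<in> B" by auto
    from B(2) have "AE \<omega> in P x. \<omega> \<in> paths - A \<longleftrightarrow> \<omega> \<in> paths - B" by eventually_elim auto
    moreover have "paths - B \<in> sets (raw_filtration t)" using sets.compl_sets[OF B(1)] by simp
    ultimately show ?case by blast
  next
    case (Union A)
    then obtain B where B: "\<And>i. B i \<in> sets (raw_filtration t)" "\<And>i. AE \<omega> in P x. \<omega> \<in> A i \<longleftrightarrow> \<omega> \<in> B i"
      by metis
    have "AE \<omega> in P x. \<forall>i. \<omega> \<in> A i \<longleftrightarrow> \<omega> \<in> B i" using B(2) by (simp add: AE_all_countable)
    then have "AE \<omega> in P x. \<omega> \<in> (\<Union>i. A i) \<longleftrightarrow> \<omega> \<in> (\<Union>i. B i)" by eventually_elim auto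
    moreover have "(\<Union>i. B i) \<in> sets (raw_filtration t)" using B(1) by auto
    ultimately show ?case by blast
  qed auto
qed

text \<open>By the previous lemma the densities \<open>f\<close> and \<open>g\<close> define the same measure on the completed
  filtration.\<close>

lemma integral_eq_completed_filtration:
  assumes raw: "\<And>A. A \<in> sets (raw_filtration t) \<Longrightarrow>
      (\<integral>\<^sup>+ \<omega>. indicator A \<omega> * f \<omega> \<partial>P x) = (\<integral>\<^sup>+ \<omega>. indicator A \<omega> * g \<omega> \<partial>P x)"
    and f: "f \<in> borel_measurable (completion (P x))"
    and g: "g \<in> borel_measurable (completion (P x))"
    and Z: "Z \<in> borel_measurable (completed_filtration P t)"
  shows "(\<integral>\<^sup>+ \<omega>. Z \<omega> * f \<omega> \<partial>P x) = (\<integral>\<^sup>+ \<omega>. Z \<omega> * g \<omega> \<partial>P x)"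
proof -
  let ?Q = "completion (P x)" and ?F = "completed_filtration P t"
  have id: "(\<lambda>\<omega>. \<omega>) \<in> density ?Q h \<rightarrow>\<^sub>M ?F" for h
    using measurable_events_P[OF measurable_completed_filtration_events[OF measurable_ident_sets[OF refl]]] by simp
  have ZQ: "Z \<in> borel_measurable ?Q"
    by (rule measurable_events_P[OF measurable_completed_filtration_events[OF Z]])
  have em: "emeasure (distr (density ?Q h) ?F (\<lambda>\<omega>. \<omega>)) A = (\<integral>\<^sup>+ \<omega>. indicator A \<omega> * h \<omega> \<partial>P x)"
    if h: "h \<in> borel_measurable ?Q" and A: "A \<in> sets ?F" for h A
  proof -
    have "A \<in> sets ?Q" using A completed_filtration_subset_events sets_events_P by blast
    then have "emeasure (density ?Q h) A = (\<integral>\<^sup>+ \<omega>. h \<omega> * indicator A \<omega> \<partial>?Q)"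
      by (rule emeasure_density[OF h])
    moreover have "(\<lambda>\<omega>. \<omega>) -` A \<inter> space (density ?Q h) = A" using sets.sets_into_space[OF A] by auto
    ultimately show ?thesis
      using emeasure_distr[OF id A, of h] by (simp add: nn_integral_completion mult.commute)
  qed
  have eq: "distr (density ?Q f) ?F (\<lambda>\<omega>. \<omega>) = distr (density ?Q g) ?F (\<lambda>\<omega>. \<omega>)"
  proof (rule measure_eqI)
    fix A assume "A \<in> sets (distr (density ?Q f) ?F (\<lambda>\<omega>. \<omega>))"
    then have A: "A \<in> sets ?F" by simp
    obtain B where B: "B \<in> sets (raw_filtration t)" "AE \<omega> in P x. \<omega> \<in> A \<longleftrightarrow> \<omega> \<in> B"
      using completed_filtration_raw[OF A] by blast
    have "(\<integral>\<^sup>+ \<omega>. indicator A \<omega> * h \<omega> \<partial>P x) = (\<integral>\<^sup>+ \<omega>. indicator B \<omega> * h \<omega> \<partial>P x)" for h :: "'a path \<Rightarrow> ennreal"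
      using B(2) by (intro nn_integral_cong_AE) (auto simp: indicator_def elim!: eventually_mono)
    then show "emeasure (distr (density ?Q f) ?F (\<lambda>\<omega>. \<omega>)) A = emeasure (distr (density ?Q g) ?F (\<lambda>\<omega>. \<omega>)) A"
      unfolding em[OF f A] em[OF g A] using raw[OF B(1)] by simp
  qed simp
  have int: "(\<integral>\<^sup>+ \<omega>. Z \<omega> \<partial>distr (density ?Q h) ?F (\<lambda>\<omega>. \<omega>)) = (\<integral>\<^sup>+ \<omega>. Z \<omega> * h \<omega> \<partial>P x)"
    if h: "h \<in> borel_measurable ?Q" for h
  proof -
    have "(\<integral>\<^sup>+ \<omega>. Z \<omega> \<partial>distr (density ?Q h) ?F (\<lambda>\<omega>. \<omega>)) = (\<integral>\<^sup>+ \<omega>. h \<omega> * Z \<omega> \<partial>?Q)"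
      using Z by (subst nn_integral_distr[OF id]) (simp_all add: nn_integral_density[OF h ZQ])
    then show ?thesis by (simp add: nn_integral_completion mult.commute)
  qed
  show ?thesis by (rule int[OF f, unfolded eq int[OF g], symmetric])
qed


lemma measurable_eventsI:
  assumes "f \<in> paths \<rightarrow> space N"
    and "\<And>\<mu>. \<mu> \<in> initial_laws \<Longrightarrow> f \<in> completion (law_init P \<mu>) \<rightarrow>\<^sub>M N"
  shows "f \<in> events P \<rightarrow>\<^sub>M N"
proof (rule measurableI)
  show "f \<omega> \<in> space N" if "\<omega> \<in> space (events P)" for \<omega> using assms(1) that by auto
  fix B assume B: "B \<in> sets N"
  have "f -` B \<inter> paths \<in> sets (completion (law_init P \<mu>))" if \<mu>: "\<mu> \<in> initial_laws" for \<mu>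
    using measurable_sets[OF assms(2)[OF \<mu>] B] by (simp add: space_law_init[OF \<mu>])
  then show "f -` B \<inter> space (events P) \<in> sets (events P)" unfolding sets_events space_events by blast
qed

lemma events_measurable_approx:
  assumes \<mu>: "\<mu> \<in> initial_laws" and G: "G \<in> borel_measurable (events P)"
  obtains G' :: "'a path \<Rightarrow> ennreal" where "G' \<in> borel_measurable raw_events" "AE \<omega> in law_init P \<mu>. G \<omega> = G' \<omega>"
proof -
  obtain G' where G': "G' \<in> borel_measurable (law_init P \<mu>)" "AE \<omega> in law_init P \<mu>. G \<omega> = G' \<omega>"
    using completion_ex_borel_measurable[OF measurable_events_law_init[OF \<mu> G]] by blast
  from G'(1) have "G' \<in> borel_measurable raw_events"
    unfolding measurable_cong_sets[OF sets_law_init[OF \<mu>] refl] .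
  then show thesis using G'(2) by (rule that)
qed

text \<open>Under every initial law \<open>G\<close> agrees almost surely with a function that is measurable without
  completion, and then the expectations agree for almost every starting point.\<close>

lemma expectation_universally_measurable:
  assumes G: "G \<in> borel_measurable (events P)"
  shows "universally_measurable (\<lambda>y. \<integral>\<^sup>+ \<omega>. G \<omega> \<partial>P y)"
  unfolding universally_measurable_def
proof
  fix \<mu> :: "'a measure" assume \<mu>: "\<mu> \<in> initial_laws"
  obtain G' where G': "G' \<in> borel_measurable raw_events" "AE \<omega> in law_init P \<mu>. G \<omega> = G' \<omega>"
    using events_measurable_approx[OF \<mu> G] by blast
  have sets: "sets \<mu> = sets borel" using \<mu> by (auto simp: initial_laws_def)
  have "(\<lambda>y. \<integral>\<^sup>+ \<omega>. G' \<omega> \<partial>P y) \<in> borel_measurable \<mu>"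
    unfolding measurable_cong_sets[OF sets refl] by (rule nn_integral_P_borel[OF G'(1)])
  moreover have "AE y in \<mu>. (\<integral>\<^sup>+ \<omega>. G \<omega> \<partial>P y) = (\<integral>\<^sup>+ \<omega>. G' \<omega> \<partial>P y)"
    using AE_law_init[OF \<mu> G'(2)] by eventually_elim (rule nn_integral_cong_AE)
  ultimately show "(\<lambda>y. \<integral>\<^sup>+ \<omega>. G \<omega> \<partial>P y) \<in> borel_measurable (completion \<mu>)"
    by (intro borel_measurable_completion_cong_AE[OF measurable_completion])
qed

lemma future_approx:
  assumes t: "0 \<le> t" and G: "G \<in> borel_measurable (events P)"
  obtains G' :: "'a path \<Rightarrow> ennreal" where "G' \<in> borel_measurable raw_events"
    "AE \<omega> in P x. future t G \<omega> = future t G' \<omega>"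
    "AE \<omega> in P x. ext0 (\<lambda>y. \<integral>\<^sup>+ \<omega>. G \<omega> \<partial>P y) (\<omega> t) = ext0 (\<lambda>y. \<integral>\<^sup>+ \<omega>. G' \<omega> \<partial>P y) (\<omega> t)"
proof -
  note \<mu> = position_law_initial_laws[OF t]
  obtain G' where G': "G' \<in> borel_measurable raw_events" "AE \<omega> in law_init P (position_law x t). G \<omega> = G' \<omega>"
    using events_measurable_approx[OF \<mu> G] by blast
  have "AE \<omega> in P x. future t G \<omega> = future t G' \<omega>"
    using AE_shift[OF t G'(2)] by eventually_elim (auto simp: future_def)
  moreover have "AE \<omega> in P x. ext0 (\<lambda>y. \<integral>\<^sup>+ \<omega>. G \<omega> \<partial>P y) (\<omega> t) = ext0 (\<lambda>y. \<integral>\<^sup>+ \<omega>. G' \<omega> \<partial>P y) (\<omega> t)"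
    using AE_position[OF t AE_law_init[OF \<mu> G'(2)]]
  proof eventually_elim
    case (elim \<omega>)
    then show ?case by (cases "\<omega> t") (auto intro: nn_integral_cong_AE)
  qed
  ultimately show thesis using that G'(1) by blast
qed

lemma future_measurable:
  assumes t: "0 \<le> t" and G: "G \<in> borel_measurable (events P)"
  shows "future t G \<in> borel_measurable (completion (P x))"
proof -
  obtain G' where G': "G' \<in> borel_measurable raw_events" "AE \<omega> in P x. future t G \<omega> = future t G' \<omega>"
    using future_approx[OF t G, of x] by blast
  have "future t G' \<in> borel_measurable (P x)"
    using future_raw_measurable[OF t G'(1)] by simp
  then show ?thesis
    using G'(2) by (intro borel_measurable_completion_cong_AE[OF measurable_completion])
qed

text \<open>The Markov property with completed past and future: the future is replaced by an uncompleted
  one with respect to the law of \<open>X\<^sub>t\<close>, the past with respect to \<open>P x\<close>.\<close>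

theorem markov:
  assumes t: "0 \<le> t" and Z: "Z \<in> borel_measurable (completed_filtration P t)"
    and G: "G \<in> borel_measurable (events P)"
  shows "(\<integral>\<^sup>+ \<omega>. Z \<omega> * future t G \<omega> \<partial>P x) =
         (\<integral>\<^sup>+ \<omega>. Z \<omega> * ext0 (\<lambda>y. \<integral>\<^sup>+ \<omega>. G \<omega> \<partial>P y) (\<omega> t) \<partial>P x)"
proof (rule integral_eq_completed_filtration[OF _ future_measurable[OF t G] _ Z])
  show "(\<lambda>\<omega>. ext0 (\<lambda>y. \<integral>\<^sup>+ \<omega>. G \<omega> \<partial>P y) (\<omega> t)) \<in> borel_measurable (completion (P x))"
    by (rule universally_measurable_at[OF t expectation_universally_measurable[OF G]])
next
  fix A :: "'a path set" assume A: "A \<in> sets (raw_filtration t)"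
  obtain G' where G': "G' \<in> borel_measurable raw_events"
    "AE \<omega> in P x. future t G \<omega> = future t G' \<omega>"
    "AE \<omega> in P x. ext0 (\<lambda>y. \<integral>\<^sup>+ \<omega>. G \<omega> \<partial>P y) (\<omega> t) = ext0 (\<lambda>y. \<integral>\<^sup>+ \<omega>. G' \<omega> \<partial>P y) (\<omega> t)"
    using future_approx[OF t G] by blast
  have "(\<integral>\<^sup>+ \<omega>. indicator A \<omega> * future t G \<omega> \<partial>P x) = (\<integral>\<^sup>+ \<omega>. indicator A \<omega> * future t G' \<omega> \<partial>P x)"
    using G'(2) by (intro nn_integral_cong_AE) (auto elim!: eventually_mono)
  also have "\<dots> = (\<integral>\<^sup>+ \<omega>. indicator A \<omega> * ext0 (\<lambda>y. \<integral>\<^sup>+ \<omega>. G' \<omega> \<partial>P y) (\<omega> t) \<partial>P x)"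
    by (rule markov_raw[OF t A G'(1)])
  also have "\<dots> = (\<integral>\<^sup>+ \<omega>. indicator A \<omega> * ext0 (\<lambda>y. \<integral>\<^sup>+ \<omega>. G \<omega> \<partial>P y) (\<omega> t) \<partial>P x)"
    using G'(3) by (intro nn_integral_cong_AE) (auto elim!: eventually_mono)
  finally show "(\<integral>\<^sup>+ \<omega>. indicator A \<omega> * future t G \<omega> \<partial>P x) =
      (\<integral>\<^sup>+ \<omega>. indicator A \<omega> * ext0 (\<lambda>y. \<integral>\<^sup>+ \<omega>. G \<omega> \<partial>P y) (\<omega> t) \<partial>P x)" .
qed

lemma raw_filtration_subset_completed:
  "sets (raw_filtration t) \<subseteq> sets (completed_filtration P t)"
proof
  fix A :: "'a path set" assume A: "A \<in> sets (raw_filtration t)"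
  let ?I = "\<Inter>\<mu>\<in>initial_laws. sigma_sets paths
    (sets (raw_filtration t) \<union> null_sets (completion (law_init P \<mu>)))"
  have "A \<in> ?I" using A by (auto intro: sigma_sets.Basic)
  moreover have "?I \<subseteq> Pow paths"
  proof -
    have "sets (raw_filtration t) \<union> null_sets (completion (P undefined)) \<subseteq> Pow paths"
      using sets.space_closed[of "raw_filtration t"] sets.space_closed[of "completion (P undefined)"] by auto
    from sigma_sets_into_sp[OF this] INT_lower[OF return_initial_laws[of undefined],
        of "\<lambda>\<mu>. sigma_sets paths (sets (raw_filtration t) \<union> null_sets (completion (law_init P \<mu>)))"]
    show ?thesis unfolding law_init_return by blast
  qed
  ultimately show "A \<in> sets (completed_filtration P t)"
    unfolding completed_filtration_def by (simp add: sets_measure_of sigma_sets.Basic)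
qed

lemma markov_expectation:
  assumes t: "0 \<le> t" and G: "G \<in> borel_measurable (events P)"
  shows "(\<integral>\<^sup>+ \<omega>. future t G \<omega> \<partial>P x) = (\<integral>\<^sup>+ \<omega>. ext0 (\<lambda>y. \<integral>\<^sup>+ \<omega>. G \<omega> \<partial>P y) (\<omega> t) \<partial>P x)"
  using markov[OF t borel_measurable_const[of 1] G, of x] by simp

lemma AE_future:
  assumes t: "0 \<le> t" and E: "E \<in> sets (events P)" and ae: "\<And>y. AE \<omega> in P y. \<omega> \<in> E"
  shows "AE \<omega> in P x. \<omega> t \<noteq> None \<longrightarrow> shift t \<omega> \<in> E"
proof -
  have co: "paths - E \<in> sets (events P)" using sets.compl_sets[OF E] by simp
  then have G: "indicator (paths - E) \<in> borel_measurable (events P)" by simp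
  have "(\<integral>\<^sup>+ \<omega>. indicator (paths - E) \<omega> \<partial>P y) = (\<integral>\<^sup>+ \<omega>. 0 \<partial>P y)" for y
    using ae[of y] by (intro nn_integral_cong_AE) (auto simp: indicator_def elim!: eventually_mono)
  then have "(\<integral>\<^sup>+ \<omega>. future t (indicator (paths - E)) \<omega> \<partial>P x) = (\<integral>\<^sup>+ \<omega>. ext0 (\<lambda>_. 0) (\<omega> t) \<partial>P x)"
    using markov_expectation[OF t G, of x] by simp
  also have "\<dots> = (\<integral>\<^sup>+ \<omega>. 0 \<partial>P x)"
    by (intro nn_integral_cong) (simp add: ext0_def split: option.splits)
  finally have "(\<integral>\<^sup>+ \<omega>. future t (indicator (paths - E)) \<omega> \<partial>completion (P x)) = 0"
    by (simp add: nn_integral_completion)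
  then have "AE \<omega> in completion (P x). future t (indicator (paths - E)) \<omega> = 0"
    using future_measurable[OF t G] by (simp add: nn_integral_0_iff_AE)
  then have "AE \<omega> in P x. future t (indicator (paths - E)) \<omega> = 0"
    by (simp add: AE_completion_iff)
  then show ?thesis
    using AE_space[of "P x"]
    by eventually_elim (use t in \<open>auto simp: future_def indicator_def shift_paths split: if_splits\<close>)
qed

end


section \<open>The debut of a point\<close>

lemma exp_neg_ennreal: "0 \<le> t \<Longrightarrow> exp_neg (ennreal t) = ennreal (exp (- t))"
  by (simp add: exp_neg_def)

lemma exp_neg_top[simp]: "exp_neg \<infinity> = 0" "exp_neg top = 0"
  by (simp_all add: exp_neg_def infinity_ennreal_def)

lemma exp_neg_0[simp]: "exp_neg 0 = 1"
  by (simp add: exp_neg_def)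

lemma exp_neg_le_iff: "exp_neg r \<le> exp_neg s \<longleftrightarrow> s \<le> r"
proof (cases r; cases s)
  fix x assume "r = ennreal x" "0 \<le> x" "s = top"
  then show ?thesis by (simp add: exp_neg_ennreal top_unique)
qed (auto simp: exp_neg_ennreal)

lemma exp_neg_le_1: "exp_neg r \<le> 1"
  using exp_neg_le_iff[of r 0] by simp

lemma exp_neg_measurable[measurable]: "exp_neg \<in> borel_measurable borel"
proof -
  have "exp_neg = (\<lambda>r. if r = \<infinity> then 0 else ennreal (exp (- enn2real r)))"
    by (simp add: exp_neg_def fun_eq_iff)
  also have "\<dots> \<in> borel_measurable borel" by measurable
  finally show ?thesis .
qed

text \<open>Unlike the hitting time, the debut takes time \<open>0\<close> into account. In this way it is determined by
  right-continuity: a path is at \<open>a\<close> at its debut.\<close>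

definition debut :: "'a \<Rightarrow> 'a path \<Rightarrow> ennreal" where
  "debut a \<omega> = Inf {ennreal t | t. 0 \<le> t \<and> \<omega> t = Some a}"

text \<open>A stopping time in the wide sense: it is enough to know strictly before time \<open>t\<close> whether it
  has occurred.\<close>

definition optional_time :: "('a::topological_space path \<Rightarrow> ennreal) \<Rightarrow> bool" where
  "optional_time T \<longleftrightarrow> (\<forall>t\<ge>0. {\<omega> \<in> paths. T \<omega> < ennreal t} \<in> sets (raw_filtration t))"

lemma optional_timeD:
  "optional_time T \<Longrightarrow> 0 \<le> t \<Longrightarrow> {\<omega> \<in> paths. T \<omega> < ennreal t} \<in> sets (raw_filtration t)"
  by (simp add: optional_time_def)

lemma optional_time_measurable:
  fixes T :: "'a::topological_space path \<Rightarrow> ennreal"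
  assumes T: "optional_time T"
  shows "T \<in> borel_measurable raw_events"
proof (rule borel_measurableI_less)
  have *: "{\<omega> \<in> paths. T \<omega> < ennreal t} \<in> sets raw_events" if "0 \<le> t" for t
    using optional_timeD[OF T that] raw_filtration_subset_raw_events[of t] by auto
  fix y :: ennreal
  show "{\<omega> \<in> space raw_events. T \<omega> < y} \<in> sets raw_events"
  proof (cases y)
    case (real t)
    then show ?thesis using * by simp
  next
    case top
    have "T \<omega> < top \<longleftrightarrow> (\<exists>n::nat. T \<omega> < ennreal (real n))" for \<omega>
    proof
      assume "T \<omega> < top"
      then obtain t where t: "T \<omega> = ennreal t" "0 \<le> t" by (cases "T \<omega>") auto
      moreover obtain n :: nat where "t < real n" using reals_Archimedean2 by blast
      ultimately show "\<exists>n::nat. T \<omega> < ennreal (real n)" by (auto intro: ennreal_lessI le_less_trans)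
    qed (auto intro: less_trans)
    then have "{\<omega> \<in> space raw_events. T \<omega> < y} = (\<Union>n::nat. {\<omega> \<in> paths. T \<omega> < ennreal (real n)})"
      using top by auto
    then show ?thesis using * by simp
  qed
qed

lemma optional_time_SUP:
  fixes T :: "nat \<Rightarrow> 'a::topological_space path \<Rightarrow> ennreal"
  assumes T: "\<And>n. optional_time (T n)"
  shows "optional_time (\<lambda>\<omega>. SUP n. T n \<omega>)"
  unfolding optional_time_def
proof (intro allI impI)
  fix t :: real assume t: "0 \<le> t"
  let ?R = "\<rat> \<inter> {0..<t}"
  have eq: "(SUP n. T n \<omega>) < ennreal t \<longleftrightarrow> (\<exists>r\<in>?R. \<forall>n. T n \<omega> < ennreal r)" for \<omega>
  proof
    assume less: "(SUP n. T n \<omega>) < ennreal t"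
    then obtain y where y: "(SUP n. T n \<omega>) = ennreal y" "0 \<le> y"
      by (cases "SUP n. T n \<omega>") auto
    with less have "y < t" by (simp add: ennreal_less_iff)
    then obtain r where r: "r \<in> \<rat>" "y < r" "r < t" using Rats_dense_in_real by blast
    have "T n \<omega> < ennreal r" for n
    proof -
      have "T n \<omega> \<le> ennreal y" unfolding y(1)[symmetric] by (rule SUP_upper) simp
      also have "\<dots> < ennreal r" using r y(2) by (simp add: ennreal_lessI)
      finally show ?thesis .
    qed
    with r y(2) show "\<exists>r\<in>?R. \<forall>n. T n \<omega> < ennreal r" by (intro bexI[of _ r]) auto
  next
    assume "\<exists>r\<in>?R. \<forall>n. T n \<omega> < ennreal r"
    then obtain r where r: "0 \<le> r" "r < t" "\<And>n. T n \<omega> < ennreal r" by auto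
    have "(SUP n. T n \<omega>) \<le> ennreal r" using r(3) by (intro SUP_least less_imp_le)
    also have "\<dots> < ennreal t" using r by (simp add: ennreal_lessI)
    finally show "(SUP n. T n \<omega>) < ennreal t" .
  qed
  have "{\<omega> \<in> paths. (SUP n. T n \<omega>) < ennreal t} =
      (\<Union>r\<in>?R. \<Inter>n. {\<omega> \<in> paths. T n \<omega> < ennreal r})"
    unfolding eq by (rule set_eqI) simp
  also have "\<dots> \<in> sets (raw_filtration t)"
  proof (rule sets.countable_UN'')
    show "countable ?R" by (intro countable_Int1 countable_rat)
    fix r assume r: "r \<in> ?R"
    have "{\<omega> \<in> paths. T n \<omega> < ennreal r} \<in> sets (raw_filtration t)" for n
      using optional_timeD[OF T, of r n] raw_filtration_mono[of r t] r by auto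
    then show "(\<Inter>n. {\<omega> \<in> paths. T n \<omega> < ennreal r}) \<in> sets (raw_filtration t)"
      by (intro sets.countable_INT) auto
  qed
  finally show "{\<omega> \<in> paths. (SUP n. T n \<omega>) < ennreal t} \<in> sets (raw_filtration t)" .
qed

lemma path_right_continuous:
  assumes "\<omega> \<in> paths" "0 \<le> t" "open V" "\<omega> t \<in> V"
  shows "\<exists>b>t. \<forall>s. t < s \<longrightarrow> s < b \<longrightarrow> \<omega> s \<in> V"
proof -
  have "(\<omega> \<longlongrightarrow> \<omega> t) (at_right t)"
    using assms by (auto simp: paths_def continuous_within)
  then have "\<forall>\<^sub>F s in at_right t. \<omega> s \<in> V" using assms by (rule_tac topological_tendstoD)
  then show ?thesis unfolding eventually_at_right_field by blast
qed

definition next_visit :: "'a set \<Rightarrow> ('a path \<Rightarrow> ennreal) \<Rightarrow> 'a path \<Rightarrow> ennreal" where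
  "next_visit U T \<omega> = Inf {ennreal s | s. 0 \<le> s \<and> T \<omega> < ennreal s \<and> \<omega> s \<in> Some ` U}"

lemma next_visit_ge: "T \<omega> \<le> next_visit U T \<omega>"
  unfolding next_visit_def by (rule Inf_greatest) auto

lemma optional_time_next_visit:
  fixes T :: "'a::topological_space path \<Rightarrow> ennreal"
  assumes U: "open U" and T: "optional_time T"
  shows "optional_time (next_visit U T)"
  unfolding optional_time_def
proof (intro allI impI)
  fix t :: real assume t: "0 \<le> t"
  let ?R = "\<rat> \<inter> {0..<t}"
  have eq: "next_visit U T \<omega> < ennreal t \<longleftrightarrow> (\<exists>r\<in>?R. T \<omega> < ennreal r \<and> \<omega> r \<in> Some ` U)"
    if \<omega>: "\<omega> \<in> paths" for \<omega>
  proof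
    assume "next_visit U T \<omega> < ennreal t"
    then obtain s where s: "0 \<le> s" "T \<omega> < ennreal s" "\<omega> s \<in> Some ` U" "ennreal s < ennreal t"
      unfolding next_visit_def by (auto simp: Inf_less_iff)
    then have "s < t" by (simp add: ennreal_less_iff)
    obtain b where b: "s < b" "\<And>u. s < u \<Longrightarrow> u < b \<Longrightarrow> \<omega> u \<in> Some ` U"
      using path_right_continuous[OF \<omega> s(1) open_image_Some[OF U] s(3)] by blast
    obtain r where r: "r \<in> \<rat>" "s < r" "r < min b t"
      using Rats_dense_in_real[of s "min b t"] b(1) \<open>s < t\<close> by auto
    have "ennreal s < ennreal r" using r s(1) by (simp add: ennreal_lessI)
    with s(2) have "T \<omega> < ennreal r" by (rule less_trans)
    with r b s(1) show "\<exists>r\<in>?R. T \<omega> < ennreal r \<and> \<omega> r \<in> Some ` U"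
      by (intro bexI[of _ r]) auto
  next
    assume "\<exists>r\<in>?R. T \<omega> < ennreal r \<and> \<omega> r \<in> Some ` U"
    then obtain r where r: "0 \<le> r" "r < t" "T \<omega> < ennreal r" "\<omega> r \<in> Some ` U" by auto
    have "next_visit U T \<omega> \<le> ennreal r"
      unfolding next_visit_def using r by (intro Inf_lower) auto
    also have "\<dots> < ennreal t" using r by (simp add: ennreal_lessI)
    finally show "next_visit U T \<omega> < ennreal t" .
  qed
  have "{\<omega> \<in> paths. next_visit U T \<omega> < ennreal t} =
      (\<Union>r\<in>?R. {\<omega> \<in> paths. T \<omega> < ennreal r} \<inter> cylinder {r} (\<lambda>_. U))"
    using eq by (intro set_eqI) (simp add: cylinder_def, blast)
  also have "\<dots> \<in> sets (raw_filtration t)"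
  proof (rule sets.countable_UN'')
    show "countable ?R" by (intro countable_Int1 countable_rat)
    fix r assume r: "r \<in> ?R"
    have "{\<omega> \<in> paths. T \<omega> < ennreal r} \<in> sets (raw_filtration t)"
      using optional_timeD[OF T, of r] raw_filtration_mono[of r t] r by auto
    moreover have "cylinder {r} (\<lambda>_. U) \<in> sets (raw_filtration t)"
      using r U by (intro cylinder_raw_filtration) auto
    ultimately show "{\<omega> \<in> paths. T \<omega> < ennreal r} \<inter> cylinder {r} (\<lambda>_. U) \<in> sets (raw_filtration t)"
      by (rule sets.Int)
  qed
  finally show "{\<omega> \<in> paths. next_visit U T \<omega> < ennreal t} \<in> sets (raw_filtration t)" .
qed

text \<open>What the study of the debut of \<open>a\<close> takes from the metrizability of the state space: the closures
  of the \<open>U n\<close> have only the point \<open>a\<close> in common.\<close>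

locale point_neighbourhoods =
  fixes a :: "'a::topological_space" and U :: "nat \<Rightarrow> 'a set"
  assumes open_U: "open (U n)" and a_in_U: "a \<in> U n"
    and separated: "y \<noteq> a \<Longrightarrow> \<exists>V n. open V \<and> y \<in> V \<and> V \<inter> U n = {}"
begin

lemma separated_option:
  assumes "z \<noteq> Some a"
  obtains V n where "open V" "z \<in> V" "V \<inter> Some ` U n = {}"
proof (cases z)
  case None
  then show thesis using that[of "{None}" 0] open_singleton_None by auto
next
  case (Some y)
  with assms obtain V n where "open V" "y \<in> V" "V \<inter> U n = {}" using separated[of y] by auto
  then show thesis using that[of "Some ` V" n] Some open_image_Some by auto
qed

lemma singleton_borel[measurable]: "{a} \<in> sets borel"
proof -
  have "open (- {a})"
  proof (subst open_subopen, intro ballI)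
    fix y assume "y \<in> - {a}"
    then obtain V n where "open V" "y \<in> V" "V \<inter> U n = {}" using separated[of y] by auto
    then show "\<exists>V. open V \<and> y \<in> V \<and> V \<subseteq> - {a}" using a_in_U[of n] by auto
  qed
  then show ?thesis by (intro borel_closed) (simp add: closed_def)
qed

lemma debut_attained:
  assumes \<omega>: "\<omega> \<in> paths" and t: "debut a \<omega> = ennreal t" "0 \<le> t"
  shows "\<omega> t = Some a"
proof (rule ccontr)
  assume "\<omega> t \<noteq> Some a"
  then obtain V n where V: "open V" "\<omega> t \<in> V" "V \<inter> Some ` U n = {}" by (rule separated_option)
  obtain b where b: "t < b" "\<And>s. t < s \<Longrightarrow> s < b \<Longrightarrow> \<omega> s \<in> V"
    using path_right_continuous[OF \<omega> t(2) V(1,2)] by blast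
  have "debut a \<omega> < ennreal b" using t b by (simp add: ennreal_lessI)
  then obtain s where s: "0 \<le> s" "\<omega> s = Some a" "ennreal s < ennreal b"
    unfolding debut_def by (auto simp: Inf_less_iff)
  then have "s < b" by (simp add: ennreal_less_iff)
  have "ennreal t \<le> ennreal s"
    unfolding t(1)[symmetric] debut_def using s by (intro Inf_lower) auto
  then have "t \<le> s" using s(1) by (simp add: ennreal_le_iff)
  moreover have "s \<noteq> t" using s(2) \<open>\<omega> t \<noteq> Some a\<close> by auto
  ultimately have "\<omega> s \<in> V" using b \<open>s < b\<close> by auto
  with V(3) s(2) a_in_U[of n] show False by auto
qed

text \<open>At the debut itself the path is at \<open>a\<close>, and by right-continuity it stays in \<open>U n\<close> for a while; so
  also in the case \<open>T = debut\<close> the next visit strictly after \<open>T\<close> begins at the debut.\<close>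

lemma next_visit_le_debut:
  assumes \<omega>: "\<omega> \<in> paths" and T: "T \<omega> \<le> debut a \<omega>"
  shows "next_visit (U n) T \<omega> \<le> debut a \<omega>"
proof (cases "debut a \<omega>")
  case (real t)
  then have at: "\<omega> t = Some a" using debut_attained[OF \<omega>] by simp
  show ?thesis
  proof (cases "T \<omega> < ennreal t")
    case True
    then show ?thesis
      unfolding real next_visit_def using real at a_in_U[of n] by (intro Inf_lower) auto
  next
    case False
    with T real have T_eq: "T \<omega> = ennreal t" by simp
    obtain b where b: "t < b" "\<And>s. t < s \<Longrightarrow> s < b \<Longrightarrow> \<omega> s \<in> Some ` U n"
      using path_right_continuous[OF \<omega> real(1) open_image_Some[OF open_U], of n] at a_in_U[of n] by auto
    show ?thesis unfolding real
    proof (rule dense_ge)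
      fix y assume "ennreal t < y"
      then have "ennreal t < min y (ennreal b)" using b(1) real by (simp add: ennreal_lessI)
      then obtain y' where y': "ennreal t < y'" "y' < min y (ennreal b)" using dense by blast
      then have "y' < top" using less_le_trans[of y' "min y (ennreal b)" top] by auto
      then obtain s where s: "y' = ennreal s" "0 \<le> s" by (cases y') auto
      with y' have "t < s" "s < b" using real by (auto simp: ennreal_less_iff)
      then have "next_visit (U n) T \<omega> \<le> ennreal s"
        unfolding next_visit_def using T_eq b s y' by (intro Inf_lower) auto
      with s y' show "next_visit (U n) T \<omega> \<le> y" by auto
    qed
  qed
qed simp

text \<open>If the next visits after \<open>T\<close> to the \<open>U n\<close> are not later than \<open>T\<close>, then the path is in every
  \<open>U n\<close> at times that decrease to \<open>T\<close>. By right-continuity the position at time \<open>T\<close> is in all the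
  closures, so it is \<open>a\<close>.\<close>

lemma debut_le_of_no_progress:
  assumes \<omega>: "\<omega> \<in> paths" and T: "(SUP n. next_visit (U n) T \<omega>) = T \<omega>"
  shows "debut a \<omega> \<le> T \<omega>"
proof (cases "T \<omega>")
  case (real t)
  have "\<omega> t = Some a"
  proof (rule ccontr)
    assume "\<omega> t \<noteq> Some a"
    then obtain V n where V: "open V" "\<omega> t \<in> V" "V \<inter> Some ` U n = {}" by (rule separated_option)
    obtain b where b: "t < b" "\<And>s. t < s \<Longrightarrow> s < b \<Longrightarrow> \<omega> s \<in> V"
      using path_right_continuous[OF \<omega> real(1) V(1,2)] by blast
    have "next_visit (U n) T \<omega> \<le> ennreal t"
      unfolding real(2)[symmetric] T[symmetric] by (rule SUP_upper) simp
    also have "\<dots> < ennreal b" using b(1) real by (simp add: ennreal_lessI)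
    finally obtain s where s: "0 \<le> s" "T \<omega> < ennreal s" "\<omega> s \<in> Some ` U n" "ennreal s < ennreal b"
      unfolding next_visit_def by (auto simp: Inf_less_iff)
    then have "t < s" "s < b" using real by (auto simp: ennreal_less_iff)
    with b s(3) V(3) show False by auto
  qed
  then show ?thesis unfolding real debut_def using real(1) by (intro Inf_lower) auto
qed simp

text \<open>Among the optional times that do not exceed the debut, choose one that is essentially maximal. Passing on to the accumulation point of the
  next visits to the neighbourhoods cannot move it, so by right-continuity it is a time at which the
  path is at \<open>a\<close>.\<close>

theorem debut_optional:
  fixes Q :: "'a path measure"
  assumes Q: "finite_measure Q" and sets_Q: "sets Q = sets raw_events"
  obtains T where "optional_time T" "\<And>\<omega>. \<omega> \<in> paths \<Longrightarrow> T \<omega> \<le> debut a \<omega>" "AE \<omega> in Q. T \<omega> = debut a \<omega>"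
proof -
  interpret finite_measure Q by fact
  have space_Q: "space Q = paths" using sets_eq_imp_space_eq[OF sets_Q] by simp
  define \<T> where "\<T> = {T. optional_time T \<and> (\<forall>\<omega>\<in>paths. T \<omega> \<le> debut a \<omega>)}"
  define \<Phi> where "\<Phi> T = (\<integral>\<^sup>+ \<omega>. exp_neg (T \<omega>) \<partial>Q)" for T
  have meas: "(\<lambda>\<omega>. exp_neg (T \<omega>)) \<in> borel_measurable Q" if "T \<in> \<T>" for T
  proof -
    have "optional_time T" using that by (simp add: \<T>_def)
    then show ?thesis
      unfolding measurable_cong_sets[OF sets_Q refl]
      by (intro measurable_compose[OF optional_time_measurable exp_neg_measurable])
  qed
  have "{\<omega> \<in> paths :: 'a path set. (0::ennreal) < ennreal t} \<in> sets (raw_filtration t)" for t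
    using sets.top[of "raw_filtration t :: 'a path measure"] by (cases "0 < t") (simp_all add: ennreal_neg)
  then have "optional_time (\<lambda>_ :: 'a path. 0)" unfolding optional_time_def by blast
  then have "(\<lambda>_. 0) \<in> \<T>" by (simp add: \<T>_def)
  then have "\<Phi> ` \<T> \<noteq> {}" by blast
  from ennreal_Inf_countable_INF[OF this] obtain f :: "nat \<Rightarrow> ennreal"
    where f: "range f \<subseteq> \<Phi> ` \<T>" "Inf (\<Phi> ` \<T>) = (INF i. f i)" by (elim exE conjE) (rule that)
  have "\<exists>T. T \<in> \<T> \<and> f i = \<Phi> T" for i
    using f(1) by blast
  then obtain S where S: "\<And>i. S i \<in> \<T>" "\<And>i. f i = \<Phi> (S i)" by metis
  define T where "T \<omega> = (SUP i. S i \<omega>)" for \<omega>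
  have T: "T \<in> \<T>"
    using S(1) optional_time_SUP[of S] by (auto simp: \<T>_def T_def[abs_def] intro!: SUP_least)
  have "\<Phi> T \<le> f i" for i
    unfolding S(2) \<Phi>_def by (intro nn_integral_mono) (auto simp: exp_neg_le_iff T_def intro: SUP_upper)
  then have T_min: "\<Phi> T \<le> Inf (\<Phi> ` \<T>)" unfolding f(2) by (intro INF_greatest) auto
  define T' where "T' \<omega> = (SUP n. next_visit (U n) T \<omega>)" for \<omega>
  have T': "T' \<in> \<T>"
    using T optional_time_SUP[of "\<lambda>n. next_visit (U n) T"] optional_time_next_visit[OF open_U]
      next_visit_le_debut by (auto simp: \<T>_def T'_def[abs_def] intro!: SUP_least)
  have le: "T \<omega> \<le> T' \<omega>" for \<omega>
  proof -
    have "T \<omega> \<le> next_visit (U 0) T \<omega>" by (rule next_visit_ge)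
    also have "\<dots> \<le> T' \<omega>" unfolding T'_def by (rule SUP_upper) simp
    finally show ?thesis .
  qed
  have "AE \<omega> in Q. exp_neg (T \<omega>) \<le> exp_neg (T' \<omega>)"
  proof (rule ccontr)
    assume not: "\<not> ?thesis"
    have "\<Phi> T' \<le> (\<integral>\<^sup>+ \<omega>. 1 \<partial>Q)"
      unfolding \<Phi>_def by (intro nn_integral_mono exp_neg_le_1)
    also have "\<dots> < \<infinity>" using emeasure_finite[of "space Q"] by (simp add: less_top[symmetric])
    finally have "\<Phi> T' < \<Phi> T"
      unfolding \<Phi>_def using not meas[OF T] meas[OF T'] le
      by (intro nn_integral_less) (auto simp: exp_neg_le_iff)
    moreover have "Inf (\<Phi> ` \<T>) \<le> \<Phi> T'" using T' by (intro Inf_lower) auto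
    ultimately show False using T_min by auto
  qed
  then have "AE \<omega> in Q. T \<omega> = debut a \<omega>"
    using AE_space[of Q]
  proof eventually_elim
    case (elim \<omega>)
    then have \<omega>: "\<omega> \<in> paths" by (simp add: space_Q)
    have "T' \<omega> = T \<omega>" using elim(1) le[of \<omega>] by (simp add: exp_neg_le_iff)
    then have "debut a \<omega> \<le> T \<omega>" by (intro debut_le_of_no_progress[OF \<omega>]) (simp add: T'_def)
    moreover have "T \<omega> \<le> debut a \<omega>" using T \<omega> by (auto simp: \<T>_def)
    ultimately show ?case by simp
  qed
  with T show thesis by (intro that[of T]) (auto simp: \<T>_def)
qed

lemma debut_le_hitting_time: "debut a \<omega> \<le> hitting_time a \<omega>"
  unfolding debut_def hitting_time_def by (rule Inf_superset_mono) auto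

lemma hitting_time_eq_debut:
  assumes "\<omega> 0 \<noteq> Some a"
  shows "hitting_time a \<omega> = debut a \<omega>"
proof -
  have "0 < t \<longleftrightarrow> 0 \<le> t" if "\<omega> t = Some a" for t
    using assms that by (cases "t = 0") auto
  then have "{ennreal t | t. 0 < t \<and> \<omega> t = Some a} = {ennreal t | t. 0 \<le> t \<and> \<omega> t = Some a}" by blast
  then show ?thesis by (simp add: debut_def hitting_time_def)
qed

lemma hitting_time_finite_iff: "hitting_time a \<omega> < \<infinity> \<longleftrightarrow> (\<exists>t>0. \<omega> t = Some a)"
  unfolding hitting_time_def by (auto simp: Inf_less_iff)

lemma last_exit_gt_iff:
  assumes "0 \<le> t"
  shows "ennreal t < last_exit a \<omega> \<longleftrightarrow> hitting_time a (shift t \<omega>) < \<infinity>"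
proof
  assume "ennreal t < last_exit a \<omega>"
  then obtain s where s: "0 \<le> s" "\<omega> s = Some a" "ennreal t < ennreal s"
    unfolding last_exit_def by (auto simp: less_Sup_iff)
  then have "t < s" using assms by (simp add: ennreal_less_iff)
  then show "hitting_time a (shift t \<omega>) < \<infinity>"
    using s unfolding hitting_time_finite_iff by (intro exI[of _ "s - t"]) (simp add: shift_apply)
next
  assume "hitting_time a (shift t \<omega>) < \<infinity>"
  then obtain s where s: "0 < s" "\<omega> (s + t) = Some a"
    unfolding hitting_time_finite_iff by (auto simp: shift_apply)
  have "ennreal t < ennreal (s + t)" using s assms by (simp add: ennreal_lessI del: ennreal_plus)
  also have "\<dots> \<le> last_exit a \<omega>"
    unfolding last_exit_def using s assms by (intro Sup_upper CollectI exI[of _ "s + t"]) auto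
  finally show "ennreal t < last_exit a \<omega>" .
qed

lemma hitting_time_dead: "hitting_time a (\<lambda>t\<in>{0..}. None) = \<infinity>"
proof -
  have "{ennreal t | t. 0 < t \<and> (\<lambda>t\<in>{0..}. None) t = Some a} = {}" by auto
  then show ?thesis unfolding hitting_time_def by (simp only: Inf_empty infinity_ennreal_def)
qed

end


section \<open>Hitting a regular point\<close>

locale regular_point = borel_right P + point_neighbourhoods a U
  for P :: "'a::topological_space \<Rightarrow> 'a path measure" and a :: 'a and U :: "nat \<Rightarrow> 'a set" +
  assumes regular: "AE \<omega> in P a. hitting_time a \<omega> = 0"
begin

text \<open>The two times differ only on paths that start at \<open>a\<close> and do not return at once. The
  exceptional set has to be a single measurable set for all starting points, so that it is null for
  every initial law.\<close>

lemma AE_hitting_time_eq_debut: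
  assumes \<mu>: "\<mu> \<in> initial_laws"
  shows "AE \<omega> in law_init P \<mu>. hitting_time a \<omega> = debut a \<omega>"
proof -
  obtain N where N: "N \<in> null_sets (P a)" "{\<omega> \<in> paths. hitting_time a \<omega> \<noteq> 0} \<subseteq> N"
    using regular unfolding eventually_ae_filter by auto
  let ?N = "N \<inter> cylinder {0} (\<lambda>_. {a})"
  have N_raw: "N \<in> sets raw_events" using N(1) by auto
  have cyl: "cylinder {0} (\<lambda>_. {a}) \<in> sets raw_events"
    using cylinder_raw_filtration[of "{0}" 0 "\<lambda>_. {a}"] raw_filtration_subset_raw_events[of 0] singleton_borel
    by auto
  have raw: "?N \<in> sets raw_events" using N_raw cyl by (rule sets.Int)
  have "emeasure (P y) ?N = 0" for y
  proof (cases "y = a")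
    case True
    have "emeasure (P a) ?N \<le> emeasure (P a) N" using N_raw by (intro emeasure_mono) auto
    with N(1) True show ?thesis by (simp add: null_sets_def)
  next
    case False
    have "AE \<omega> in P y. \<omega> \<notin> ?N"
      using start[of y] by eventually_elim (use False in \<open>auto simp: cylinder_def\<close>)
    then show ?thesis using AE_iff_null_sets[of ?N "P y"] raw by (auto simp: null_sets_def)
  qed
  then have "emeasure (law_init P \<mu>) ?N = 0"
    using emeasure_law_init[OF \<mu> raw] by simp
  then have "AE \<omega> in law_init P \<mu>. \<omega> \<notin> ?N"
    using raw sets_law_init[OF \<mu>] by (intro AE_not_in) (simp add: null_sets_def)
  then show ?thesis
    using AE_space[of "law_init P \<mu>"]
  proof eventually_elim
    case (elim \<omega>)
    then have \<omega>: "\<omega> \<in> paths" by (simp add: space_law_init[OF \<mu>])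
    show ?case
    proof (cases "\<omega> 0 = Some a")
      case True
      then have "\<omega> \<notin> N" using elim(1) \<omega> by (simp add: cylinder_def)
      then have "hitting_time a \<omega> = 0" using N(2) \<omega> by blast
      then show ?thesis using debut_le_hitting_time[of \<omega>] by simp
    qed (rule hitting_time_eq_debut)
  qed
qed

lemma hitting_time_optional:
  obtains T where "optional_time T" "AE \<omega> in P x. T \<omega> = hitting_time a \<omega>"
    "AE \<omega> in P x. \<forall>t\<ge>0. T \<omega> = ennreal t \<longrightarrow> \<omega> t = Some a"
proof -
  interpret prob_space "P x" by (rule prob_space_P)
  obtain T where T: "optional_time T" "AE \<omega> in P x. T \<omega> = debut a \<omega>"
    using debut_optional[of "P x"] finite_measure_axioms by auto
  have "AE \<omega> in P x. hitting_time a \<omega> = debut a \<omega>"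
    using AE_hitting_time_eq_debut[OF return_initial_laws[of x]] by (simp only: law_init_return)
  with T(2) have "AE \<omega> in P x. T \<omega> = hitting_time a \<omega>" by eventually_elim simp
  moreover have "AE \<omega> in P x. \<forall>t\<ge>0. T \<omega> = ennreal t \<longrightarrow> \<omega> t = Some a"
    using T(2) AE_space[of "P x"]
    by eventually_elim (auto intro: debut_attained)
  ultimately show thesis using T(1) that by blast
qed

lemma hitting_time_measurable: "hitting_time a \<in> borel_measurable (events P)"
proof (rule measurable_eventsI)
  fix \<mu> :: "'a measure" assume \<mu>: "\<mu> \<in> initial_laws"
  have "prob_space \<mu>" and sets_\<mu>: "sets \<mu> = sets borel" using \<mu> by (auto simp: initial_laws_def)
  have "emeasure (law_init P \<mu>) (space (law_init P \<mu>)) = emeasure \<mu> (space \<mu>)"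
    using emeasure_law_init[OF \<mu> sets.top] by (simp add: space_law_init[OF \<mu>])
  then have "finite_measure (law_init P \<mu>)"
    using prob_space.emeasure_space_1[OF \<open>prob_space \<mu>\<close>] by (intro finite_measureI) simp
  then obtain T where T: "optional_time T" "AE \<omega> in law_init P \<mu>. T \<omega> = debut a \<omega>"
    using debut_optional[OF _ sets_law_init[OF \<mu>]] by blast
  have "T \<in> borel_measurable (law_init P \<mu>)"
    unfolding measurable_cong_sets[OF sets_law_init[OF \<mu>] refl]
    by (rule optional_time_measurable[OF T(1)])
  moreover have "AE \<omega> in law_init P \<mu>. hitting_time a \<omega> = T \<omega>"
    using T(2) AE_hitting_time_eq_debut[OF \<mu>] by eventually_elim simp
  ultimately show "hitting_time a \<in> borel_measurable (completion (law_init P \<mu>))"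
    by (intro borel_measurable_completion_cong_AE[OF measurable_completion])
qed simp

definition hit :: "'a path set" where
  "hit = {\<omega> \<in> paths. hitting_time a \<omega> < \<infinity>}"

definition hit_prob :: "'a \<Rightarrow> ennreal" where
  "hit_prob y = (\<integral>\<^sup>+ \<omega>. indicator hit \<omega> \<partial>P y)"

lemma hit_events: "hit \<in> sets (events P)"
proof -
  have "hitting_time a -` {..<\<infinity>} \<inter> space (events P) \<in> sets (events P)"
    by (rule measurable_sets[OF hitting_time_measurable]) simp
  moreover have "hitting_time a -` {..<\<infinity>} \<inter> space (events P) = hit"
    by (auto simp: hit_def)
  ultimately show ?thesis by simp
qed

lemma emeasure_law_hit: "emeasure (law P (Some y)) hit = hit_prob y"
proof -
  have "emeasure (completion (P y)) hit = (\<integral>\<^sup>+ \<omega>. indicator hit \<omega> \<partial>completion (P y))"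
    using sets_events_P[OF hit_events] by simp
  then show ?thesis unfolding law_Some hit_prob_def nn_integral_completion .
qed

lemma emeasure_law_None_hit: "emeasure (law P None) hit = 0"
proof -
  let ?\<delta> = "(\<lambda>t\<in>{0..}. None) :: 'a path"
  let ?R = "return raw_events ?\<delta>"
  have raw: "{\<omega> \<in> paths. \<omega> 0 \<noteq> None} \<in> sets (raw_events :: 'a path measure)"
    by (rule alive_raw_events) simp
  have "hit \<subseteq> {\<omega> \<in> paths. \<omega> 0 \<noteq> None}"
  proof
    fix \<omega> assume "\<omega> \<in> hit"
    then obtain t where "\<omega> \<in> paths" "0 < t" "\<omega> t = Some a"
      by (auto simp: hit_def hitting_time_finite_iff simp del: infinity_ennreal_def)
    then show "\<omega> \<in> {\<omega> \<in> paths. \<omega> 0 \<noteq> None}" using path_absorbed[of \<omega> 0 t] by auto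
  qed
  moreover have "{\<omega> \<in> paths. \<omega> 0 \<noteq> None} \<in> null_sets ?R"
    using raw emeasure_return[OF raw, of ?\<delta>] by (simp add: null_sets_def)
  ultimately have "hit \<in> null_sets (completion ?R)"
    unfolding null_sets_completion_iff2 by blast
  then show ?thesis by (simp add: law_def null_sets_def)
qed

lemma emeasure_law_hit_ext0: "emeasure (law P z) hit = ext0 hit_prob z"
  by (cases z) (simp_all add: emeasure_law_hit emeasure_law_None_hit)

lemma hit_prob_le_1: "hit_prob y \<le> 1"
proof -
  have "hit_prob y \<le> (\<integral>\<^sup>+ \<omega>. 1 \<partial>P y)"
    unfolding hit_prob_def by (intro nn_integral_mono) (simp add: indicator_def)
  then show ?thesis by simp
qed

lemma future_hit:
  assumes \<omega>: "\<omega> \<in> paths" and t: "0 \<le> t"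
  shows "future t (indicator hit) \<omega> = indicator {\<omega>. ennreal t < last_exit a \<omega>} \<omega>"
proof (cases "\<omega> t")
  case None
  have "\<not> hitting_time a (shift t \<omega>) < \<infinity>"
    unfolding shift_of_dead[OF \<omega> t None] hitting_time_dead by simp
  then show ?thesis
    using None last_exit_gt_iff[OF t] by (simp add: future_def)
next
  case (Some y)
  then show ?thesis
    using shift_paths[OF \<omega> t] last_exit_gt_iff[OF t]
    by (simp add: future_def hit_def indicator_def del: infinity_ennreal_def)
qed

lemma last_exit_gt_measurable:
  assumes t: "0 \<le> t"
  shows "{\<omega> \<in> paths. ennreal t < last_exit a \<omega>} \<in> sets (completion (P x))"
proof -
  have "future t (indicator hit) \<in> borel_measurable (completion (P x))"
    by (rule future_measurable[OF t borel_measurable_indicator[OF hit_events]])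
  from measurable_sets[OF this, of "{1}"]
  have "future t (indicator hit) -` {1} \<inter> paths \<in> sets (completion (P x))" by simp
  moreover have "future t (indicator hit) -` {1} \<inter> paths = {\<omega> \<in> paths. ennreal t < last_exit a \<omega>}"
    using future_hit[OF _ t] by (auto simp: indicator_def)
  ultimately show ?thesis by simp
qed

text \<open>The last exit exceeds \<open>t\<close> if and only if the path after time \<open>t\<close> hits \<open>a\<close>.\<close>

lemma last_exit_tail:
  assumes t: "0 \<le> t" and Z: "Z \<in> borel_measurable (completed_filtration P t)"
  shows "(\<integral>\<^sup>+ \<omega>. Z \<omega> * indicator {\<omega>. ennreal t < last_exit a \<omega>} \<omega> \<partial>P x) =
         (\<integral>\<^sup>+ \<omega>. Z \<omega> * ext0 hit_prob (\<omega> t) \<partial>P x)"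
proof -
  have "(\<integral>\<^sup>+ \<omega>. Z \<omega> * indicator {\<omega>. ennreal t < last_exit a \<omega>} \<omega> \<partial>P x) =
      (\<integral>\<^sup>+ \<omega>. Z \<omega> * future t (indicator hit) \<omega> \<partial>P x)"
    using future_hit[OF _ t] by (intro nn_integral_cong) simp
  also have "\<dots> = (\<integral>\<^sup>+ \<omega>. Z \<omega> * ext0 hit_prob (\<omega> t) \<partial>P x)"
    unfolding hit_prob_def[abs_def] using hit_events by (intro markov[OF t Z]) simp
  finally show ?thesis .
qed

end


section \<open>Integration against a continuous nondecreasing function\<close>

text \<open>Integrals against \<open>dF\<close> are computed by the change of time \<open>F t = s\<close>: the measure \<open>dF\<close> is the
  image of Lebesgue measure under the first time at which the level \<open>s\<close> is reached. In this form
  joint measurability, the effect of a time shift and the product structure of the Campbell measure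
  are immediate.\<close>

text \<open>Only positive levels count. They are reached at positive times, so that the image measure has no
  mass at \<open>0\<close>.\<close>

definition reached :: "(real \<Rightarrow> real) \<Rightarrow> real \<Rightarrow> bool" where
  "reached F s \<longleftrightarrow> 0 < s \<and> (\<exists>t\<ge>0. s \<le> F t)"

definition level_time :: "(real \<Rightarrow> real) \<Rightarrow> real \<Rightarrow> real" where
  "level_time F s = (if reached F s then Inf {t. 0 \<le> t \<and> s \<le> F t} else 0)"

definition growth_integral :: "(real \<Rightarrow> real) \<Rightarrow> (real \<Rightarrow> ennreal) \<Rightarrow> ennreal" where
  "growth_integral F f = (\<integral>\<^sup>+ s. (if reached F s then f (level_time F s) else 0) \<partial>lborel)"

locale growth =
  fixes F :: "real \<Rightarrow> real"
  assumes zero: "F 0 = 0" and mono: "mono_on {0..} F" and cont: "continuous_on {0..} F"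
begin

lemma monoD: "0 \<le> s \<Longrightarrow> s \<le> t \<Longrightarrow> F s \<le> F t"
  using mono by (auto simp: mono_on_def)

lemma nonneg: "0 \<le> t \<Longrightarrow> 0 \<le> F t"
  using monoD[of 0 t] zero by simp

lemma level_time_attained:
  assumes "reached F s"
  shows "0 \<le> level_time F s" "s \<le> F (level_time F s)"
proof -
  let ?S = "{t. 0 \<le> t \<and> s \<le> F t}"
  have "?S = {0..} \<inter> F -` {s..}" by auto
  then have "closed ?S" using continuous_closed_preimage[OF cont, of "{s..}"] by simp
  moreover have "?S \<noteq> {}" using assms by (auto simp: reached_def)
  moreover have "bdd_below ?S" by (auto intro!: bdd_belowI[of _ 0])
  ultimately have "Inf ?S \<in> ?S" by (rule closed_contains_Inf[rotated 2])
  then show "0 \<le> level_time F s" "s \<le> F (level_time F s)"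
    using assms by (auto simp: level_time_def)
qed

lemma level_time_le_iff:
  assumes "reached F s" "0 \<le> q"
  shows "level_time F s \<le> q \<longleftrightarrow> s \<le> F q"
proof
  assume "level_time F s \<le> q"
  then show "s \<le> F q" using level_time_attained[OF assms(1)] monoD[of "level_time F s" q] by simp
next
  assume "s \<le> F q"
  then show "level_time F s \<le> q"
    using assms by (auto simp: level_time_def intro!: cInf_lower bdd_belowI[of _ 0])
qed

lemma level_time_pos: "reached F s \<Longrightarrow> 0 < level_time F s"
  using level_time_attained[of s] level_time_le_iff[of s 0] zero by (auto simp: reached_def)

lemma reached_le: "0 < s \<Longrightarrow> 0 \<le> t \<Longrightarrow> s \<le> F t \<Longrightarrow> reached F s"
  by (auto simp: reached_def)

lemma reached_iff_nat: "reached F s \<longleftrightarrow> 0 < s \<and> (\<exists>n::nat. s \<le> F (real n))"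
proof
  assume "reached F s"
  then obtain t where "0 < s" "0 \<le> t" "s \<le> F t" by (auto simp: reached_def)
  moreover obtain n :: nat where "t \<le> real n" using real_arch_simple by blast
  ultimately show "0 < s \<and> (\<exists>n::nat. s \<le> F (real n))"
    using monoD[of t "real n"] by (auto intro: order_trans)
next
  assume "0 < s \<and> (\<exists>n::nat. s \<le> F (real n))"
  then obtain n :: nat where "0 < s" "s \<le> F (real n)" by blast
  then show "reached F s" by (intro reached_le[of s "real n"]) auto
qed

lemma level_time_interval:
  assumes "p \<le> q"
  shows "reached F s \<and> p < level_time F s \<and> level_time F s \<le> q \<longleftrightarrow> s \<in> {F (max 0 p)<..F (max 0 q)}"
proof (cases "0 \<le> q")
  case True
  have "reached F s \<Longrightarrow> p < level_time F s \<longleftrightarrow> F (max 0 p) < s"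
    using level_time_le_iff[of s "max 0 p"] level_time_pos[of s] zero
    by (cases "0 \<le> p") (auto simp: not_le[symmetric] max_def reached_def)
  moreover have "reached F s" if "F (max 0 p) < s" "s \<le> F q"
    using that nonneg[of "max 0 p"] True by (intro reached_le[of s q]) auto
  ultimately show ?thesis
    using True level_time_le_iff[of s q] by (auto simp: max_def)
next
  case False
  then show ?thesis using assms level_time_attained[of s] by auto
qed

end

lemma (in growth) reached_shift:
  assumes t: "0 \<le> t" and H: "\<And>r. 0 \<le> r \<Longrightarrow> F (t + r) = F t + H r" and H0: "growth H" and s: "0 < s"
  shows "reached F (F t + s) \<longleftrightarrow> reached H s"
    and "reached H s \<Longrightarrow> level_time F (F t + s) = t + level_time H s"
proof -
  interpret H: growth H by fact
  show eq: "reached F (F t + s) \<longleftrightarrow> reached H s"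
  proof
    assume "reached F (F t + s)"
    then obtain u where u: "0 \<le> u" "F t + s \<le> F u" by (auto simp: reached_def)
    then have "t \<le> u" using monoD[of u t] s by (cases "t \<le> u") auto
    with u H[of "u - t"] s show "reached H s" by (auto simp: reached_def intro!: exI[of _ "u - t"])
  next
    assume "reached H s"
    then obtain u where "0 \<le> u" "s \<le> H u" by (auto simp: reached_def)
    with H[of u] t s nonneg[of t] show "reached F (F t + s)"
      by (intro reached_le[of _ "t + u"]) auto
  qed
  assume rH: "reached H s"
  then have rF: "reached F (F t + s)" using eq by simp
  have "level_time F (F t + s) \<le> t + level_time H s"
    using H.level_time_attained[OF rH] H[of "level_time H s"] t
    by (subst level_time_le_iff[OF rF]) auto
  moreover have "t + level_time H s \<le> level_time F (F t + s)"
  proof -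
    let ?u = "level_time F (F t + s)"
    have u: "0 \<le> ?u" "F t + s \<le> F ?u" using level_time_attained[OF rF] .
    then have "t \<le> ?u" using monoD[of ?u t] s by (cases "t \<le> ?u") auto
    with u H[of "?u - t"] have "level_time H s \<le> ?u - t"
      by (subst H.level_time_le_iff[OF rH]) auto
    then show ?thesis by simp
  qed
  ultimately show "level_time F (F t + s) = t + level_time H s" by simp
qed

lemma level_time_jointly_measurable:
  assumes growth: "\<And>\<omega>. \<omega> \<in> space N \<Longrightarrow> growth (\<lambda>t. A t \<omega>)"
    and A: "\<And>t. 0 \<le> t \<Longrightarrow> A t \<in> borel_measurable N"
  shows "Measurable.pred (N \<Otimes>\<^sub>M borel) (\<lambda>(\<omega>, s). reached (\<lambda>t. A t \<omega>) s)"
    and "(\<lambda>(\<omega>, s). level_time (\<lambda>t. A t \<omega>) s) \<in> borel_measurable (N \<Otimes>\<^sub>M borel)"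
proof -
  have [measurable]: "(\<lambda>z. A t (fst z)) \<in> borel_measurable (N \<Otimes>\<^sub>M (borel :: real measure))" if "0 \<le> t" for t
    using measurable_compose[OF measurable_fst A[OF that]] .
  have "Measurable.pred (N \<Otimes>\<^sub>M borel) (\<lambda>z. 0 < snd z \<and> (\<exists>n::nat. snd z \<le> A (real n) (fst z)))"
    by measurable
  moreover have "(0 < snd z \<and> (\<exists>n::nat. snd z \<le> A (real n) (fst z))) \<longleftrightarrow> (case z of (\<omega>, s) \<Rightarrow> reached (\<lambda>t. A t \<omega>) s)"
    if "z \<in> space (N \<Otimes>\<^sub>M borel)" for z
    using growth.reached_iff_nat[OF growth[of "fst z"], of "snd z"] that
    by (auto simp: space_pair_measure split: prod.splits)
  ultimately show R: "Measurable.pred (N \<Otimes>\<^sub>M borel) (\<lambda>(\<omega>, s). reached (\<lambda>t. A t \<omega>) s)"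
    by (rule measurable_cong[THEN iffD1, rotated])
  show "(\<lambda>(\<omega>, s). level_time (\<lambda>t. A t \<omega>) s) \<in> borel_measurable (N \<Otimes>\<^sub>M borel)"
  proof (rule borel_measurableI_le)
    fix q :: real
    let ?S = "{z \<in> space (N \<Otimes>\<^sub>M borel). (case z of (\<omega>, s) \<Rightarrow> level_time (\<lambda>t. A t \<omega>) s) \<le> q}"
    show "?S \<in> sets (N \<Otimes>\<^sub>M borel)"
    proof (cases "0 \<le> q")
      case True
      have "(case z of (\<omega>, s) \<Rightarrow> level_time (\<lambda>t. A t \<omega>) s) \<le> q \<longleftrightarrow>
          ((case z of (\<omega>, s) \<Rightarrow> reached (\<lambda>t. A t \<omega>) s) \<longrightarrow> snd z \<le> A q (fst z))"
        if "z \<in> space (N \<Otimes>\<^sub>M borel)" for z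
        using growth.level_time_le_iff[OF growth[of "fst z"], of "snd z" q] that True
        by (auto simp: space_pair_measure level_time_def split: prod.splits)
      then have "?S = {z \<in> space (N \<Otimes>\<^sub>M borel).
          (case z of (\<omega>, s) \<Rightarrow> reached (\<lambda>t. A t \<omega>) s) \<longrightarrow> snd z \<le> A q (fst z)}" by blast
      also have "\<dots> \<in> sets (N \<Otimes>\<^sub>M borel)" using R True by measurable
      finally show ?thesis .
    next
      case False
      have "0 \<le> (case z of (\<omega>, s) \<Rightarrow> level_time (\<lambda>t. A t \<omega>) s)" if "z \<in> space (N \<Otimes>\<^sub>M borel)" for z
        using growth.level_time_attained(1)[OF growth[of "fst z"], of "snd z"] that
        by (cases "reached (\<lambda>t. A t (fst z)) (snd z)")
          (auto simp: space_pair_measure level_time_def split: prod.splits)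
      then have empty: "?S = {}" using False by force
      show ?thesis unfolding empty by (rule sets.empty_sets)
    qed
  qed
qed

lemma growth_integrand_jointly_measurable:
  assumes growth: "\<And>\<omega>. \<omega> \<in> space N \<Longrightarrow> growth (\<lambda>t. A t \<omega>)"
    and A: "\<And>t. 0 \<le> t \<Longrightarrow> A t \<in> borel_measurable N"
    and f[measurable]: "case_prod f \<in> borel_measurable (N \<Otimes>\<^sub>M borel)"
  shows "(\<lambda>(\<omega>, s). if reached (\<lambda>t. A t \<omega>) s then f \<omega> (level_time (\<lambda>t. A t \<omega>) s) else 0 :: ennreal)
    \<in> borel_measurable (N \<Otimes>\<^sub>M lborel)"
proof -
  note [measurable] = level_time_jointly_measurable[OF growth A]
  have sets: "sets (N \<Otimes>\<^sub>M (lborel :: real measure)) = sets (N \<Otimes>\<^sub>M borel)" by (intro sets_pair_measure_cong) auto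
  have "(\<lambda>z. (fst z, case z of (\<omega>, s) \<Rightarrow> level_time (\<lambda>t. A t \<omega>) s)) \<in> N \<Otimes>\<^sub>M borel \<rightarrow>\<^sub>M N \<Otimes>\<^sub>M borel"
    by (intro measurable_Pair measurable_fst level_time_jointly_measurable[OF growth A])
  from measurable_compose[OF this f]
  have "(\<lambda>z. f (fst z) (case z of (\<omega>, s) \<Rightarrow> level_time (\<lambda>t. A t \<omega>) s)) \<in> borel_measurable (N \<Otimes>\<^sub>M borel)" by simp
  then have "(\<lambda>z. if (case z of (\<omega>, s) \<Rightarrow> reached (\<lambda>t. A t \<omega>) s)
      then f (fst z) (case z of (\<omega>, s) \<Rightarrow> level_time (\<lambda>t. A t \<omega>) s) else 0) \<in> borel_measurable (N \<Otimes>\<^sub>M borel)"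
    by (intro measurable_If level_time_jointly_measurable[OF growth A]) auto
  then show ?thesis
    unfolding measurable_cong_sets[OF sets refl] by (simp add: case_prod_beta')
qed

lemma growth_integral_measurable:
  assumes growth: "\<And>\<omega>. \<omega> \<in> space N \<Longrightarrow> growth (\<lambda>t. A t \<omega>)"
    and A: "\<And>t. 0 \<le> t \<Longrightarrow> A t \<in> borel_measurable N"
    and f: "case_prod f \<in> borel_measurable (N \<Otimes>\<^sub>M borel)"
  shows "(\<lambda>\<omega>. growth_integral (\<lambda>t. A t \<omega>) (f \<omega>)) \<in> borel_measurable N"
  unfolding growth_integral_def
  by (rule lborel.borel_measurable_nn_integral[OF growth_integrand_jointly_measurable[OF growth A f]])

context growth
begin

lemma reached_measurable[measurable]: "Measurable.pred borel (reached F)"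
  and level_time_measurable[measurable]: "level_time F \<in> borel_measurable borel"
proof -
  let ?N = "count_space (UNIV :: unit set)"
  have J: "Measurable.pred (?N \<Otimes>\<^sub>M borel) (\<lambda>(\<omega>, s). reached F s)"
    "(\<lambda>(\<omega>, s). level_time F s) \<in> borel_measurable (?N \<Otimes>\<^sub>M borel)"
    by (rule level_time_jointly_measurable[of ?N "\<lambda>t _. F t"]; simp add: growth_axioms)+
  have pair: "(\<lambda>s. ((), s)) \<in> borel \<rightarrow>\<^sub>M ?N \<Otimes>\<^sub>M (borel :: real measure)" by simp
  show "Measurable.pred borel (reached F)" using measurable_compose[OF pair J(1)] by simp
  show "level_time F \<in> borel_measurable borel" using measurable_compose[OF pair J(2)] by simp
qed

lemma growth_integrand_measurable[measurable]:
  assumes f: "f \<in> borel_measurable borel"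
  shows "(\<lambda>s. if reached F s then f (level_time F s) else 0 :: ennreal) \<in> borel_measurable borel"
  by (rule measurable_If[OF measurable_compose[OF level_time_measurable f] borel_measurable_const
        reached_measurable[unfolded pred_def]])

lemma growth_integral_mono:
  "(\<And>r. 0 < r \<Longrightarrow> f r \<le> g r) \<Longrightarrow> growth_integral F f \<le> growth_integral F g"
  unfolding growth_integral_def by (intro nn_integral_mono) (auto simp: level_time_pos)

lemma growth_integral_cong:
  "(\<And>r. 0 < r \<Longrightarrow> f r = g r) \<Longrightarrow> growth_integral F f = growth_integral F g"
  by (intro antisym growth_integral_mono) auto

lemma growth_integral_cmult:
  assumes [measurable]: "f \<in> borel_measurable borel"
  shows "growth_integral F (\<lambda>r. c * f r) = c * growth_integral F f"
  unfolding growth_integral_def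
  by (subst nn_integral_cmult[symmetric]) (auto intro!: nn_integral_cong)

lemma growth_integral_add:
  assumes [measurable]: "f \<in> borel_measurable borel" "g \<in> borel_measurable borel"
  shows "growth_integral F (\<lambda>r. f r + g r) = growth_integral F f + growth_integral F g"
  unfolding growth_integral_def
  by (subst nn_integral_add[symmetric]) (auto intro!: nn_integral_cong)

lemma growth_integral_incseq:
  assumes [measurable]: "\<And>n. f n \<in> borel_measurable borel" and "\<And>r m n. m \<le> n \<Longrightarrow> f m r \<le> f n r"
    and lim: "\<And>r. 0 < r \<Longrightarrow> (\<lambda>n. f n r) \<longlonglongrightarrow> g r"
  shows "(\<lambda>n. growth_integral F (f n)) \<longlonglongrightarrow> growth_integral F g"
  unfolding growth_integral_def
proof (rule nn_integral_LIMSEQ)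
  show "incseq (\<lambda>n s. if reached F s then f n (level_time F s) else 0)"
    using assms(2) by (auto simp: incseq_def le_fun_def)
  show "(\<lambda>n. if reached F s then f n (level_time F s) else 0) \<longlonglongrightarrow>
      (if reached F s then g (level_time F s) else 0)" for s
    using lim[OF level_time_pos] by auto
qed simp

text \<open>By continuity the level \<open>s\<close> is reached in \<open>(p, q]\<close> if and only if \<open>s\<close> lies in \<open>(F p, F q]\<close>; so both
  measures agree on half-open intervals.\<close>

lemma interval_measure_eq:
  "interval_measure (\<lambda>t. F (max 0 t)) =
    distr (density lborel (\<lambda>s. indicator {s. reached F s} s)) borel (level_time F)" (is "?I = ?D")
proof (rule measure_eqI_generator_eq[where A="\<lambda>n::nat. {- real n<..real n}" and
      E="range (\<lambda>(p, q). {p<..q :: real})" and \<Omega>="UNIV :: real set"])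
  have mono': "F (max 0 x) \<le> F (max 0 y)" if "x \<le> y" for x y
    using that by (intro monoD) auto
  have "continuous_on UNIV (\<lambda>t. F (max 0 t))"
    by (intro continuous_on_compose2[OF cont]) (auto intro!: continuous_intros)
  then have rc: "continuous (at_right x) (\<lambda>t. F (max 0 t))" for x
    by (simp add: continuous_on_eq_continuous_at continuous_at_imp_continuous_within)
  have I: "emeasure ?I {p<..q} = ennreal (F (max 0 q) - F (max 0 p))" if "p \<le> q" for p q
    using emeasure_interval_measure_Ioc[OF that mono' rc] by simp
  have D: "emeasure ?D {p<..q} = ennreal (F (max 0 q) - F (max 0 p))" if "p \<le> q" for p q
  proof -
    have vimage: "level_time F -` {p<..q} \<in> sets lborel"
      using measurable_sets[OF level_time_measurable, of "{p<..q}"] by simp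
    have "{s. reached F s} \<in> sets borel" using reached_measurable by (simp add: pred_def)
    then have ind: "(\<lambda>s. indicator {s. reached F s} s :: ennreal) \<in> borel_measurable lborel" by simp
    have "emeasure ?D {p<..q} = emeasure (density lborel (\<lambda>s. indicator {s. reached F s} s)) (level_time F -` {p<..q})"
      by (subst emeasure_distr) auto
    also have "\<dots> = (\<integral>\<^sup>+ s. indicator {s. reached F s} s * indicator (level_time F -` {p<..q}) s \<partial>lborel)"
      by (rule emeasure_density[OF ind vimage])
    also have "\<dots> = (\<integral>\<^sup>+ s. indicator {F (max 0 p)<..F (max 0 q)} s \<partial>lborel)"
      using level_time_interval[OF that] by (intro nn_integral_cong) (auto simp: indicator_def)
    also have "\<dots> = ennreal (F (max 0 q) - F (max 0 p))"
      using mono'[OF that] by simp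
    finally show ?thesis .
  qed
  show "Int_stable (range (\<lambda>(p, q). {p<..q :: real}))"
  proof (rule Int_stableI)
    fix X Y :: "real set"
    assume "X \<in> range (\<lambda>(p, q). {p<..q})" "Y \<in> range (\<lambda>(p, q). {p<..q})"
    then obtain p q p' q' where "X = {p<..q}" "Y = {p'<..q'}" by auto
    then show "X \<inter> Y \<in> range (\<lambda>(p, q). {p<..q})"
      by (intro range_eqI[of _ _ "(max p p', min q q')"]) auto
  qed
  show "emeasure ?I X = emeasure ?D X" if X_range: "X \<in> range (\<lambda>(p, q). {p<..q})" for X
  proof -
    obtain p q where X: "X = {p<..q}" using X_range by auto
    show ?thesis using I[of p q] D[of p q] X by (cases "p \<le> q") auto
  qed
  show "emeasure ?I {- real n<..real n} \<noteq> \<infinity>" for n using I[of "- real n" "real n"] by simp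
  show "(\<Union>n::nat. {- real n<..real n}) = (UNIV :: real set)"
  proof (rule UNIV_eq_I[symmetric])
    fix x :: real
    obtain n :: nat where "\<bar>x\<bar> < real n" using reals_Archimedean2 by blast
    then show "x \<in> (\<Union>n::nat. {- real n<..real n})" by (auto intro!: exI[of _ n])
  qed
qed (auto simp: borel_sigma_sets_Ioc)

lemma nn_integral_interval_measure:
  assumes [measurable]: "f \<in> borel_measurable borel"
  shows "(\<integral>\<^sup>+ r. f r \<partial>interval_measure (\<lambda>t. F (max 0 t))) = growth_integral F f"
  unfolding interval_measure_eq growth_integral_def
  by (subst nn_integral_distr) (auto simp: nn_integral_density intro!: nn_integral_cong)

end

lemma growth_integral_zero: "growth_integral (\<lambda>_. 0) f = 0"
proof -
  have "\<not> reached (\<lambda>_. 0) s" for s by (auto simp: reached_def)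
  then show ?thesis by (simp add: growth_integral_def)
qed

lemma growth_zero: "growth (\<lambda>_. 0)"
  by standard (auto simp: mono_on_def)

text \<open>Translating Lebesgue measure by \<open>F t\<close> turns the levels that \<open>F\<close> reaches after time \<open>t\<close> into
  the levels that the increments \<open>H\<close> after time \<open>t\<close> reach.\<close>

lemma (in growth) growth_integral_shift:
  assumes t: "0 \<le> t" and H: "\<And>r. 0 \<le> r \<Longrightarrow> F (t + r) = F t + H r" and H0: "growth H"
    and f[measurable]: "f \<in> borel_measurable borel"
  shows "growth_integral F (\<lambda>r. indicator {t<..} r * f (r - t)) = growth_integral H f"
proof -
  interpret H: growth H by fact
  let ?g = "\<lambda>s. if reached F s then indicator {t<..} (level_time F s) * f (level_time F s - t) else 0"
  have "(\<integral>\<^sup>+ s. ?g s \<partial>lborel) = ennreal \<bar>1\<bar> * (\<integral>\<^sup>+ s. ?g (F t + 1 * s) \<partial>lborel)"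
    by (rule nn_integral_real_affine) auto
  also have "\<dots> = (\<integral>\<^sup>+ s. (if reached H s then f (level_time H s) else 0) \<partial>lborel)"
    unfolding abs_one ennreal_1 mult_1
  proof (rule nn_integral_cong)
    fix s
    show "?g (F t + s) = (if reached H s then f (level_time H s) else 0)"
    proof (cases "0 < s")
      case True
      then show ?thesis
        using reached_shift[OF t H H0 True] H.level_time_pos[of s] by auto
    next
      case False
      then have "\<not> reached H s" by (simp add: reached_def)
      moreover have "level_time F (F t + s) \<le> t" if "reached F (F t + s)"
        using level_time_le_iff[OF that t] False by simp
      ultimately show ?thesis by (auto simp: indicator_def)
    qed
  qed
  finally show ?thesis unfolding growth_integral_def .
qed


lemma (in growth) growth_integral_suminf:
  assumes [measurable]: "\<And>n. f n \<in> borel_measurable borel"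
  shows "growth_integral F (\<lambda>r. \<Sum>n. f n r) = (\<Sum>n. growth_integral F (f n))"
  unfolding growth_integral_def
  by (subst nn_integral_suminf[symmetric]) (auto intro!: nn_integral_cong)

lemma (in growth) growth_integral_Fatou:
  assumes [measurable]: "\<And>n. f n \<in> borel_measurable borel"
    and lim: "\<And>r. 0 < r \<Longrightarrow> (\<lambda>n. f n r) \<longlonglongrightarrow> g r"
  shows "growth_integral F g \<le> liminf (\<lambda>n. growth_integral F (f n))"
proof -
  have "(\<lambda>n. if reached F s then f n (level_time F s) else 0) \<longlonglongrightarrow>
      (if reached F s then g (level_time F s) else 0)" for s
    using lim[OF level_time_pos] by auto
  from lim_imp_Liminf[OF sequentially_bot this]
  have "growth_integral F g = (\<integral>\<^sup>+ s. liminf (\<lambda>n. if reached F s then f n (level_time F s) else 0) \<partial>lborel)"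
    unfolding growth_integral_def by simp
  also have "\<dots> \<le> liminf (\<lambda>n. growth_integral F (f n))"
    unfolding growth_integral_def by (intro nn_integral_liminf) simp
  finally show ?thesis .
qed

lemma (in growth) growth_integral_eq_0_mono:
  assumes f[measurable]: "f \<in> borel_measurable borel" and zero: "growth_integral F f = 0"
    and le: "\<And>r. 0 < r \<Longrightarrow> f r = 0 \<Longrightarrow> g r = 0"
  shows "growth_integral F g = 0"
proof -
  have "AE s in lborel. (if reached F s then f (level_time F s) else 0) = 0"
    using zero unfolding growth_integral_def by (subst (asm) nn_integral_0_iff_AE) auto
  then have "AE s in lborel. (if reached F s then g (level_time F s) else 0) = 0"
    by eventually_elim (use le level_time_pos in \<open>auto split: if_splits\<close>)
  then show ?thesis unfolding growth_integral_def by (simp cong: nn_integral_cong_AE)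
qed


section \<open>Potentials of an additive functional\<close>

lemma exp_measurable[measurable]: "(\<lambda>r::real. ennreal (exp (- (\<alpha> * r)))) \<in> borel_measurable borel"
  by measurable

text \<open>Every path of \<open>A\<close> is continuous and nondecreasing, while the additivity at a given time holds
  almost surely. There is no growth after the death of the path.\<close>

locale additive_functional = borel_right P
  for P :: "'a::topological_space \<Rightarrow> 'a path measure" +
  fixes A :: "real \<Rightarrow> 'a path \<Rightarrow> real"
  assumes A_measurable: "0 \<le> t \<Longrightarrow> A t \<in> borel_measurable (events P)"
    and growth_A: "growth (\<lambda>t. A t \<omega>)"
    and additive: "0 \<le> t \<Longrightarrow>
      AE \<omega> in P x. \<forall>r\<ge>0. A (t + r) \<omega> = A t \<omega> + (if \<omega> t = None then 0 else A r (shift t \<omega>))"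
begin

definition additive_integral :: "(real \<Rightarrow> ennreal) \<Rightarrow> 'a path \<Rightarrow> ennreal" where
  "additive_integral f \<omega> = growth_integral (\<lambda>t. A t \<omega>) f"

lemma additive_integral_measurable:
  assumes f: "f \<in> borel_measurable borel"
  shows "additive_integral f \<in> borel_measurable (events P)"
proof -
  have "case_prod (\<lambda>_. f) \<in> borel_measurable (events P \<Otimes>\<^sub>M borel)"
    using measurable_compose[OF measurable_snd f] by (simp add: case_prod_beta')
  from growth_integral_measurable[OF growth_A A_measurable this]
  show ?thesis unfolding additive_integral_def[abs_def] .
qed

lemma additive_integral_shift:
  assumes t: "0 \<le> t" and f: "f \<in> borel_measurable borel"
  shows "AE \<omega> in P x. additive_integral (\<lambda>r. indicator {t<..} r * f (r - t)) \<omega> =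
    future t (additive_integral f) \<omega>"
  using additive[OF t, of x]
proof eventually_elim
  case (elim \<omega>)
  interpret growth "\<lambda>t. A t \<omega>" by (rule growth_A)
  let ?H = "\<lambda>r. if \<omega> t = None then 0 else A r (shift t \<omega>)"
  have "growth ?H"
    using growth_A[of "shift t \<omega>"] growth_zero by (cases "\<omega> t") simp_all
  from growth_integral_shift[OF t _ this f] elim
  have "additive_integral (\<lambda>r. indicator {t<..} r * f (r - t)) \<omega> = growth_integral ?H f"
    by (simp add: additive_integral_def)
  then show ?case
    by (cases "\<omega> t") (simp_all add: future_def additive_integral_def growth_integral_zero)
qed

definition potential :: "real \<Rightarrow> 'a \<Rightarrow> ennreal" where
  "potential \<alpha> y = (\<integral>\<^sup>+ \<omega>. additive_integral (\<lambda>r. ennreal (exp (- (\<alpha> * r)))) \<omega> \<partial>P y)"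

definition tail_integral :: "real \<Rightarrow> real \<Rightarrow> 'a path \<Rightarrow> ennreal" where
  "tail_integral \<alpha> t = additive_integral (\<lambda>r. indicator {t<..} r * ennreal (exp (- (\<alpha> * r))))"

lemma tail_integral_measurable: "tail_integral \<alpha> t \<in> borel_measurable (events P)"
  unfolding tail_integral_def by (rule additive_integral_measurable) measurable

lemma tail_integral_0: "tail_integral \<alpha> 0 = additive_integral (\<lambda>r. ennreal (exp (- (\<alpha> * r))))"
  unfolding tail_integral_def additive_integral_def
  by (intro ext growth.growth_integral_cong[OF growth_A]) simp

lemma potential_eq_tail: "potential \<alpha> y = (\<integral>\<^sup>+ \<omega>. tail_integral \<alpha> 0 \<omega> \<partial>P y)"
  by (simp add: potential_def tail_integral_0)

lemma potential_universally_measurable: "universally_measurable (potential \<alpha>)"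
  unfolding potential_def[abs_def]
  by (intro expectation_universally_measurable additive_integral_measurable exp_measurable)

lemma tail_integral_eq:
  assumes t: "0 \<le> t"
  shows "AE \<omega> in P x. tail_integral \<alpha> t \<omega> =
    ennreal (exp (- (\<alpha> * t))) * future t (tail_integral \<alpha> 0) \<omega>"
  using additive_integral_shift[OF t exp_measurable, where \<alpha>1=\<alpha> and x=x]
proof eventually_elim
  case (elim \<omega>)
  interpret growth "\<lambda>t. A t \<omega>" by (rule growth_A)
  have "tail_integral \<alpha> t \<omega> = additive_integral (\<lambda>r. ennreal (exp (- (\<alpha> * t))) *
      (indicator {t<..} r * ennreal (exp (- (\<alpha> * (r - t)))))) \<omega>"
    unfolding tail_integral_def additive_integral_def
    by (intro growth_integral_cong)
      (auto simp: indicator_def ennreal_mult[symmetric] exp_add[symmetric] algebra_simps)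
  also have "\<dots> = ennreal (exp (- (\<alpha> * t))) *
      additive_integral (\<lambda>r. indicator {t<..} r * ennreal (exp (- (\<alpha> * (r - t))))) \<omega>"
    unfolding additive_integral_def by (rule growth_integral_cmult) measurable
  finally show ?case unfolding elim tail_integral_0 .
qed

lemma markov_tail_integral:
  assumes t: "0 \<le> t" and Z: "Z \<in> borel_measurable (completed_filtration P t)"
  shows "(\<integral>\<^sup>+ \<omega>. Z \<omega> * tail_integral \<alpha> t \<omega> \<partial>P x) =
    ennreal (exp (- (\<alpha> * t))) * (\<integral>\<^sup>+ \<omega>. Z \<omega> * ext0 (potential \<alpha>) (\<omega> t) \<partial>P x)"
proof -
  let ?c = "ennreal (exp (- (\<alpha> * t)))"
  have Zc: "(\<lambda>\<omega>. ?c * Z \<omega>) \<in> borel_measurable (completed_filtration P t)"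
    using Z by simp
  have "(\<integral>\<^sup>+ \<omega>. Z \<omega> * tail_integral \<alpha> t \<omega> \<partial>P x) = (\<integral>\<^sup>+ \<omega>. ?c * Z \<omega> * future t (tail_integral \<alpha> 0) \<omega> \<partial>P x)"
    using tail_integral_eq[OF t, where x=x and \<alpha>=\<alpha>] by (intro nn_integral_cong_AE) (auto simp: mult_ac elim!: eventually_mono)
  also have "\<dots> = (\<integral>\<^sup>+ \<omega>. ?c * Z \<omega> * ext0 (potential \<alpha>) (\<omega> t) \<partial>P x)"
    using markov[OF t Zc tail_integral_measurable[of \<alpha> 0], of x] by (simp only: potential_eq_tail[abs_def])
  also have "\<dots> = (\<integral>\<^sup>+ \<omega>. ?c * (Z \<omega> * ext0 (potential \<alpha>) (\<omega> t)) \<partial>completion (P x))"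
    by (simp only: nn_integral_completion mult.assoc)
  also have "\<dots> = ?c * (\<integral>\<^sup>+ \<omega>. Z \<omega> * ext0 (potential \<alpha>) (\<omega> t) \<partial>completion (P x))"
    using measurable_events_P[OF measurable_completed_filtration_events[OF Z]]
      universally_measurable_at[OF t potential_universally_measurable]
    by (intro nn_integral_cmult borel_measurable_times_ennreal)
  finally show ?thesis by (simp only: nn_integral_completion)
qed

lemma expectation_tail_integral:
  assumes t: "0 \<le> t"
  shows "(\<integral>\<^sup>+ \<omega>. tail_integral \<alpha> t \<omega> \<partial>P x) = ennreal (exp (- (\<alpha> * t))) * semigroup P t (potential \<alpha>) x"
  using markov_tail_integral[OF t borel_measurable_const[of 1], where \<alpha>=\<alpha> and x=x] by (simp add: semigroup_eq)

lemma tail_integral_antimono: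
  "s \<le> t \<Longrightarrow> tail_integral \<alpha> t \<omega> \<le> tail_integral \<alpha> s \<omega>"
  unfolding tail_integral_def additive_integral_def
  by (intro growth.growth_integral_mono[OF growth_A]) (auto simp: indicator_def)

lemma tail_integral_LIMSEQ:
  assumes S: "decseq S" "S \<longlonglongrightarrow> 0" "\<And>n. 0 < S n"
  shows "(\<lambda>n. tail_integral \<alpha> (S n) \<omega>) \<longlonglongrightarrow> tail_integral \<alpha> 0 \<omega>"
  unfolding tail_integral_def additive_integral_def
proof (rule growth.growth_integral_incseq[OF growth_A])
  show "indicator {S m<..} r * ennreal (exp (- (\<alpha> * r))) \<le> indicator {S n<..} r * ennreal (exp (- (\<alpha> * r)))"
    if "m \<le> n" for m n r
    using decseqD[OF S(1) that] by (auto simp: indicator_def)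
next
  fix r :: real assume "0 < r"
  then have "\<forall>\<^sub>F n in sequentially. S n < r" using S(2) by (auto dest: order_tendstoD)
  then have "\<forall>\<^sub>F n in sequentially. indicator {S n<..} r * ennreal (exp (- (\<alpha> * r))) =
      indicator {0<..} r * ennreal (exp (- (\<alpha> * r)))"
    by eventually_elim (use \<open>0 < r\<close> in simp)
  then show "(\<lambda>n. indicator {S n<..} r * ennreal (exp (- (\<alpha> * r)))) \<longlonglongrightarrow>
      indicator {0<..} r * ennreal (exp (- (\<alpha> * r)))"
    by (rule tendsto_eventually)
qed measurable

text \<open>Discounting the expected potential at time \<open>t\<close> gives the mean of the discounted growth after
  time \<open>t\<close>. This is at most the mean over all times, to which it increases as \<open>t\<close> tends to \<open>0\<close>.\<close>

lemma excessive_potential: "excessive P \<alpha> (potential \<alpha>)"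
  unfolding excessive_def
proof (intro conjI allI impI)
  show "universally_measurable (potential \<alpha>)" by (rule potential_universally_measurable)
next
  fix x :: 'a and t :: real assume t: "0 \<le> t"
  have "ennreal (exp (- \<alpha> * t)) * semigroup P t (potential \<alpha>) x = (\<integral>\<^sup>+ \<omega>. tail_integral \<alpha> t \<omega> \<partial>P x)"
    using expectation_tail_integral[OF t] by simp
  also have "\<dots> \<le> potential \<alpha> x"
    unfolding potential_eq_tail using t by (intro nn_integral_mono tail_integral_antimono)
  finally show "ennreal (exp (- \<alpha> * t)) * semigroup P t (potential \<alpha>) x \<le> potential \<alpha> x" .
next
  fix x :: 'a
  show "((\<lambda>t. ennreal (exp (- \<alpha> * t)) * semigroup P t (potential \<alpha>) x) \<longlongrightarrow> potential \<alpha> x) (at_right 0)"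
  proof (rule tendsto_at_right_sequentially[of 0 1])
    fix S :: "nat \<Rightarrow> real"
    assume S: "\<And>n. 0 < S n" "\<And>n. S n < 1" "decseq S" "S \<longlonglongrightarrow> 0"
    have "(\<lambda>n. \<integral>\<^sup>+ \<omega>. tail_integral \<alpha> (S n) \<omega> \<partial>completion (P x)) \<longlonglongrightarrow>
        (\<integral>\<^sup>+ \<omega>. tail_integral \<alpha> 0 \<omega> \<partial>completion (P x))"
    proof (rule nn_integral_LIMSEQ)
      show "incseq (\<lambda>n. tail_integral \<alpha> (S n))"
        using decseqD[OF S(3)] tail_integral_antimono by (auto simp: incseq_def le_fun_def)
      show "tail_integral \<alpha> (S n) \<in> borel_measurable (completion (P x))" for n
        by (rule measurable_events_P[OF tail_integral_measurable])
    qed (rule tail_integral_LIMSEQ[OF S(3,4,1)])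
    moreover have "(\<integral>\<^sup>+ \<omega>. tail_integral \<alpha> (S n) \<omega> \<partial>completion (P x)) =
        ennreal (exp (- \<alpha> * S n)) * semigroup P (S n) (potential \<alpha>) x" for n
      using expectation_tail_integral[OF less_imp_le[OF S(1)], where \<alpha>=\<alpha> and x=x]
      by (simp only: nn_integral_completion mult_minus_left)
    ultimately show "(\<lambda>n. ennreal (exp (- \<alpha> * S n)) * semigroup P (S n) (potential \<alpha>) x) \<longlonglongrightarrow> potential \<alpha> x"
      by (simp only: nn_integral_completion potential_eq_tail[symmetric])
  qed simp
qed

lemma potential_right_continuous:
  assumes "0 < \<alpha>"
  shows "AE \<omega> in P x. \<forall>t\<ge>0. continuous (at_right t) (\<lambda>s. ext0 (potential \<alpha>) (\<omega> s))"
proof -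
  have "\<forall>\<alpha>>0. \<forall>f. excessive P \<alpha> f \<longrightarrow> (\<forall>\<mu>\<in>initial_laws. AE \<omega> in law_init P \<mu>.
      \<forall>t\<ge>0. continuous (at_right t) (\<lambda>s. ext0 f (\<omega> s)))"
    using right_process unfolding right_process_def by blast
  then have "AE \<omega> in law_init P (return borel x). \<forall>t\<ge>0. continuous (at_right t) (\<lambda>s. ext0 (potential \<alpha>) (\<omega> s))"
    using assms excessive_potential return_initial_laws by blast
  then show ?thesis by (simp only: law_init_return)
qed

text \<open>Split the time axis into unit intervals. By the Markov property the interval that begins at
  \<open>n\<close> contributes at most \<open>e * exp (- \<alpha> n)\<close>.\<close>

lemma potential_bounded:
  assumes \<alpha>: "0 < \<alpha>" and le_1: "\<And>x. potential 1 x \<le> 1"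
  obtains C where "C < \<infinity>" "\<And>x. potential \<alpha> x \<le> C"
proof -
  define c where "c n = ennreal (exp (real n + 1) * exp (- (\<alpha> * real n)))" for n :: nat
  define C where "C = (\<Sum>n. ennreal (exp 1 * exp (- \<alpha>) ^ n))"
  have le: "ennreal (exp (- (\<alpha> * r))) \<le> (\<Sum>n. c n * (indicator {real n<..} r * ennreal (exp (- (1 * r)))))"
    if r: "0 < r" for r
  proof -
    \<comment> \<open>the unit interval \<open>(n, n + 1]\<close> that contains \<open>r\<close>\<close>
    define n where "n = nat (\<lceil>r\<rceil> - 1)"
    have n: "real n < r" "r \<le> real n + 1" using r by (auto simp: n_def) linarith+
    have "exp (- (\<alpha> * r)) \<le> exp (real n + 1) * exp (- (\<alpha> * real n)) * exp (- r)"
    proof -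
      have "\<alpha> * real n \<le> \<alpha> * r" using n \<alpha> by simp
      then have "- (\<alpha> * r) \<le> (real n + 1) + - (\<alpha> * real n) + - r" using n by simp
      then have "exp (- (\<alpha> * r)) \<le> exp ((real n + 1) + - (\<alpha> * real n) + - r)" by simp
      then show ?thesis by (simp only: exp_add)
    qed
    then have "ennreal (exp (- (\<alpha> * r))) \<le> c n * (indicator {real n<..} r * ennreal (exp (- (1 * r))))"
      using n by (simp add: c_def ennreal_mult[symmetric] ennreal_leI)
    also have "\<dots> \<le> (\<Sum>n. c n * (indicator {real n<..} r * ennreal (exp (- (1 * r)))))"
      using sum_le_suminf[of "\<lambda>n. c n * (indicator {real n<..} r * ennreal (exp (- (1 * r))))" "{n}"] by simp
    finally show ?thesis .
  qed
  have "additive_integral (\<lambda>r. ennreal (exp (- (\<alpha> * r)))) \<omega> \<le> (\<Sum>n. c n * tail_integral 1 (real n) \<omega>)" for \<omega>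
  proof -
    interpret growth "\<lambda>t. A t \<omega>" by (rule growth_A)
    have "additive_integral (\<lambda>r. ennreal (exp (- (\<alpha> * r)))) \<omega> \<le>
        growth_integral (\<lambda>t. A t \<omega>) (\<lambda>r. \<Sum>n. c n * (indicator {real n<..} r * ennreal (exp (- (1 * r)))))"
      unfolding additive_integral_def by (rule growth_integral_mono[OF le])
    also have "\<dots> = (\<Sum>n. growth_integral (\<lambda>t. A t \<omega>) (\<lambda>r. c n * (indicator {real n<..} r * ennreal (exp (- (1 * r))))))"
      by (rule growth_integral_suminf) measurable
    also have "\<dots> = (\<Sum>n. c n * tail_integral 1 (real n) \<omega>)"
      unfolding tail_integral_def additive_integral_def
      by (intro suminf_cong growth_integral_cmult) measurable
    finally show ?thesis .
  qed
  then have sum_le: "potential \<alpha> x \<le> (\<integral>\<^sup>+ \<omega>. (\<Sum>n. c n * tail_integral 1 (real n) \<omega>) \<partial>completion (P x))" for x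
    unfolding potential_def nn_integral_completion by (intro nn_integral_mono)
  have "potential \<alpha> x \<le> C" for x
  proof -
    note sum_le[of x]
    also have "(\<integral>\<^sup>+ \<omega>. (\<Sum>n. c n * tail_integral 1 (real n) \<omega>) \<partial>completion (P x)) =
        (\<Sum>n. \<integral>\<^sup>+ \<omega>. c n * tail_integral 1 (real n) \<omega> \<partial>completion (P x))"
      by (intro nn_integral_suminf borel_measurable_times_ennreal borel_measurable_const
          measurable_events_P[OF tail_integral_measurable])
    also have "\<dots> = (\<Sum>n. c n * (\<integral>\<^sup>+ \<omega>. tail_integral 1 (real n) \<omega> \<partial>completion (P x)))"
      by (intro suminf_cong nn_integral_cmult measurable_events_P[OF tail_integral_measurable])
    also have "\<dots> \<le> C"
      unfolding C_def
    proof (intro suminf_le allI)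
      fix n
      have "semigroup P (real n) (potential 1) x \<le> (\<integral>\<^sup>+ \<omega>. 1 \<partial>P x)"
        unfolding semigroup_eq using le_1
        by (intro nn_integral_mono) (simp add: ext0_def split: option.splits)
      then have "c n * (ennreal (exp (- (1 * real n))) * semigroup P (real n) (potential 1) x) \<le>
          c n * (ennreal (exp (- (1 * real n))) * 1)"
        by (intro mult_left_mono) auto
      also have "\<dots> = ennreal (exp 1 * exp (- \<alpha>) ^ n)"
        by (simp add: c_def ennreal_mult[symmetric] exp_add[symmetric] exp_of_nat_mult[symmetric] algebra_simps)
      finally show "c n * (\<integral>\<^sup>+ \<omega>. tail_integral 1 (real n) \<omega> \<partial>completion (P x)) \<le> ennreal (exp 1 * exp (- \<alpha>) ^ n)"
        by (simp add: nn_integral_completion expectation_tail_integral)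
    qed simp_all
    finally show ?thesis .
  qed
  moreover have "summable (\<lambda>n. exp 1 * exp (- \<alpha>) ^ n)"
    using \<alpha> by (intro summable_mult summable_geometric) simp
  then have "C < \<infinity>"
    unfolding C_def by (subst suminf_ennreal2) auto
  ultimately show thesis using that by blast
qed

end


section \<open>The potentials of the local time\<close>

text \<open>The normalisation of the local time is a condition on its \<open>1\<close>-potential.\<close>

locale local_time_process = regular_point P a U + additive_functional P A
  for P :: "'a::topological_space \<Rightarrow> 'a path measure" and a U A +
  assumes potential_1: "potential 1 x = (\<integral>\<^sup>+ \<omega>. exp_neg (hitting_time a \<omega>) \<partial>P x)"
    and transient: "AE \<omega> in P a. last_exit a \<omega> < \<infinity>"
begin

lemma potential_1_le_1: "potential 1 x \<le> 1"
proof -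
  have "potential 1 x \<le> (\<integral>\<^sup>+ \<omega>. 1 \<partial>P x)"
    unfolding potential_1 by (intro nn_integral_mono exp_neg_le_1)
  then show ?thesis by simp
qed

lemma potential_1_at: "potential 1 a = 1"
proof -
  have "potential 1 a = (\<integral>\<^sup>+ \<omega>. 1 \<partial>P a)"
    unfolding potential_1 using regular by (intro nn_integral_cong_AE) (auto elim!: eventually_mono)
  then show ?thesis by simp
qed

end

text \<open>\<open>grid_point n (grid_index n r)\<close> is the first point strictly after \<open>r\<close> of the grid of mesh
  \<open>1 / (n + 1)\<close>. It follows \<open>r\<close> strictly so that right-continuity applies as \<open>n\<close> tends to infinity.\<close>

definition grid_index :: "nat \<Rightarrow> real \<Rightarrow> nat" where
  "grid_index n r = nat \<lfloor>real (Suc n) * r\<rfloor>"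

definition grid_point :: "nat \<Rightarrow> nat \<Rightarrow> real" where
  "grid_point n k = (real k + 1) / real (Suc n)"

lemma grid_index_iff:
  assumes "0 \<le> r"
  shows "k = grid_index n r \<longleftrightarrow> real k / real (Suc n) \<le> r \<and> r < grid_point n k"
proof -
  have "real (Suc n) > 0" by simp
  have "k = grid_index n r \<longleftrightarrow> int k = \<lfloor>real (Suc n) * r\<rfloor>"
    using assms unfolding grid_index_def by (auto simp: nat_eq_iff)
  also have "\<dots> \<longleftrightarrow> real k \<le> real (Suc n) * r \<and> real (Suc n) * r < real k + 1"
    using floor_eq_iff[of "real (Suc n) * r" "int k"] by (simp only: of_int_of_nat_eq eq_commute)
  also have "\<dots> \<longleftrightarrow> real k / real (Suc n) \<le> r \<and> r < grid_point n k"
    unfolding grid_point_def using \<open>real (Suc n) > 0\<close>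
    by (simp only: divide_le_eq less_divide_eq if_True mult.commute) 
  finally show ?thesis .
qed

lemma grid_point_index:
  assumes "0 \<le> r"
  shows "r < grid_point n (grid_index n r)" "grid_point n (grid_index n r) \<le> r + 1 / real (Suc n)"
proof -
  have *: "real (grid_index n r) / real (Suc n) \<le> r" "r < grid_point n (grid_index n r)"
    using grid_index_iff[OF assms, of "grid_index n r" n] by auto
  show "r < grid_point n (grid_index n r)" by (rule *(2))
  show "grid_point n (grid_index n r) \<le> r + 1 / real (Suc n)"
    using *(1) by (simp only: grid_point_def add_divide_distrib)
qed

lemma grid_point_nonneg: "0 \<le> grid_point n k"
  by (simp add: grid_point_def)

lemma grid_point_tendsto:
  assumes "0 \<le> r"
  shows "(\<lambda>n. grid_point n (grid_index n r)) \<longlonglongrightarrow> r"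
proof (rule tendsto_sandwich[of "\<lambda>_. r" _ _ "\<lambda>n. r + 1 / real (Suc n)"])
  have "(\<lambda>n. r + 1 / real (Suc n)) \<longlonglongrightarrow> r + 0"
    by (intro tendsto_add tendsto_const LIMSEQ_Suc[OF lim_1_over_n])
  then show "(\<lambda>n. r + 1 / real (Suc n)) \<longlonglongrightarrow> r" by simp
qed (auto intro!: always_eventually less_imp_le[OF grid_point_index(1)[OF assms]] simp del: of_nat_Suc
    simp: grid_point_index(2)[OF assms])

lemma suminf_ennreal_single:
  "(\<Sum>k. (if k = i then f k else 0 :: ennreal)) = f i"
  using sums_unique[OF sums_single[of i f]] by simp

context local_time_process
begin

definition on_finite :: "('a path \<Rightarrow> ennreal) \<Rightarrow> (real \<Rightarrow> 'a path \<Rightarrow> ennreal) \<Rightarrow> 'a path \<Rightarrow> ennreal" where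
  "on_finite T g \<omega> = (if T \<omega> < \<infinity> then g (enn2real (T \<omega>)) \<omega> else 0)"

lemma optional_time_grid_event:
  assumes T: "optional_time T"
  shows "{\<omega> \<in> paths. T \<omega> < \<infinity> \<and> k = grid_index n (enn2real (T \<omega>))} \<in> sets (raw_filtration (grid_point n k))"
proof -
  have eq: "{\<omega> \<in> paths. T \<omega> < \<infinity> \<and> k = grid_index n (enn2real (T \<omega>))} =
    {\<omega> \<in> paths. T \<omega> < ennreal (grid_point n k)} - {\<omega> \<in> paths. T \<omega> < ennreal (real k / real (Suc n))}"
  proof (rule set_eqI)
    fix \<omega>
    show "\<omega> \<in> {\<omega> \<in> paths. T \<omega> < \<infinity> \<and> k = grid_index n (enn2real (T \<omega>))} \<longleftrightarrow>
      \<omega> \<in> {\<omega> \<in> paths. T \<omega> < ennreal (grid_point n k)} - {\<omega> \<in> paths. T \<omega> < ennreal (real k / real (Suc n))}"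
    proof (cases "T \<omega>")
      case (real r)
      have "ennreal r < ennreal (real k / real (Suc n)) \<longleftrightarrow> r < real k / real (Suc n)"
        "ennreal r < ennreal (grid_point n k) \<longleftrightarrow> r < grid_point n k"
        using real(1) by (simp_all only: ennreal_less_iff)
      then show ?thesis using real grid_index_iff[OF real(1), of k n]
        by (simp only: mem_Collect_eq Diff_iff enn2real_ennreal not_less) auto
    qed simp
  qed
  have "real k / real (Suc n) \<le> grid_point n k"
    unfolding grid_point_def by (intro divide_right_mono) auto
  then have "{\<omega> \<in> paths. T \<omega> < ennreal (real k / real (Suc n))} \<in> sets (raw_filtration (grid_point n k))"
    using optional_timeD[OF T, of "real k / real (Suc n)"] raw_filtration_mono by fastforce
  with optional_timeD[OF T grid_point_nonneg[of n k]] show ?thesis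
    unfolding eq by (rule sets.Diff)
qed

text \<open>The Markov property at the grid points adds up to the Markov property at the grid point that
  follows \<open>T\<close>.\<close>

lemma markov_at_grid:
  assumes T: "optional_time T"
  shows "(\<integral>\<^sup>+ \<omega>. on_finite T (\<lambda>r. tail_integral \<alpha> (grid_point n (grid_index n r))) \<omega> \<partial>P x) =
    (\<integral>\<^sup>+ \<omega>. on_finite T (\<lambda>r \<omega>. ennreal (exp (- (\<alpha> * grid_point n (grid_index n r)))) *
      ext0 (potential \<alpha>) (\<omega> (grid_point n (grid_index n r)))) \<omega> \<partial>P x)"
    and "on_finite T (\<lambda>r \<omega>. ennreal (exp (- (\<alpha> * grid_point n (grid_index n r)))) *
      ext0 (potential \<alpha>) (\<omega> (grid_point n (grid_index n r)))) \<in> borel_measurable (completion (P x))" (is "?g \<in> _")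
    and "on_finite T (\<lambda>r. tail_integral \<alpha> (grid_point n (grid_index n r))) \<in> borel_measurable (completion (P x))" (is "?f \<in> _")
proof -
  define E where "E k = {\<omega> \<in> paths. T \<omega> < \<infinity> \<and> k = grid_index n (enn2real (T \<omega>))}" for k
  have E: "E k \<in> sets (raw_filtration (grid_point n k))" for k
    unfolding E_def by (rule optional_time_grid_event[OF T])
  have EP: "E k \<in> sets (completion (P x))" for k
    using E[of k] raw_filtration_subset_raw_events by auto
  define u where "u k \<omega> = indicator (E k) \<omega> * tail_integral \<alpha> (grid_point n k) \<omega>" for k \<omega>
  define v where "v k \<omega> = indicator (E k) \<omega> * (ennreal (exp (- (\<alpha> * grid_point n k))) * ext0 (potential \<alpha>) (\<omega> (grid_point n k)))" for k \<omega>
  have u: "u k \<in> borel_measurable (completion (P x))" for k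
    unfolding u_def using EP[of k] measurable_events_P[OF tail_integral_measurable]
    by (intro borel_measurable_times_ennreal borel_measurable_indicator)
  have v: "v k \<in> borel_measurable (completion (P x))" for k
    unfolding v_def using EP[of k] universally_measurable_at[OF grid_point_nonneg potential_universally_measurable]
    by (intro borel_measurable_times_ennreal borel_measurable_indicator borel_measurable_const)
  have sum: "(\<Sum>k. indicator (E k) \<omega> * h k) = (if T \<omega> < \<infinity> then h (grid_index n (enn2real (T \<omega>))) else 0)"
    if "\<omega> \<in> paths" for \<omega> and h :: "nat \<Rightarrow> ennreal"
  proof (cases "T \<omega> < \<infinity>")
    case True
    then have "(\<Sum>k. indicator (E k) \<omega> * h k) = (\<Sum>k. if k = grid_index n (enn2real (T \<omega>)) then h k else 0)"
      using that by (intro suminf_cong) (auto simp: E_def indicator_def)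
    then show ?thesis using True by (simp only: suminf_ennreal_single if_True)
  qed (simp add: E_def)
  have f_eq: "?f \<omega> = (\<Sum>k. u k \<omega>)" and g_eq: "?g \<omega> = (\<Sum>k. v k \<omega>)" if "\<omega> \<in> paths" for \<omega>
    unfolding u_def v_def sum[OF that] on_finite_def by (rule refl)+
  show "?f \<in> borel_measurable (completion (P x))"
    using u f_eq by (subst measurable_cong[of _ _ "\<lambda>\<omega>. \<Sum>k. u k \<omega>"]) auto
  show "?g \<in> borel_measurable (completion (P x))"
    using v g_eq by (subst measurable_cong[of _ _ "\<lambda>\<omega>. \<Sum>k. v k \<omega>"]) auto
  have uv: "(\<integral>\<^sup>+ \<omega>. u k \<omega> \<partial>completion (P x)) = (\<integral>\<^sup>+ \<omega>. v k \<omega> \<partial>completion (P x))" for k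
  proof -
    have "E k \<in> sets (completed_filtration P (grid_point n k))"
      using E[of k] raw_filtration_subset_completed by blast
    then have Z: "indicator (E k) \<in> borel_measurable (completed_filtration P (grid_point n k))" by simp
    let ?c = "ennreal (exp (- (\<alpha> * grid_point n k)))"
    have "(\<integral>\<^sup>+ \<omega>. u k \<omega> \<partial>P x) = ?c * (\<integral>\<^sup>+ \<omega>. indicator (E k) \<omega> * ext0 (potential \<alpha>) (\<omega> (grid_point n k)) \<partial>P x)"
      unfolding u_def by (rule markov_tail_integral[OF grid_point_nonneg Z])
    also have "\<dots> = ?c * (\<integral>\<^sup>+ \<omega>. indicator (E k) \<omega> * ext0 (potential \<alpha>) (\<omega> (grid_point n k)) \<partial>completion (P x))"
      by (simp only: nn_integral_completion)
    also have "\<dots> = (\<integral>\<^sup>+ \<omega>. ?c * (indicator (E k) \<omega> * ext0 (potential \<alpha>) (\<omega> (grid_point n k))) \<partial>completion (P x))"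
      using EP[of k] universally_measurable_at[OF grid_point_nonneg potential_universally_measurable]
      by (intro nn_integral_cmult[symmetric] borel_measurable_times_ennreal borel_measurable_indicator)
    also have "\<dots> = (\<integral>\<^sup>+ \<omega>. v k \<omega> \<partial>completion (P x))"
      unfolding v_def by (simp only: mult.left_commute)
    finally show ?thesis by (simp only: nn_integral_completion)
  qed
  have "(\<integral>\<^sup>+ \<omega>. ?f \<omega> \<partial>completion (P x)) = (\<integral>\<^sup>+ \<omega>. (\<Sum>k. u k \<omega>) \<partial>completion (P x))"
    using f_eq by (intro nn_integral_cong) simp
  also have "\<dots> = (\<integral>\<^sup>+ \<omega>. (\<Sum>k. v k \<omega>) \<partial>completion (P x))"
    using u v by (simp only: nn_integral_suminf uv)
  also have "\<dots> = (\<integral>\<^sup>+ \<omega>. ?g \<omega> \<partial>completion (P x))"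
    using g_eq by (intro nn_integral_cong) simp
  finally show "(\<integral>\<^sup>+ \<omega>. ?f \<omega> \<partial>P x) = (\<integral>\<^sup>+ \<omega>. ?g \<omega> \<partial>P x)"
    by (simp only: nn_integral_completion)
qed

lemma optional_time_measurable_P:
  assumes "optional_time T" shows "T \<in> borel_measurable (completion (P x))"
  by (rule measurable_completion)
    (unfold measurable_cong_sets[OF sets_P refl], rule optional_time_measurable[OF assms])

lemma on_finite_tail_measurable:
  assumes T: "optional_time T"
  shows "on_finite T (tail_integral \<alpha>) \<in> borel_measurable (completion (P x))"
proof -
  let ?N = "completion (P x)"
  have TP: "T \<in> borel_measurable ?N"
    by (rule optional_time_measurable_P[OF T])
  then have [measurable]: "(\<lambda>z. T (fst z)) \<in> borel_measurable (?N \<Otimes>\<^sub>M (borel :: real measure))"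
    by (rule measurable_compose[OF measurable_fst])
  have "case_prod (\<lambda>\<omega> r. indicator {enn2real (T \<omega>)<..} r * ennreal (exp (- (\<alpha> * r)))) =
    (\<lambda>z. (if enn2real (T (fst z)) < snd z then 1 else 0) * ennreal (exp (- (\<alpha> * snd z))))"
    by (auto simp: fun_eq_iff indicator_def)
  also have "\<dots> \<in> borel_measurable (?N \<Otimes>\<^sub>M (borel :: real measure))" by measurable
  finally have "(\<lambda>\<omega>. growth_integral (\<lambda>t. A t \<omega>)
      (\<lambda>r. indicator {enn2real (T \<omega>)<..} r * ennreal (exp (- (\<alpha> * r))))) \<in> borel_measurable ?N"
    by (intro growth_integral_measurable growth_A measurable_events_P A_measurable)
  then have *: "(\<lambda>\<omega>. tail_integral \<alpha> (enn2real (T \<omega>)) \<omega>) \<in> borel_measurable ?N"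
    by (simp only: tail_integral_def additive_integral_def)
  have "{\<omega> \<in> space ?N. T \<omega> < \<infinity>} \<in> sets ?N"
    using measurable_sets[OF TP, of "{..<\<infinity>}"] by (simp add: vimage_def Int_def conj_commute)
  from measurable_If[OF * borel_measurable_const[of 0] this]
  show ?thesis by (simp only: on_finite_def[abs_def])
qed

text \<open>The potential is bounded and right-continuous along the paths, so one can pass to the limit in
  the Markov property at the grid points that tend to \<open>T\<close> from above; at time \<open>T\<close> the path is at
  \<open>a\<close>.\<close>

lemma strong_markov_tail:
  assumes \<alpha>: "0 < \<alpha>" and T: "optional_time T"
    and at: "AE \<omega> in P x. \<forall>t\<ge>0. T \<omega> = ennreal t \<longrightarrow> \<omega> t = Some a"
  shows "(\<integral>\<^sup>+ \<omega>. on_finite T (tail_integral \<alpha>) \<omega> \<partial>P x) =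
    potential \<alpha> a * (\<integral>\<^sup>+ \<omega>. on_finite T (\<lambda>r _. ennreal (exp (- (\<alpha> * r)))) \<omega> \<partial>P x)"
proof -
  let ?Q = "completion (P x)"
  obtain C where C: "C < \<infinity>" "\<And>y. potential \<alpha> y \<le> C"
    using potential_bounded[OF \<alpha> potential_1_le_1] by blast
  define f where "f n = on_finite T (\<lambda>r. tail_integral \<alpha> (grid_point n (grid_index n r)))" for n
  define g where "g n = on_finite T (\<lambda>r \<omega>. ennreal (exp (- (\<alpha> * grid_point n (grid_index n r)))) *
      ext0 (potential \<alpha>) (\<omega> (grid_point n (grid_index n r))))" for n
  define h where "h = on_finite T (\<lambda>r _. ennreal (exp (- (\<alpha> * r))))"
  have meas: "f n \<in> borel_measurable ?Q" "g n \<in> borel_measurable ?Q" for n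
    unfolding f_def g_def by (rule markov_at_grid[OF T])+
  have fg: "(\<integral>\<^sup>+ \<omega>. f n \<omega> \<partial>?Q) = (\<integral>\<^sup>+ \<omega>. g n \<omega> \<partial>?Q)" for n
    unfolding f_def g_def nn_integral_completion by (rule markov_at_grid(1)[OF T])
  have TQ[measurable]: "T \<in> borel_measurable ?Q"
    by (rule optional_time_measurable_P[OF T])
  have h[measurable]: "h \<in> borel_measurable ?Q"
    unfolding h_def on_finite_def[abs_def] by measurable
  have lim: "AE \<omega> in ?Q. (\<lambda>n. g n \<omega>) \<longlonglongrightarrow> potential \<alpha> a * h \<omega>"
    unfolding AE_completion_iff using potential_right_continuous[OF \<alpha>, of x] at
  proof eventually_elim
    case (elim \<omega>)
    show ?case
    proof (cases "T \<omega>")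
      case (real r)
      let ?t = "\<lambda>n. grid_point n (grid_index n r)"
      have gt: "r < ?t n" for n by (rule grid_point_index(1)[OF real(1)])
      have "filterlim ?t (at_right r) sequentially"
        unfolding filterlim_at
        by (simp add: grid_point_tendsto[OF real(1)] gt gt[THEN less_imp_neq, THEN not_sym])
      moreover have "((\<lambda>s. ext0 (potential \<alpha>) (\<omega> s)) \<longlongrightarrow> ext0 (potential \<alpha>) (\<omega> r)) (at_right r)"
        using elim(1) real(1) by (auto simp: continuous_within)
      ultimately have "(\<lambda>n. ext0 (potential \<alpha>) (\<omega> (?t n))) \<longlonglongrightarrow> ext0 (potential \<alpha>) (\<omega> r)"
        by (rule filterlim_compose[rotated])
      moreover have "\<omega> r = Some a" using elim(2) real by auto
      ultimately have "(\<lambda>n. ext0 (potential \<alpha>) (\<omega> (?t n))) \<longlonglongrightarrow> potential \<alpha> a" by simp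
      moreover have "(\<lambda>n. ennreal (exp (- (\<alpha> * ?t n)))) \<longlonglongrightarrow> ennreal (exp (- (\<alpha> * r)))"
        by (intro tendsto_intros grid_point_tendsto real(1))
      ultimately have "(\<lambda>n. ennreal (exp (- (\<alpha> * ?t n))) * ext0 (potential \<alpha>) (\<omega> (?t n)))
          \<longlonglongrightarrow> ennreal (exp (- (\<alpha> * r))) * potential \<alpha> a"
        using C le_less_trans[OF C(2) C(1), of a]
        by (intro tendsto_mult_ennreal) (auto simp: ennreal_eq_0_iff)
      then show ?thesis
        using real by (simp add: g_def h_def on_finite_def mult.commute)
    next
      case top
      then show ?thesis by (simp add: g_def h_def on_finite_def)
    qed
  qed
  have g_lim: "(\<lambda>n. \<integral>\<^sup>+ \<omega>. g n \<omega> \<partial>?Q) \<longlonglongrightarrow> (\<integral>\<^sup>+ \<omega>. potential \<alpha> a * h \<omega> \<partial>?Q)"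
  proof (rule nn_integral_dominated_convergence[where w="\<lambda>_. C"])
    show "AE \<omega> in ?Q. g n \<omega> \<le> C" for n
    proof (rule AE_I2)
      fix \<omega>
      have "ennreal (exp (- (\<alpha> * grid_point n k))) * ext0 (potential \<alpha>) z \<le> 1 * C" for k z
        using C(2) \<alpha> grid_point_nonneg[of n k]
        by (intro mult_mono) (auto simp: ext0_def split: option.splits)
      then show "g n \<omega> \<le> C" by (simp add: g_def on_finite_def)
    qed
    show "(\<integral>\<^sup>+ \<omega>. C \<partial>?Q) < \<infinity>" unfolding nn_integral_completion using C(1) by simp
  qed (use meas lim in auto)
  \<comment> \<open>the growth after the grid points tends to the growth after \<open>T\<close>, since the grid points lie
    strictly after \<open>T\<close> and tend to it\<close>
  have "(\<integral>\<^sup>+ \<omega>. on_finite T (tail_integral \<alpha>) \<omega> \<partial>?Q) \<le> (\<integral>\<^sup>+ \<omega>. liminf (\<lambda>n. f n \<omega>) \<partial>?Q)"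
  proof (intro nn_integral_mono)
    fix \<omega>
    show "on_finite T (tail_integral \<alpha>) \<omega> \<le> liminf (\<lambda>n. f n \<omega>)"
    proof (cases "T \<omega>")
      case (real r)
      have "tail_integral \<alpha> r \<omega> \<le> liminf (\<lambda>n. tail_integral \<alpha> (grid_point n (grid_index n r)) \<omega>)"
        unfolding tail_integral_def additive_integral_def
      proof (rule growth.growth_integral_Fatou[OF growth_A])
        fix s :: real
        have "\<forall>\<^sub>F n in sequentially. indicator {grid_point n (grid_index n r)<..} s * ennreal (exp (- (\<alpha> * s))) =
            indicator {r<..} s * ennreal (exp (- (\<alpha> * s)))"
        proof (cases "r < s")
          case True
          then have "\<forall>\<^sub>F n in sequentially. grid_point n (grid_index n r) < s"
            using grid_point_tendsto[OF real(1)] by (auto dest: order_tendstoD)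
          then show ?thesis by eventually_elim (use True in simp)
        next
          case False
          have "\<not> grid_point n (grid_index n r) < s" for n
            using grid_point_index(1)[OF real(1), of n] False by simp
          then show ?thesis using False by (simp add: indicator_def)
        qed
        then show "(\<lambda>n. indicator {grid_point n (grid_index n r)<..} s * ennreal (exp (- (\<alpha> * s)))) \<longlonglongrightarrow>
            indicator {r<..} s * ennreal (exp (- (\<alpha> * s)))" by (rule tendsto_eventually)
      qed measurable
      then show ?thesis using real by (simp add: f_def on_finite_def)
    next
      case top
      then show ?thesis by (simp add: on_finite_def)
    qed
  qed
  also have "\<dots> \<le> liminf (\<lambda>n. \<integral>\<^sup>+ \<omega>. f n \<omega> \<partial>?Q)"
    by (rule nn_integral_liminf) (rule meas)
  also have "\<dots> = (\<integral>\<^sup>+ \<omega>. potential \<alpha> a * h \<omega> \<partial>?Q)"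
    unfolding fg by (rule lim_imp_Liminf[OF sequentially_bot g_lim])
  finally have 1: "(\<integral>\<^sup>+ \<omega>. on_finite T (tail_integral \<alpha>) \<omega> \<partial>?Q) \<le> (\<integral>\<^sup>+ \<omega>. potential \<alpha> a * h \<omega> \<partial>?Q)" .
  have "f n \<omega> \<le> on_finite T (tail_integral \<alpha>) \<omega>" for n \<omega>
    unfolding f_def on_finite_def
    using less_imp_le[OF grid_point_index(1)[OF enn2real_nonneg[of "T \<omega>"], of n]]
    by (simp add: tail_integral_antimono)
  then have "(\<integral>\<^sup>+ \<omega>. g n \<omega> \<partial>?Q) \<le> (\<integral>\<^sup>+ \<omega>. on_finite T (tail_integral \<alpha>) \<omega> \<partial>?Q)" for n
    unfolding fg[symmetric] by (intro nn_integral_mono)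
  then have 2: "(\<integral>\<^sup>+ \<omega>. potential \<alpha> a * h \<omega> \<partial>?Q) \<le> (\<integral>\<^sup>+ \<omega>. on_finite T (tail_integral \<alpha>) \<omega> \<partial>?Q)"
    by (intro LIMSEQ_le_const2[OF g_lim]) auto
  have "(\<integral>\<^sup>+ \<omega>. on_finite T (tail_integral \<alpha>) \<omega> \<partial>?Q) = (\<integral>\<^sup>+ \<omega>. potential \<alpha> a * h \<omega> \<partial>?Q)"
    using 1 2 by (rule antisym)
  also have "\<dots> = potential \<alpha> a * (\<integral>\<^sup>+ \<omega>. h \<omega> \<partial>?Q)" by (rule nn_integral_cmult) (rule h)
  finally show ?thesis unfolding h_def nn_integral_completion .
qed


text \<open>For \<open>\<alpha> = 1\<close> the strong Markov property and the normalisation of the local time give the same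
  finite mean to the integral over all times and to the integral over the times after the hitting
  time. So there is almost surely no growth before the hitting time, which settles all \<open>\<alpha>\<close>.\<close>

lemma no_growth_before_hitting:
  assumes T: "optional_time T" "AE \<omega> in P x. T \<omega> = hitting_time a \<omega>"
    "AE \<omega> in P x. \<forall>t\<ge>0. T \<omega> = ennreal t \<longrightarrow> \<omega> t = Some a"
  shows "AE \<omega> in P x. \<forall>\<alpha>. on_finite T (tail_integral \<alpha>) \<omega> = tail_integral \<alpha> 0 \<omega>"
proof -
  let ?Q = "completion (P x)"
  let ?f = "on_finite T (tail_integral 1)"
  have le: "?f \<omega> \<le> tail_integral 1 0 \<omega>" for \<omega>
    by (simp add: on_finite_def tail_integral_antimono)
  have meas: "?f \<in> borel_measurable ?Q" "tail_integral 1 0 \<in> borel_measurable ?Q"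
    by (rule on_finite_tail_measurable[OF T(1)], rule measurable_events_P[OF tail_integral_measurable])
  have exp_neg: "on_finite T (\<lambda>r _. ennreal (exp (- (1 * r)))) \<omega> = exp_neg (T \<omega>)" for \<omega>
    by (cases "T \<omega>") (simp_all add: on_finite_def exp_neg_ennreal)
  have "(\<integral>\<^sup>+ \<omega>. ?f \<omega> \<partial>P x) = (\<integral>\<^sup>+ \<omega>. exp_neg (T \<omega>) \<partial>P x)"
    unfolding strong_markov_tail[OF zero_less_one T(1,3)] exp_neg potential_1_at by simp
  also have "\<dots> = potential 1 x"
    unfolding potential_1 using T(2) by (intro nn_integral_cong_AE) (auto elim!: eventually_mono)
  finally have eq: "(\<integral>\<^sup>+ \<omega>. ?f \<omega> \<partial>?Q) = (\<integral>\<^sup>+ \<omega>. tail_integral 1 0 \<omega> \<partial>?Q)"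
    unfolding potential_eq_tail nn_integral_completion .
  have fin: "(\<integral>\<^sup>+ \<omega>. tail_integral 1 0 \<omega> \<partial>?Q) \<noteq> \<infinity>"
    using le_less_trans[OF potential_1_le_1 ennreal_one_less_top, of x]
    by (simp add: potential_eq_tail nn_integral_completion)
  have "AE \<omega> in ?Q. tail_integral 1 0 \<omega> \<le> ?f \<omega>"
  proof (rule ccontr)
    assume "\<not> ?thesis"
    from nn_integral_less[OF meas _ _ this] fin le eq show False by simp
  qed
  moreover have "AE \<omega> in ?Q. tail_integral 1 0 \<omega> \<noteq> \<infinity>"
    using nn_integral_PInf_AE[OF meas(2) fin] by simp
  ultimately have "AE \<omega> in ?Q. \<forall>\<alpha>. on_finite T (tail_integral \<alpha>) \<omega> = tail_integral \<alpha> 0 \<omega>"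
  proof eventually_elim
    case (elim \<omega>)
    interpret growth "\<lambda>t. A t \<omega>" by (rule growth_A)
    from elim(1) le[of \<omega>] have f_eq: "?f \<omega> = tail_integral 1 0 \<omega>" by (rule antisym[rotated])
    show ?case
    proof (intro allI, cases "T \<omega>")
      case (real r)
      define early where "early \<alpha> = growth_integral (\<lambda>t. A t \<omega>) (\<lambda>s. indicator {0<..r} s * ennreal (exp (- (\<alpha> * s))))" for \<alpha>
      have split: "tail_integral \<alpha> 0 \<omega> = early \<alpha> + tail_integral \<alpha> r \<omega>" for \<alpha>
      proof -
        have "tail_integral \<alpha> 0 \<omega> = growth_integral (\<lambda>t. A t \<omega>)
            (\<lambda>s. indicator {0<..r} s * ennreal (exp (- (\<alpha> * s))) + indicator {r<..} s * ennreal (exp (- (\<alpha> * s))))"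
          unfolding tail_integral_def additive_integral_def using real(1)
          by (intro growth_integral_cong) (auto simp: indicator_def)
        also have "\<dots> = early \<alpha> + tail_integral \<alpha> r \<omega>"
          unfolding tail_integral_def additive_integral_def early_def by (rule growth_integral_add) measurable
        finally show ?thesis .
      qed
      have "tail_integral 1 r \<omega> = early 1 + tail_integral 1 r \<omega>"
        using f_eq split[of 1] real by (simp add: on_finite_def)
      moreover have "tail_integral 1 r \<omega> \<noteq> \<infinity>"
        using elim(2) f_eq real by (simp add: on_finite_def)
      ultimately have "early 1 = 0"
        using ennreal_add_left_cancel[of "tail_integral 1 r \<omega>" 0 "early 1"] by (simp add: add.commute)
      then have "early \<alpha> = 0" for \<alpha>
        unfolding early_def
        by (rule growth_integral_eq_0_mono[rotated]) (auto simp: indicator_def ennreal_eq_0_iff not_le)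
      then show "on_finite T (tail_integral \<alpha>) \<omega> = tail_integral \<alpha> 0 \<omega>" for \<alpha>
        using split real by (simp add: on_finite_def)
    next
      case top
      then have "tail_integral 1 0 \<omega> = 0" using f_eq by (simp add: on_finite_def)
      then have "tail_integral \<alpha> 0 \<omega> = 0" for \<alpha>
        unfolding tail_integral_def additive_integral_def
        by (rule growth_integral_eq_0_mono[rotated]) (auto simp: indicator_def ennreal_eq_0_iff not_le)
      then show "on_finite T (tail_integral \<alpha>) \<omega> = tail_integral \<alpha> 0 \<omega>" for \<alpha>
        using top by (simp add: on_finite_def)
    qed
  qed
  then show ?thesis unfolding AE_completion_iff .
qed

lemma potential_eq_hitting:
  assumes \<alpha>: "0 < \<alpha>" and T: "optional_time T" "AE \<omega> in P x. T \<omega> = hitting_time a \<omega>"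
    "AE \<omega> in P x. \<forall>t\<ge>0. T \<omega> = ennreal t \<longrightarrow> \<omega> t = Some a"
  shows "potential \<alpha> x = potential \<alpha> a * (\<integral>\<^sup>+ \<omega>. on_finite T (\<lambda>r _. ennreal (exp (- (\<alpha> * r)))) \<omega> \<partial>P x)"
proof -
  have "potential \<alpha> x = (\<integral>\<^sup>+ \<omega>. on_finite T (tail_integral \<alpha>) \<omega> \<partial>P x)"
    unfolding potential_eq_tail using no_growth_before_hitting[OF T]
    by (intro nn_integral_cong_AE) (auto elim!: eventually_mono)
  then show ?thesis unfolding strong_markov_tail[OF \<alpha> T(1,3)] .
qed

lemma on_finite_1_eq_hit:
  assumes "AE \<omega> in P x. T \<omega> = hitting_time a \<omega>"
  shows "(\<integral>\<^sup>+ \<omega>. on_finite T (\<lambda>_ _. 1) \<omega> \<partial>P x) = hit_prob x"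
  unfolding hit_prob_def
proof (rule nn_integral_cong_AE)
  show "AE \<omega> in P x. on_finite T (\<lambda>_ _. 1) \<omega> = indicator hit \<omega>"
    using assms AE_space[of "P x"]
    by eventually_elim (simp add: on_finite_def hit_def indicator_def del: infinity_ennreal_def)
qed

lemma potential_le_hit_prob:
  assumes \<alpha>: "0 < \<alpha>"
  shows "potential \<alpha> x \<le> potential \<alpha> a * hit_prob x"
proof -
  obtain T where T: "optional_time T" "AE \<omega> in P x. T \<omega> = hitting_time a \<omega>"
    "AE \<omega> in P x. \<forall>t\<ge>0. T \<omega> = ennreal t \<longrightarrow> \<omega> t = Some a"
    by (rule hitting_time_optional)
  have "(\<integral>\<^sup>+ \<omega>. on_finite T (\<lambda>r _. ennreal (exp (- (\<alpha> * r)))) \<omega> \<partial>P x) \<le> (\<integral>\<^sup>+ \<omega>. on_finite T (\<lambda>_ _. 1) \<omega> \<partial>P x)"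
    using \<alpha> by (intro nn_integral_mono) (simp add: on_finite_def)
  then show ?thesis
    unfolding potential_eq_hitting[OF \<alpha> T] on_finite_1_eq_hit[OF T(2)] by (rule mult_left_mono) simp
qed

text \<open>Choose \<open>t\<close> such that a process started at \<open>a\<close> returns after \<open>t\<close> with probability at most
  \<open>1/2\<close>. The mean discounted local time is then at most the mean of the part before \<open>t\<close> plus half of
  itself, whatever the discount rate.\<close>

lemma potential_bound_uniform:
  "\<exists>B<\<infinity>. \<forall>\<alpha>>0. potential \<alpha> a \<le> B"
proof -
  let ?Q = "completion (P a)"
  interpret Q: prob_space "P a" by (rule prob_space_P)
  let ?K = "\<lambda>n::nat. {\<omega> \<in> paths. ennreal (real n) < last_exit a \<omega>}"
  have K: "?K n \<in> sets ?Q" for n by (rule last_exit_gt_measurable) simp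
  have "emeasure ?Q (?K n) \<le> emeasure ?Q (space ?Q)" for n
    using K sets.top[of ?Q] by (intro emeasure_mono) auto
  also have "emeasure ?Q (space ?Q) = 1"
    using sets.top[of "P a"] by (simp add: emeasure_completion main_part)
  finally have "emeasure ?Q (?K n) \<noteq> \<infinity>" for n
    by (metis ennreal_one_less_top infinity_ennreal_def leD)
  moreover have "decseq ?K"
    unfolding decseq_def by (auto intro: le_less_trans[rotated] ennreal_leI)
  ultimately have lim: "(\<lambda>n. emeasure ?Q (?K n)) \<longlonglongrightarrow> emeasure ?Q (\<Inter>n. ?K n)"
    using K by (intro Lim_emeasure_decseq) auto
  have "AE \<omega> in ?Q. \<omega> \<notin> (\<Inter>n. ?K n)"
    unfolding AE_completion_iff using transient
  proof eventually_elim
    case (elim \<omega>)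
    then obtain k where k: "last_exit a \<omega> = ennreal k" "0 \<le> k" by (cases "last_exit a \<omega>") auto
    obtain n :: nat where "k \<le> real n" using real_arch_simple by blast
    then have "\<not> ennreal (real n) < last_exit a \<omega>" using k by (simp add: not_less ennreal_leI)
    then show ?case by blast
  qed
  then have "emeasure ?Q (\<Inter>n. ?K n) = 0"
    using AE_iff_null_sets[of "\<Inter>n. ?K n" ?Q] K by (auto simp: null_sets_def)
  then have lim_0: "(\<lambda>n. emeasure ?Q (?K n)) \<longlonglongrightarrow> 0" using lim by (simp only:)
  have "(0 :: real) < 1 / 2" by simp
  then have "0 < ennreal (1 / 2)" by (simp only: ennreal_less_zero_iff)
  from order_tendstoD(2)[OF lim_0 this]
  have "\<forall>\<^sub>F n in sequentially. emeasure ?Q (?K n) < ennreal (1 / 2)" .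
  then obtain n where n: "emeasure ?Q (?K n) < ennreal (1 / 2)"
    by (auto simp: eventually_sequentially)
  define t where "t = real n"
  have t: "0 \<le> t" by (simp add: t_def)
  define q where "q = (\<integral>\<^sup>+ \<omega>. ext0 hit_prob (\<omega> t) \<partial>P a)"
  have "q = (\<integral>\<^sup>+ \<omega>. indicator {\<omega>. ennreal t < last_exit a \<omega>} \<omega> \<partial>P a)"
    unfolding q_def using last_exit_tail[OF t borel_measurable_const[of 1], of a] by simp
  also have "\<dots> = (\<integral>\<^sup>+ \<omega>. indicator (?K n) \<omega> \<partial>?Q)"
    unfolding nn_integral_completion by (intro nn_integral_cong) (simp add: indicator_def t_def)
  also have "\<dots> = emeasure ?Q (?K n)" using K by simp
  finally have q: "q \<le> ennreal (1 / 2)" using n by simp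
  have hit_univ: "universally_measurable hit_prob"
    unfolding hit_prob_def[abs_def] by (intro expectation_universally_measurable borel_measurable_indicator hit_events)
  have "potential \<alpha> a \<le> ennreal (2 * exp t)" if \<alpha>: "0 < \<alpha>" for \<alpha>
  proof -
    obtain C where C: "C < \<infinity>" "\<And>y. potential \<alpha> y \<le> C"
      using potential_bounded[OF \<alpha> potential_1_le_1] by blast
    then have "potential \<alpha> a < \<infinity>" using le_less_trans by blast
    then obtain p where p: "potential \<alpha> a = ennreal p" "0 \<le> p" by (cases "potential \<alpha> a") auto
    have "tail_integral \<alpha> 0 \<omega> \<le> ennreal (exp t) * tail_integral 1 0 \<omega> + tail_integral \<alpha> t \<omega>" for \<omega>
    proof -
      interpret growth "\<lambda>t. A t \<omega>" by (rule growth_A)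
      have "tail_integral \<alpha> 0 \<omega> \<le> growth_integral (\<lambda>t. A t \<omega>)
          (\<lambda>r. ennreal (exp t) * (indicator {0<..} r * ennreal (exp (- (1 * r)))) +
            indicator {t<..} r * ennreal (exp (- (\<alpha> * r))))"
        unfolding tail_integral_def additive_integral_def
      proof (rule growth_integral_mono)
        fix r :: real assume r: "0 < r"
        have "exp (- (\<alpha> * r)) \<le> exp t * exp (- r)" if "\<not> t < r"
        proof -
          have "- (\<alpha> * r) \<le> t + - r" using that r \<alpha> mult_pos_pos[OF \<alpha> r] by linarith
          then have "exp (- (\<alpha> * r)) \<le> exp (t + - r)" by simp
          then show ?thesis by (simp only: exp_add)
        qed
        then show "indicator {0<..} r * ennreal (exp (- (\<alpha> * r))) \<le>
          ennreal (exp t) * (indicator {0<..} r * ennreal (exp (- (1 * r)))) +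
            indicator {t<..} r * ennreal (exp (- (\<alpha> * r)))"
          using r by (cases "t < r") (simp_all add: ennreal_mult[symmetric] ennreal_leI)
      qed
      also have "\<dots> = ennreal (exp t) * tail_integral 1 0 \<omega> + tail_integral \<alpha> t \<omega>"
        unfolding tail_integral_def additive_integral_def
        by (subst growth_integral_add, measurable) (subst growth_integral_cmult, measurable)
      finally show ?thesis .
    qed
    then have "potential \<alpha> a \<le> (\<integral>\<^sup>+ \<omega>. ennreal (exp t) * tail_integral 1 0 \<omega> + tail_integral \<alpha> t \<omega> \<partial>?Q)"
      unfolding potential_eq_tail nn_integral_completion by (intro nn_integral_mono)
    also have "\<dots> = ennreal (exp t) * (\<integral>\<^sup>+ \<omega>. tail_integral 1 0 \<omega> \<partial>?Q) + (\<integral>\<^sup>+ \<omega>. tail_integral \<alpha> t \<omega> \<partial>?Q)"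
      using measurable_events_P[OF tail_integral_measurable]
      by (subst nn_integral_add) (auto simp: nn_integral_cmult)
    also have "\<dots> = ennreal (exp t) * potential 1 a + (\<integral>\<^sup>+ \<omega>. tail_integral \<alpha> t \<omega> \<partial>P a)"
      unfolding nn_integral_completion potential_eq_tail ..
    also have "\<dots> \<le> ennreal (exp t) * 1 + potential \<alpha> a * q"
    proof (intro add_mono mult_left_mono potential_1_le_1)
      have "(\<integral>\<^sup>+ \<omega>. tail_integral \<alpha> t \<omega> \<partial>P a) = ennreal (exp (- (\<alpha> * t))) * (\<integral>\<^sup>+ \<omega>. ext0 (potential \<alpha>) (\<omega> t) \<partial>P a)"
        using expectation_tail_integral[OF t, where \<alpha>=\<alpha> and x=a] by (simp only: semigroup_eq)
      also have "\<dots> \<le> 1 * (\<integral>\<^sup>+ \<omega>. ext0 (potential \<alpha>) (\<omega> t) \<partial>P a)"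
        using \<alpha> t by (intro mult_right_mono) auto
      also have "\<dots> \<le> (\<integral>\<^sup>+ \<omega>. potential \<alpha> a * ext0 hit_prob (\<omega> t) \<partial>?Q)"
        unfolding mult_1 nn_integral_completion using potential_le_hit_prob[OF \<alpha>]
        by (intro nn_integral_mono) (simp add: ext0_def split: option.splits)
      also have "\<dots> = potential \<alpha> a * q"
        unfolding q_def using universally_measurable_at[OF t hit_univ, of a]
        by (subst nn_integral_cmult) (simp_all add: nn_integral_completion)
      finally show "(\<integral>\<^sup>+ \<omega>. tail_integral \<alpha> t \<omega> \<partial>P a) \<le> potential \<alpha> a * q" .
    qed simp
    also have "\<dots> \<le> ennreal (exp t) + ennreal p * ennreal (1 / 2)"
      unfolding p(1) using q by (simp add: mult_left_mono)
    also have "\<dots> = ennreal (exp t) + ennreal (p * (1 / 2))"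
      by (subst ennreal_mult) (use p(2) in auto)
    also have "\<dots> = ennreal (exp t + p * (1 / 2))"
      by (rule ennreal_plus[symmetric]) (use p(2) in auto)
    finally have "ennreal p \<le> ennreal (exp t + p * (1 / 2))" unfolding p(1) .
    then have "p \<le> exp t + p * (1 / 2)" using p(2) by (subst (asm) ennreal_le_iff) auto
    then show ?thesis unfolding p(1) by (intro ennreal_leI) linarith
  qed
  then show ?thesis by (intro exI[of _ "ennreal (2 * exp t)"]) auto
qed

text \<open>Let the discount rate tend to \<open>0\<close> in the representation of the potentials by the hitting time. The
  constant \<open>c\<close> is the mean total local time from \<open>a\<close>; it is at least \<open>potential 1 a = 1\<close>.\<close>

theorem potential_0_eq:
  obtains c where "1 \<le> c" "c < \<infinity>" "\<And>x. potential 0 x = c * hit_prob x"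
proof -
  define \<alpha> where "\<alpha> n = inverse (real (Suc n))" for n
  have \<alpha>: "0 < \<alpha> n" "\<alpha> \<longlonglongrightarrow> 0" for n
    unfolding \<alpha>_def[abs_def] using LIMSEQ_inverse_real_of_nat by auto
  have \<alpha>_anti: "\<alpha> n \<le> \<alpha> m" if "m \<le> n" for m n
    using that by (simp add: \<alpha>_def)
  have exp_mono: "ennreal (exp (- (\<alpha> m * r))) \<le> ennreal (exp (- (\<alpha> n * r)))" if "m \<le> n" "0 \<le> r" for m n r
    using that \<alpha>_anti by (intro ennreal_leI) (simp add: mult_right_mono)
  have exp_lim: "(\<lambda>n. ennreal (exp (- (\<alpha> n * r)))) \<longlonglongrightarrow> 1" for r
  proof -
    have "(\<lambda>n. ennreal (exp (- (\<alpha> n * r)))) \<longlonglongrightarrow> ennreal (exp (- (0 * r)))"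
      by (intro tendsto_intros \<alpha>)
    then show ?thesis by simp
  qed
  have pot_lim: "(\<lambda>n. potential (\<alpha> n) x) \<longlonglongrightarrow> potential 0 x" for x
    unfolding potential_eq_tail nn_integral_completion[of "P x", symmetric]
  proof (rule nn_integral_LIMSEQ)
    have mono: "indicator {0<..} r * ennreal (exp (- (\<alpha> m * r))) \<le> indicator {0<..} r * ennreal (exp (- (\<alpha> n * r)))"
      if "m \<le> n" for m n r
      using exp_mono[OF that, of r] by (simp add: indicator_def)
    show "incseq (\<lambda>n. tail_integral (\<alpha> n) 0)"
      unfolding incseq_def le_fun_def tail_integral_def additive_integral_def
      using mono by (auto intro!: growth.growth_integral_mono[OF growth_A])
    show "tail_integral (\<alpha> n) 0 \<in> borel_measurable (completion (P x))" for n
      by (rule measurable_events_P[OF tail_integral_measurable])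
    show "(\<lambda>n. tail_integral (\<alpha> n) 0 \<omega>) \<longlonglongrightarrow> tail_integral 0 0 \<omega>" for \<omega>
      unfolding tail_integral_def additive_integral_def
    proof (rule growth.growth_integral_incseq[OF growth_A])
      show "(\<lambda>n. indicator {0<..} r * ennreal (exp (- (\<alpha> n * r)))) \<longlonglongrightarrow>
          indicator {0<..} r * ennreal (exp (- (0 * r)))" if "0 < r" for r
        using exp_lim[of r] that by simp
    qed (use mono in \<open>auto\<close>)
  qed
  have pot_eq: "potential 0 x = potential 0 a * hit_prob x" if fin: "potential 0 a < \<infinity>" for x
  proof -
    obtain T where T: "optional_time T" "AE \<omega> in P x. T \<omega> = hitting_time a \<omega>"
      "AE \<omega> in P x. \<forall>t\<ge>0. T \<omega> = ennreal t \<longrightarrow> \<omega> t = Some a"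
      by (rule hitting_time_optional)
    let ?h = "\<lambda>n. on_finite T (\<lambda>r _. ennreal (exp (- (\<alpha> n * r))))"
    have "(\<lambda>n. \<integral>\<^sup>+ \<omega>. ?h n \<omega> \<partial>completion (P x)) \<longlonglongrightarrow> (\<integral>\<^sup>+ \<omega>. on_finite T (\<lambda>_ _. 1) \<omega> \<partial>completion (P x))"
    proof (rule nn_integral_LIMSEQ)
      show "incseq ?h"
        using exp_mono by (auto simp: incseq_def le_fun_def on_finite_def)
      note [measurable] = optional_time_measurable_P[OF T(1), of x]
      show "?h n \<in> borel_measurable (completion (P x))" for n
        unfolding on_finite_def[abs_def] by measurable
      show "(\<lambda>n. ?h n \<omega>) \<longlonglongrightarrow> on_finite T (\<lambda>_ _. 1) \<omega>" for \<omega>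
        using exp_lim by (simp add: on_finite_def)
    qed
    then have h_lim: "(\<lambda>n. \<integral>\<^sup>+ \<omega>. ?h n \<omega> \<partial>P x) \<longlonglongrightarrow> hit_prob x"
      unfolding nn_integral_completion on_finite_1_eq_hit[OF T(2)] .
    have "(\<lambda>n. potential (\<alpha> n) a * (\<integral>\<^sup>+ \<omega>. ?h n \<omega> \<partial>P x)) \<longlonglongrightarrow> potential 0 a * hit_prob x"
      using fin le_less_trans[OF hit_prob_le_1 ennreal_one_less_top, of x]
      by (intro tendsto_mult_ennreal pot_lim h_lim) auto
    then have "(\<lambda>n. potential (\<alpha> n) x) \<longlonglongrightarrow> potential 0 a * hit_prob x"
      unfolding potential_eq_hitting[OF \<alpha>(1) T, symmetric] .
    with pot_lim show ?thesis by (rule LIMSEQ_unique)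
  qed
  obtain B where B: "B < \<infinity>" "\<And>\<alpha>. 0 < \<alpha> \<Longrightarrow> potential \<alpha> a \<le> B" using potential_bound_uniform by blast
  have "potential 0 a \<le> B" using B(2) \<alpha>(1) by (intro LIMSEQ_le_const2[OF pot_lim]) auto
  then have fin: "potential 0 a < \<infinity>" using B(1) by (rule le_less_trans)
  have "potential 1 a \<le> potential 0 a"
    unfolding potential_eq_tail tail_integral_def additive_integral_def
    by (intro nn_integral_mono growth.growth_integral_mono[OF growth_A]) (auto simp: indicator_def)
  then have "1 \<le> potential 0 a" by (simp only: potential_1_at)
  with fin pot_eq show thesis using that by blast
qed

end


section \<open>The Campbell measure\<close>

context local_time_process
begin

text \<open>The change of time that makes \<open>dA\<close> an image of Lebesgue measure makes the Campbell measure an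
  image of a measure with a density with respect to a product measure.\<close>

definition campbell_law :: "'a \<Rightarrow> ('a path \<times> real) measure" where
  "campbell_law x = distr
     (density (distr (completion (P x)) (events P) (\<lambda>\<omega>. \<omega>) \<Otimes>\<^sub>M lborel)
       (\<lambda>(\<omega>, s). (if reached (\<lambda>t. A t \<omega>) s then inverse (potential 0 x) else 0)))
     (events P \<Otimes>\<^sub>M restrict_space borel {0..})
     (\<lambda>z. (fst z, level_time (\<lambda>t. A t (fst z)) (snd z)))"

lemma sets_campbell_law[simp]:
  "sets (campbell_law x) = sets (events P \<Otimes>\<^sub>M restrict_space borel {0..})"
  by (simp add: campbell_law_def)

lemma space_campbell_law[simp]: "space (campbell_law x) = paths \<times> {0..}"
  by (simp add: campbell_law_def space_pair_measure space_restrict_space)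

lemma level_time_nonneg: "0 \<le> level_time (\<lambda>t. A t \<omega>) s"
  using growth.level_time_attained(1)[OF growth_A, of \<omega> s]
  by (cases "reached (\<lambda>t. A t \<omega>) s") (auto simp: level_time_def)

lemma nn_integral_campbell_law:
  assumes h: "h \<in> borel_measurable (events P \<Otimes>\<^sub>M restrict_space borel {0..})"
  shows "(\<integral>\<^sup>+ z. h z \<partial>campbell_law x) =
    (\<integral>\<^sup>+ \<omega>. growth_integral (\<lambda>t. A t \<omega>) (\<lambda>r. h (\<omega>, r)) \<partial>P x) * inverse (potential 0 x)"
proof -
  let ?Q = "distr (completion (P x)) (events P) (\<lambda>\<omega>. \<omega>)"
  let ?N = "?Q \<Otimes>\<^sub>M (lborel :: real measure)"
  let ?d = "\<lambda>(\<omega>, s). (if reached (\<lambda>t. A t \<omega>) s then inverse (potential 0 x) else 0)"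
  let ?\<phi> = "\<lambda>z. (fst z, level_time (\<lambda>t. A t (fst z)) (snd z))"
  have id: "(\<lambda>\<omega>. \<omega>) \<in> completion (P x) \<rightarrow>\<^sub>M events P"
    by (rule measurable_events_P) simp
  have sets_Q: "sets ?Q = sets (events P)" by simp
  have sets_N: "sets ?N = sets (events P \<Otimes>\<^sub>M borel)" by (intro sets_pair_measure_cong) auto
  note joint = level_time_jointly_measurable[of "events P" A, OF growth_A A_measurable]
  have d: "?d \<in> borel_measurable ?N"
  proof -
    have "(\<lambda>z. if (case z of (\<omega>, s) \<Rightarrow> reached (\<lambda>t. A t \<omega>) s) then inverse (potential 0 x) else 0)
        \<in> borel_measurable (events P \<Otimes>\<^sub>M borel)"
      using joint(1) by measurable
    then show ?thesis unfolding measurable_cong_sets[OF sets_N refl] by (simp only: case_prod_beta')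
  qed
  have \<phi>: "?\<phi> \<in> ?N \<rightarrow>\<^sub>M events P \<Otimes>\<^sub>M restrict_space borel {0..}"
  proof -
    have "(\<lambda>z. (fst z, case z of (\<omega>, s) \<Rightarrow> level_time (\<lambda>t. A t \<omega>) s)) \<in>
        events P \<Otimes>\<^sub>M borel \<rightarrow>\<^sub>M events P \<Otimes>\<^sub>M restrict_space borel {0..}"
      by (intro measurable_Pair measurable_fst measurable_restrict_space2 joint(2))
        (auto simp: level_time_nonneg)
    then show ?thesis unfolding measurable_cong_sets[OF sets_N refl] by (simp only: case_prod_beta')
  qed
  have h\<phi>: "(\<lambda>z. h (?\<phi> z)) \<in> borel_measurable ?N"
    by (rule measurable_compose[OF \<phi> h])
  have gi: "(\<lambda>\<omega>. growth_integral (\<lambda>t. A t \<omega>) (\<lambda>r. h (\<omega>, r))) \<in> borel_measurable (events P)"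
  proof -
    have "(\<lambda>z. if (case z of (\<omega>, s) \<Rightarrow> reached (\<lambda>t. A t \<omega>) s) then h (?\<phi> z) else 0) \<in> borel_measurable ?N"
    proof (rule measurable_If[OF h\<phi> borel_measurable_const])
      show "{z \<in> space ?N. case z of (\<omega>, s) \<Rightarrow> reached (\<lambda>t. A t \<omega>) s} \<in> sets ?N"
        using joint(1) unfolding pred_def sets_N sets_eq_imp_space_eq[OF sets_N] .
    qed
    then have "(\<lambda>\<omega>. growth_integral (\<lambda>t. A t \<omega>) (\<lambda>r. h (\<omega>, r))) \<in> borel_measurable ?Q"
      unfolding growth_integral_def by (intro lborel.borel_measurable_nn_integral) (simp add: case_prod_beta')
    then show ?thesis by simp
  qed
  have "(\<integral>\<^sup>+ z. h z \<partial>campbell_law x) = (\<integral>\<^sup>+ z. h (?\<phi> z) \<partial>density ?N ?d)"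
    unfolding campbell_law_def using \<phi> h by (intro nn_integral_distr) simp_all
  also have "\<dots> = (\<integral>\<^sup>+ z. ?d z * h (?\<phi> z) \<partial>?N)"
    by (rule nn_integral_density[OF d h\<phi>])
  also have "\<dots> = (\<integral>\<^sup>+ \<omega>. \<integral>\<^sup>+ s. ?d (\<omega>, s) * h (?\<phi> (\<omega>, s)) \<partial>lborel \<partial>?Q)"
    by (rule lborel.nn_integral_fst[symmetric]) (rule borel_measurable_times_ennreal[OF d h\<phi>])
  also have "\<dots> = (\<integral>\<^sup>+ \<omega>. growth_integral (\<lambda>t. A t \<omega>) (\<lambda>r. h (\<omega>, r)) * inverse (potential 0 x) \<partial>?Q)"
  proof (intro nn_integral_cong)
    fix \<omega> assume "\<omega> \<in> space ?Q"
    then have \<omega>: "\<omega> \<in> space ?Q" .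
    have meas: "(\<lambda>s. if reached (\<lambda>t. A t \<omega>) s then h (\<omega>, level_time (\<lambda>t. A t \<omega>) s) else 0) \<in> borel_measurable lborel"
    proof (rule measurable_If)
      show "(\<lambda>s. h (\<omega>, level_time (\<lambda>t. A t \<omega>) s)) \<in> borel_measurable lborel"
        using measurable_compose[OF measurable_Pair1'[OF \<omega>, of lborel] h\<phi>] by simp
      show "{s \<in> space lborel. reached (\<lambda>t. A t \<omega>) s} \<in> sets lborel"
        using growth.reached_measurable[OF growth_A, of \<omega>] by (simp add: pred_def)
    qed simp
    have "(\<integral>\<^sup>+ s. ?d (\<omega>, s) * h (?\<phi> (\<omega>, s)) \<partial>lborel) =
        (\<integral>\<^sup>+ s. (if reached (\<lambda>t. A t \<omega>) s then h (\<omega>, level_time (\<lambda>t. A t \<omega>) s) else 0) * inverse (potential 0 x) \<partial>lborel)"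
      by (intro nn_integral_cong) (simp add: mult.commute)
    also have "\<dots> = growth_integral (\<lambda>t. A t \<omega>) (\<lambda>r. h (\<omega>, r)) * inverse (potential 0 x)"
      unfolding growth_integral_def by (rule nn_integral_multc[OF meas])
    finally show "(\<integral>\<^sup>+ s. ?d (\<omega>, s) * h (?\<phi> (\<omega>, s)) \<partial>lborel) =
        growth_integral (\<lambda>t. A t \<omega>) (\<lambda>r. h (\<omega>, r)) * inverse (potential 0 x)" .
  qed
  also have "\<dots> = (\<integral>\<^sup>+ \<omega>. growth_integral (\<lambda>t. A t \<omega>) (\<lambda>r. h (\<omega>, r)) \<partial>?Q) * inverse (potential 0 x)"
    using gi by (intro nn_integral_multc) simp
  also have "(\<integral>\<^sup>+ \<omega>. growth_integral (\<lambda>t. A t \<omega>) (\<lambda>r. h (\<omega>, r)) \<partial>?Q) =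
      (\<integral>\<^sup>+ \<omega>. growth_integral (\<lambda>t. A t \<omega>) (\<lambda>r. h (\<omega>, r)) \<partial>completion (P x))"
    using gi by (intro nn_integral_distr id) simp
  finally show ?thesis by (simp only: nn_integral_completion)
qed

lemma emeasure_campbell_law_rectangle:
  assumes E: "E \<in> sets (events P)" and B: "B \<in> sets (restrict_space borel {0..})"
  shows "emeasure (campbell_law x) (E \<times> B) =
    (\<integral>\<^sup>+ \<omega>. indicator E \<omega> * additive_integral (indicator B) \<omega> \<partial>P x) * inverse (potential 0 x)"
proof -
  have EB: "E \<times> B \<in> sets (events P \<Otimes>\<^sub>M restrict_space borel {0..})" using E B by simp
  have gi: "growth_integral (\<lambda>t. A t \<omega>) (\<lambda>r. indicator (E \<times> B) (\<omega>, r)) = indicator E \<omega> * additive_integral (indicator B) \<omega>" for \<omega>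
    by (cases "\<omega> \<in> E") (simp_all add: additive_integral_def indicator_times growth_integral_def cong: if_cong)
  have "emeasure (campbell_law x) (E \<times> B) = (\<integral>\<^sup>+ z. indicator (E \<times> B) z \<partial>campbell_law x)"
    using EB by simp
  also have "\<dots> = (\<integral>\<^sup>+ \<omega>. growth_integral (\<lambda>t. A t \<omega>) (\<lambda>r. indicator (E \<times> B) (\<omega>, r)) \<partial>P x) * inverse (potential 0 x)"
    using EB by (intro nn_integral_campbell_law) simp
  finally show ?thesis unfolding gi .
qed

text \<open>A probability measure on the product is determined by its values on rectangles, so the
  description of the Campbell measure has exactly one solution.\<close>

lemma campbell_measure_eq:
  assumes M: "AE \<omega> in P x. \<forall>B\<in>sets (restrict_space borel {0..}). emeasure (M \<omega>) B = additive_integral (indicator B) \<omega>"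
    and v: "potential 0 x \<noteq> 0" "potential 0 x \<noteq> \<infinity>"
  shows "campbell_measure (events P) (law P (Some x)) M = campbell_law x"
    and "prob_space (campbell_law x)"
proof -
  let ?I = "restrict_space borel {0..} :: real measure"
  have whole: "{0..} \<in> sets ?I" using sets.top[of ?I] by (simp add: space_restrict_space)
  have total: "additive_integral (indicator {0..}) \<omega> = tail_integral 0 0 \<omega>" for \<omega>
    unfolding tail_integral_def additive_integral_def
    by (intro growth.growth_integral_cong[OF growth_A]) simp
  have mass: "(\<integral>\<^sup>+ \<omega>. emeasure (M \<omega>) {0..} \<partial>P x) = potential 0 x"
    unfolding potential_eq_tail total[symmetric] using M whole
    by (intro nn_integral_cong_AE) (auto elim!: eventually_mono)
  have rect: "emeasure (campbell_law x) (E \<times> B) =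
      (\<integral>\<^sup>+ \<omega>. indicator E \<omega> * emeasure (M \<omega>) B \<partial>law P (Some x)) / (\<integral>\<^sup>+ \<omega>. emeasure (M \<omega>) {0..} \<partial>law P (Some x))"
    if "E \<in> sets (events P)" "B \<in> sets ?I" for E B
  proof -
    have "(\<integral>\<^sup>+ \<omega>. indicator E \<omega> * emeasure (M \<omega>) B \<partial>P x) = (\<integral>\<^sup>+ \<omega>. indicator E \<omega> * additive_integral (indicator B) \<omega> \<partial>P x)"
      using M that by (intro nn_integral_cong_AE) (auto elim!: eventually_mono)
    then show ?thesis
      unfolding emeasure_campbell_law_rectangle[OF that] law_Some nn_integral_completion mass divide_ennreal_def by simp
  qed
  have "emeasure (campbell_law x) (space (campbell_law x)) = potential 0 x * inverse (potential 0 x)"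
  proof -
    have "(\<integral>\<^sup>+ \<omega>. indicator paths \<omega> * tail_integral 0 0 \<omega> \<partial>P x) = potential 0 x"
      unfolding potential_eq_tail by (intro nn_integral_cong) simp
    then show ?thesis
      using emeasure_campbell_law_rectangle[OF sets.top whole, of x] by (simp add: total)
  qed
  also have "\<dots> = 1" using v ennreal_divide_self[of "potential 0 x"] by (simp add: divide_ennreal_def less_top[symmetric])
  finally show prob: "prob_space (campbell_law x)" by (rule prob_spaceI)
  show "campbell_measure (events P) (law P (Some x)) M = campbell_law x"
    unfolding campbell_measure_def
  proof (rule the_equality)
    show "prob_space (campbell_law x) \<and> sets (campbell_law x) = sets (events P \<Otimes>\<^sub>M ?I) \<and>
      (\<forall>E\<in>sets (events P). \<forall>B\<in>sets ?I. emeasure (campbell_law x) (E \<times> B) =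
        (\<integral>\<^sup>+ \<omega>. indicator E \<omega> * emeasure (M \<omega>) B \<partial>law P (Some x)) / (\<integral>\<^sup>+ \<omega>. emeasure (M \<omega>) {0..} \<partial>law P (Some x)))"
      using prob rect by simp
  next
    fix R assume R: "prob_space R \<and> sets R = sets (events P \<Otimes>\<^sub>M ?I) \<and>
      (\<forall>E\<in>sets (events P). \<forall>B\<in>sets ?I. emeasure R (E \<times> B) =
        (\<integral>\<^sup>+ \<omega>. indicator E \<omega> * emeasure (M \<omega>) B \<partial>law P (Some x)) / (\<integral>\<^sup>+ \<omega>. emeasure (M \<omega>) {0..} \<partial>law P (Some x)))"
    let ?E = "{E \<times> B | E B. E \<in> sets (events P) \<and> B \<in> sets ?I}"
    show "R = campbell_law x"
    proof (rule measure_eqI_generator_eq[where E="?E" and \<Omega>="paths \<times> {0..}" and A="\<lambda>_ :: nat. paths \<times> {0..}"])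
      show "Int_stable ?E" by (rule Int_stable_pair_measure_generator)
      show "?E \<subseteq> Pow (paths \<times> {0..})"
        using pair_measure_closed[of "events P" ?I] by (simp add: space_restrict_space)
      show "emeasure R X = emeasure (campbell_law x) X" if X_rect: "X \<in> ?E" for X
      proof -
        obtain E B where "X = E \<times> B" "E \<in> sets (events P)" "B \<in> sets ?I" using X_rect by blast
        then show ?thesis using R rect by simp
      qed
      show "sets R = sigma_sets (paths \<times> {0..}) ?E"
        using R by (simp add: sets_pair_measure space_restrict_space)
      show "sets (campbell_law x) = sigma_sets (paths \<times> {0..}) ?E"
        by (simp add: sets_pair_measure space_restrict_space)
      show "range (\<lambda>_. paths \<times> {0..}) \<subseteq> ?E"
        using sets.top[of "events P"] whole by auto
      have "finite_measure R" using R by (simp add: prob_space.finite_measure)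
      then show "emeasure R (paths \<times> {0..}) \<noteq> \<infinity>" by (simp add: finite_measure.emeasure_finite)
    qed simp
  qed
qed

text \<open>The mass after time \<open>t\<close> is the total mass of the future after \<open>t\<close>. Its conditional mean is
  proportional to the hitting probability from \<open>X\<^sub>t\<close>, and the factor of proportionality cancels
  against the normalisation.\<close>

theorem campbell_law_tail:
  assumes t: "0 \<le> t" and Z: "Z \<in> borel_measurable (completed_filtration P t)" and pos: "hit_prob x > 0"
  shows "(\<integral>\<^sup>+ (\<omega>, \<xi>). Z \<omega> * indicator {t<..} \<xi> \<partial>campbell_law x) =
    1 / hit_prob x * (\<integral>\<^sup>+ \<omega>. Z \<omega> * ext0 hit_prob (\<omega> t) \<partial>P x)"
proof -
  obtain c where c: "1 \<le> c" "c < \<infinity>" "\<And>x. potential 0 x = c * hit_prob x" using potential_0_eq by blast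
  have ZE: "Z \<in> borel_measurable (events P)" by (rule measurable_completed_filtration_events[OF Z])
  have ind: "(\<lambda>\<xi>. indicator {t<..} \<xi> :: ennreal) \<in> borel_measurable (restrict_space borel {0..})"
    by (intro measurable_restrict_space1) simp
  have "(\<lambda>z. Z (fst z) * indicator {t<..} (snd z)) \<in> borel_measurable (events P \<Otimes>\<^sub>M restrict_space borel {0..})"
    by (intro borel_measurable_times_ennreal measurable_compose[OF measurable_fst ZE] measurable_compose[OF measurable_snd ind])
  note int = nn_integral_campbell_law[OF this, of x]
  have gi: "growth_integral (\<lambda>t. A t \<omega>) (\<lambda>r. Z \<omega> * indicator {t<..} r) = Z \<omega> * tail_integral 0 t \<omega>" for \<omega>
    unfolding tail_integral_def additive_integral_def
    by (subst growth.growth_integral_cmult[OF growth_A]) simp_all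
  have "(\<integral>\<^sup>+ (\<omega>, \<xi>). Z \<omega> * indicator {t<..} \<xi> \<partial>campbell_law x) =
      (\<integral>\<^sup>+ \<omega>. Z \<omega> * tail_integral 0 t \<omega> \<partial>P x) * inverse (potential 0 x)"
    using int by (simp add: case_prod_beta' gi)
  also have "(\<integral>\<^sup>+ \<omega>. Z \<omega> * tail_integral 0 t \<omega> \<partial>P x) = (\<integral>\<^sup>+ \<omega>. Z \<omega> * ext0 (potential 0) (\<omega> t) \<partial>P x)"
    using markov_tail_integral[OF t Z, where \<alpha>=0 and x=x] by simp
  also have "\<dots> = (\<integral>\<^sup>+ \<omega>. c * (Z \<omega> * ext0 hit_prob (\<omega> t)) \<partial>completion (P x))"
    unfolding nn_integral_completion
    by (intro nn_integral_cong) (simp add: ext0_def c(3) mult.left_commute split: option.splits)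
  also have "\<dots> = c * (\<integral>\<^sup>+ \<omega>. Z \<omega> * ext0 hit_prob (\<omega> t) \<partial>P x)"
  proof (subst nn_integral_cmult)
    have "universally_measurable hit_prob"
      unfolding hit_prob_def[abs_def] by (intro expectation_universally_measurable borel_measurable_indicator hit_events)
    from universally_measurable_at[OF t this]
    show "(\<lambda>\<omega>. Z \<omega> * ext0 hit_prob (\<omega> t)) \<in> borel_measurable (completion (P x))"
      by (intro borel_measurable_times_ennreal measurable_events_P[OF ZE])
  qed (simp only: nn_integral_completion)
  also have "\<dots> * inverse (potential 0 x) = (c * inverse c) * (inverse (hit_prob x) * (\<integral>\<^sup>+ \<omega>. Z \<omega> * ext0 hit_prob (\<omega> t) \<partial>P x))"
    unfolding c(3) using c(1,2) le_less_trans[OF hit_prob_le_1 ennreal_one_less_top, of x]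
    by (subst ennreal_inverse_mult) (auto simp: mult_ac)
  also have "c * inverse c = 1"
  proof -
    have "c \<noteq> 0" using c(1) by auto
    then show ?thesis using c(2) ennreal_divide_self[of c] by (simp add: divide_ennreal_def)
  qed
  finally show ?thesis by (simp add: divide_ennreal_def)
qed

end


section \<open>The path killed at a random time\<close>

text \<open>The law of the path killed at a random time \<open>r\<close> only depends on the probabilities of the
  events that \<open>r\<close> exceeds \<open>t\<close> and that the path up to time \<open>t\<close> has a given property. These events
  are stable under intersection and generate the following field.\<close>

definition observed_events :: "(ennreal \<times> 'a::topological_space path) measure" where
  "observed_events = sigma (UNIV \<times> paths)
     (insert (UNIV \<times> paths) {{ennreal t<..} \<times> E | t E. 0 \<le> t \<and> E \<in> sets (raw_filtration t)})"

lemma observed_generator_closed: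
  "insert (UNIV \<times> paths) {{ennreal t<..} \<times> E | t E. 0 \<le> t \<and> E \<in> sets (raw_filtration t)}
    \<subseteq> Pow (UNIV \<times> (paths :: 'a::topological_space path set))"
proof -
  have "E \<subseteq> paths" if "E \<in> sets (raw_filtration t)" for t and E :: "'a path set"
    using sets.sets_into_space[OF that] by simp
  then show ?thesis by blast
qed

lemma space_observed_events[simp]: "space observed_events = UNIV \<times> paths"
  unfolding observed_events_def by (rule space_measure_of[OF observed_generator_closed])

lemma sets_observed_events: "sets observed_events = sigma_sets (UNIV \<times> paths)
    (insert (UNIV \<times> paths) {{ennreal t<..} \<times> E | t E. 0 \<le> t \<and> E \<in> sets (raw_filtration t)})"
  unfolding observed_events_def by (rule sets_measure_of[OF observed_generator_closed])

lemma observed_event: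
  fixes E :: "'a::topological_space path set"
  assumes "0 \<le> t" "E \<in> sets (raw_filtration t)"
  shows "{ennreal t<..} \<times> E \<in> sets observed_events"
  unfolding sets_observed_events using assms by (intro sigma_sets.Basic) blast

lemma measurable_observed_eventsI:
  fixes f :: "'b \<Rightarrow> ennreal \<times> 'a::topological_space path"
  assumes space: "f \<in> space M \<rightarrow> UNIV \<times> paths"
    and sets: "\<And>t E. 0 \<le> t \<Longrightarrow> E \<in> sets (raw_filtration t) \<Longrightarrow> f -` ({ennreal t<..} \<times> E) \<inter> space M \<in> sets M"
  shows "f \<in> M \<rightarrow>\<^sub>M observed_events"
  unfolding observed_events_def
proof (rule measurable_measure_of[OF observed_generator_closed space])
  fix S assume S: "S \<in> insert (UNIV \<times> paths) {{ennreal t<..} \<times> E | t E. 0 \<le> t \<and> E \<in> sets (raw_filtration t :: 'a path measure)}"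
  show "f -` S \<inter> space M \<in> sets M"
  proof (cases "S = UNIV \<times> paths")
    case True
    have "f -` (UNIV \<times> paths) \<inter> space M = space M" using space by auto
    then show ?thesis unfolding True by (simp only: sets.top)
  next
    case False
    then obtain t E where "S = {ennreal t<..} \<times> E" "0 \<le> t" "E \<in> sets (raw_filtration t)" using S by blast
    then show ?thesis using sets by simp
  qed
qed

lemma kill_measurable:
  "(\<lambda>z. (fst z, kill (fst z) (snd z))) \<in>
    (observed_events :: (ennreal \<times> 'a::topological_space path) measure) \<rightarrow>\<^sub>M borel \<Otimes>\<^sub>M raw_events"
proof (rule measurable_Pair)
  show "fst \<in> borel_measurable (observed_events :: (ennreal \<times> 'a path) measure)"
  proof (rule borel_measurableI_greater)
    fix y :: ennreal
    show "{z \<in> space (observed_events :: (ennreal \<times> 'a path) measure). y < fst z} \<in> sets observed_events"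
    proof (cases y)
      case (real t)
      have "{z \<in> space (observed_events :: (ennreal \<times> 'a path) measure). y < fst z} = {ennreal t<..} \<times> paths"
        using real by auto
      moreover have "paths \<in> sets (raw_filtration t :: 'a path measure)"
        using sets.top[of "raw_filtration t"] by simp
      ultimately show ?thesis using observed_event[OF real(1)] by simp
    next
      case top
      then show ?thesis by simp
    qed
  qed
next
  show "(\<lambda>z. kill (fst z) (snd z)) \<in> (observed_events :: (ennreal \<times> 'a path) measure) \<rightarrow>\<^sub>M raw_events"
  proof (rule measurable_into_raw_events)
    show "(\<lambda>z. kill (fst z) (snd z)) \<in> space (observed_events :: (ennreal \<times> 'a path) measure) \<rightarrow> paths"
      by (auto intro: kill_paths)
    fix s :: real assume s: "0 \<le> s"
    let ?G = "\<lambda>B. {ennreal s<..} \<times> {\<omega> \<in> (paths :: 'a path set). \<omega> s \<in> B}"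
    show "(\<lambda>z. kill (fst z) (snd z) s) \<in> borel_measurable (observed_events :: (ennreal \<times> 'a path) measure)"
    proof (rule measurableI)
      fix B :: "'a option set" assume B: "B \<in> sets borel"
      have G: "?G C \<in> sets observed_events" if C: "C \<in> sets borel" for C
      proof (rule observed_event[OF s])
        have "(\<lambda>\<omega>. \<omega> s) -` C \<inter> space (raw_filtration s) \<in> sets (raw_filtration s :: 'a path measure)"
          using measurable_sets[OF coordinate_raw_filtration[OF s order_refl] C] .
        moreover have "(\<lambda>\<omega>. \<omega> s) -` C \<inter> space (raw_filtration s) = {\<omega> \<in> (paths :: 'a path set). \<omega> s \<in> C}" by auto
        ultimately show "{\<omega> \<in> (paths :: 'a path set). \<omega> s \<in> C} \<in> sets (raw_filtration s)" by simp
      qed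
      have "(\<lambda>z. kill (fst z) (snd z) s) -` B \<inter> space observed_events =
          (if None \<in> B then space observed_events - ?G (- B) else ?G B)" (is "?l = ?r")
      proof (rule set_eqI)
        show "z \<in> ?l \<longleftrightarrow> z \<in> ?r" for z
          using s by (cases z) (auto simp: kill_apply)
      qed
      moreover have "- B \<in> sets borel" using B by (rule borel_comp)
      ultimately show "(\<lambda>z. kill (fst z) (snd z) s) -` B \<inter> space observed_events \<in> sets observed_events"
        using G[OF B] G[of "- B"] sets.compl_sets[of "?G (- B)" observed_events] by (simp split: if_splits)
    qed simp
  qed
qed

lemma distr_observed_events_eqI:
  fixes X :: "'b \<Rightarrow> ennreal \<times> 'a::topological_space path" and Y :: "'c \<Rightarrow> ennreal \<times> 'a path"
  assumes "prob_space M" "prob_space N"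
    and X: "X \<in> M \<rightarrow>\<^sub>M observed_events" and Y: "Y \<in> N \<rightarrow>\<^sub>M observed_events"
    and eq: "\<And>t E. 0 \<le> t \<Longrightarrow> E \<in> sets (raw_filtration t) \<Longrightarrow>
      emeasure M (X -` ({ennreal t<..} \<times> E) \<inter> space M) = emeasure N (Y -` ({ennreal t<..} \<times> E) \<inter> space N)"
  shows "distr M observed_events X = distr N observed_events Y"
proof -
  interpret M: prob_space "distr M observed_events X" by (rule prob_space.prob_space_distr[OF assms(1) X])
  interpret N: prob_space "distr N observed_events Y" by (rule prob_space.prob_space_distr[OF assms(2) Y])
  let ?E = "insert (UNIV \<times> paths) {{ennreal t<..} \<times> E | t E. 0 \<le> t \<and> E \<in> sets (raw_filtration t :: 'a path measure)}"
  have whole: "emeasure (distr M observed_events X) (UNIV \<times> paths) = 1" "emeasure (distr N observed_events Y) (UNIV \<times> paths) = 1"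
    using M.emeasure_space_1 N.emeasure_space_1 by simp_all
  show ?thesis
  proof (rule measure_eqI_generator_eq[where E="?E" and \<Omega>="UNIV \<times> paths" and A="\<lambda>_ :: nat. UNIV \<times> paths"])
    show "?E \<subseteq> Pow (UNIV \<times> paths)" by (rule observed_generator_closed)
    show "Int_stable ?E"
    proof (rule Int_stableI)
      fix S T assume S: "S \<in> ?E" and T: "T \<in> ?E"
      have whole_Int: "(UNIV \<times> paths) \<inter> S' = S'" if "S' \<in> ?E" for S'
        by (rule Int_absorb1[OF PowD[OF subsetD[OF observed_generator_closed that]]])
      show "S \<inter> T \<in> ?E"
      proof (cases "S = UNIV \<times> paths \<or> T = UNIV \<times> paths")
        case True
        then show ?thesis
        proof
          assume "S = UNIV \<times> paths"
          then show ?thesis using whole_Int[OF T] T by (simp only:)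
        next
          assume "T = UNIV \<times> paths"
          then show ?thesis using whole_Int[OF S] S by (simp only: Int_commute)
        qed
      next
        case False
        then obtain s t E F where *: "S = {ennreal s<..} \<times> E" "0 \<le> s" "E \<in> sets (raw_filtration s)"
          "T = {ennreal t<..} \<times> F" "0 \<le> t" "F \<in> sets (raw_filtration t)" using S T by blast
        have "E \<in> sets (raw_filtration (max s t))" "F \<in> sets (raw_filtration (max s t))"
          using * raw_filtration_mono[of s "max s t"] raw_filtration_mono[of t "max s t"] by auto
        then have "E \<inter> F \<in> sets (raw_filtration (max s t))" by (rule sets.Int)
        moreover have "S \<inter> T = {ennreal (max s t)<..} \<times> (E \<inter> F)"
        proof (cases "s \<le> t")
          case True
          then have "ennreal s \<le> ennreal t" by (rule ennreal_leI)
          with True * show ?thesis by (auto simp: max_def intro: le_less_trans[of "ennreal s" "ennreal t"])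
        next
          case False
          then have "ennreal t \<le> ennreal s" by (intro ennreal_leI) simp
          with False * show ?thesis by (auto simp: max_def intro: le_less_trans[of "ennreal t" "ennreal s"])
        qed
        ultimately show ?thesis using *(2) by (intro insertI2 CollectI exI[of _ "max s t"] exI[of _ "E \<inter> F"]) auto
      qed
    qed
    show "emeasure (distr M observed_events X) S = emeasure (distr N observed_events Y) S" if S: "S \<in> ?E" for S
    proof (cases "S = UNIV \<times> paths")
      case True
      then show ?thesis using whole by simp
    next
      case False
      then obtain t E where *: "S = {ennreal t<..} \<times> E" "0 \<le> t" "E \<in> sets (raw_filtration t)" using S by blast
      then show ?thesis
        using eq[OF *(2,3)] observed_event[OF *(2,3)] by (simp add: emeasure_distr[OF X] emeasure_distr[OF Y])
    qed
    show "emeasure (distr M observed_events X) (UNIV \<times> paths) \<noteq> \<infinity>" using whole by simp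
  qed (auto simp: sets_observed_events)
qed

context local_time_process
begin

text \<open>Both laws give the event that the killing time exceeds \<open>t\<close> and that the path up to \<open>t\<close> lies
  in \<open>E\<close> the probability \<open>P\<^sup>x[E; P\<^sup>X\<^sup>t[hit]] / P\<^sup>x[hit]\<close>: the Campbell law by the formula for its
  tails, the conditional law because the last exit exceeds \<open>t\<close> if and only if the path after \<open>t\<close>
  hits \<open>a\<close>.\<close>

theorem killed_campbell_law:
  assumes pos: "hit_prob x > 0" and prob: "prob_space (campbell_law x)"
  shows "distr (campbell_law x) (borel \<Otimes>\<^sub>M raw_events) (\<lambda>(\<omega>, \<xi>). (ennreal \<xi>, kill (ennreal \<xi>) \<omega>)) =
    distr (uniform_measure (law P (Some x)) hit) (borel \<Otimes>\<^sub>M raw_events) (\<lambda>\<omega>. (last_exit a \<omega>, kill (last_exit a \<omega>) \<omega>))"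
proof -
  let ?R = "campbell_law x" and ?Q = "completion (P x)"
  let ?W = "uniform_measure ?Q hit"
  let ?X = "\<lambda>z :: 'a path \<times> real. (ennreal (snd z), fst z)" and ?Y = "\<lambda>\<omega>. (last_exit a \<omega>, \<omega>)"
  let ?k = "\<lambda>z :: ennreal \<times> 'a path. (fst z, kill (fst z) (snd z))"
  have hitQ: "hit \<in> sets ?Q" by (rule sets_events_P[OF hit_events])
  have hit_em: "emeasure ?Q hit = hit_prob x" using emeasure_law_hit[of x] by (simp only: law_Some)
  have prob_W: "prob_space ?W"
    using pos le_less_trans[OF hit_prob_le_1 ennreal_one_less_top, of x]
    by (intro prob_space_uniform_measure) (simp_all only: hit_em, auto)
  have X_vimage: "?X -` ({ennreal t<..} \<times> E) \<inter> space ?R = E \<times> {t<..}"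
    if "0 \<le> t" "E \<in> sets (raw_filtration t)" for t E
    using that sets.sets_into_space[OF that(2)] by (auto simp: ennreal_less_iff)
  have E_events: "E \<in> sets (events P)" if "E \<in> sets (raw_filtration t)" for t E
    using that raw_filtration_subset_completed completed_filtration_subset_events by blast
  have tail_set: "{t<..} \<in> sets (restrict_space borel {0..} :: real measure)" if "0 \<le> t" for t
    using that by (subst sets_restrict_space_iff) auto
  have X: "?X \<in> ?R \<rightarrow>\<^sub>M observed_events"
  proof (rule measurable_observed_eventsI)
    show "?X -` ({ennreal t<..} \<times> E) \<inter> space ?R \<in> sets ?R" if "0 \<le> t" "E \<in> sets (raw_filtration t)" for t E
      unfolding X_vimage[OF that] sets_campbell_law
      by (rule pair_measureI[OF E_events[OF that(2)] tail_set[OF that(1)]])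
  qed auto
  have Y_vimage: "?Y -` ({ennreal t<..} \<times> E) \<inter> paths = E \<inter> {\<omega> \<in> paths. ennreal t < last_exit a \<omega>}" for t E
    by auto
  have Y_sets: "E \<inter> {\<omega> \<in> paths. ennreal t < last_exit a \<omega>} \<in> sets ?Q"
    if "0 \<le> t" "E \<in> sets (raw_filtration t)" for t E
    by (rule sets.Int[OF sets_events_P[OF E_events[OF that(2)]] last_exit_gt_measurable[OF that(1)]])
  have Y: "?Y \<in> ?W \<rightarrow>\<^sub>M observed_events"
  proof (rule measurable_observed_eventsI)
    show "?Y -` ({ennreal t<..} \<times> E) \<inter> space ?W \<in> sets ?W" if "0 \<le> t" "E \<in> sets (raw_filtration t)" for t E
      using Y_sets[OF that] Y_vimage[of t E] by simp
  qed auto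
  have "distr ?R observed_events ?X = distr ?W observed_events ?Y"
  proof (rule distr_observed_events_eqI[OF prob prob_W X Y])
    fix t and E :: "'a path set" assume t: "0 \<le> t" and E: "E \<in> sets (raw_filtration t)"
    have "E \<in> sets (completed_filtration P t)" using E raw_filtration_subset_completed by blast
    then have Z: "indicator E \<in> borel_measurable (completed_filtration P t)" by simp
    let ?I = "\<integral>\<^sup>+ \<omega>. indicator E \<omega> * ext0 hit_prob (\<omega> t) \<partial>P x"
    have rect: "E \<times> {t<..} \<in> sets ?R"
      unfolding sets_campbell_law by (rule pair_measureI[OF E_events[OF E] tail_set[OF t]])
    have "emeasure ?R (?X -` ({ennreal t<..} \<times> E) \<inter> space ?R) = (\<integral>\<^sup>+ z. indicator (E \<times> {t<..}) z \<partial>?R)"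
      unfolding X_vimage[OF t E] by (rule nn_integral_indicator[OF rect, symmetric])
    also have "\<dots> = (\<integral>\<^sup>+ (\<omega>, \<xi>). indicator E \<omega> * indicator {t<..} \<xi> \<partial>?R)"
      by (intro nn_integral_cong) (auto simp: indicator_def)
    also have "\<dots> = 1 / hit_prob x * ?I" by (rule campbell_law_tail[OF t Z pos])
    finally have 1: "emeasure ?R (?X -` ({ennreal t<..} \<times> E) \<inter> space ?R) = 1 / hit_prob x * ?I" .
    let ?B = "E \<inter> {\<omega> \<in> paths. ennreal t < last_exit a \<omega>}"
    have "hit \<inter> ?B = ?B"
    proof -
      have "\<omega> \<in> hit" if \<omega>: "\<omega> \<in> paths" "ennreal t < last_exit a \<omega>" for \<omega>
      proof -
        obtain s where "0 < s" "shift t \<omega> s = Some a"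
          using \<omega>(2) unfolding last_exit_gt_iff[OF t] hitting_time_finite_iff by blast
        then have "\<omega> (s + t) = Some a" "0 < s + t" using t by (simp_all add: shift_apply)
        then have "hitting_time a \<omega> < \<infinity>" unfolding hitting_time_finite_iff by blast
        then show ?thesis using \<omega>(1) by (simp only: hit_def mem_Collect_eq)
      qed
      then show ?thesis by blast
    qed
    moreover have "?Y -` ({ennreal t<..} \<times> E) \<inter> space ?W = ?B" using Y_vimage[of t E] by simp
    ultimately have "emeasure ?W (?Y -` ({ennreal t<..} \<times> E) \<inter> space ?W) = emeasure ?Q ?B / hit_prob x"
      using emeasure_uniform_measure[OF hitQ Y_sets[OF t E]] by (simp only: hit_em)
    also have "emeasure ?Q ?B = (\<integral>\<^sup>+ \<omega>. indicator ?B \<omega> \<partial>?Q)"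
      by (rule nn_integral_indicator[OF Y_sets[OF t E], symmetric])
    also have "\<dots> = (\<integral>\<^sup>+ \<omega>. indicator E \<omega> * indicator {\<omega>. ennreal t < last_exit a \<omega>} \<omega> \<partial>P x)"
      unfolding nn_integral_completion by (intro nn_integral_cong) (simp add: indicator_def)
    also have "\<dots> = ?I" by (rule last_exit_tail[OF t Z])
    finally show "emeasure ?R (?X -` ({ennreal t<..} \<times> E) \<inter> space ?R) =
        emeasure ?W (?Y -` ({ennreal t<..} \<times> E) \<inter> space ?W)"
      unfolding 1 by (simp add: divide_ennreal_def mult.commute)
  qed
  then have "distr (distr ?R observed_events ?X) (borel \<Otimes>\<^sub>M raw_events) ?k =
      distr (distr ?W observed_events ?Y) (borel \<Otimes>\<^sub>M raw_events) ?k" by simp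
  then have "distr ?R (borel \<Otimes>\<^sub>M raw_events) (?k \<circ> ?X) = distr ?W (borel \<Otimes>\<^sub>M raw_events) (?k \<circ> ?Y)"
    unfolding distr_distr[OF kill_measurable X] distr_distr[OF kill_measurable Y] .
  moreover have "?k \<circ> ?X = (\<lambda>(\<omega>, \<xi>). (ennreal \<xi>, kill (ennreal \<xi>) \<omega>))" by (auto simp: fun_eq_iff)
  moreover have "?k \<circ> ?Y = (\<lambda>\<omega>. (last_exit a \<omega>, kill (last_exit a \<omega>) \<omega>))" by (auto simp: fun_eq_iff)
  ultimately show ?thesis by (simp only: law_Some)
qed

end


section \<open>From the hypotheses to the local time process\<close>

lemma lusin_space_imp_metrizable: "lusin_space X \<Longrightarrow> metrizable_space X"
  using homeomorphic_metrizable_space metrizable_space_subtopology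
  unfolding lusin_space_def by blast

lemma metrizable_point_neighbourhoods:
  assumes "metrizable_space (euclidean :: 'a::topological_space topology)"
  obtains U where "point_neighbourhoods (a :: 'a) U"
proof -
  obtain S d where "Metric_space S d" and top: "euclidean = Metric_space.mtopology S (d :: 'a \<Rightarrow> 'a \<Rightarrow> real)"
    using assms unfolding metrizable_space_def by blast
  then interpret Metric_space S d by simp
  have "S = UNIV" using topspace_mtopology unfolding top[symmetric] by simp
  then have S: "y \<in> S" for y by simp
  have open_ball: "open (mball y r)" for y r
    using openin_mball[of y r] unfolding top[symmetric] by simp
  have "point_neighbourhoods a (\<lambda>n. mball a (1 / real (Suc n)))"
  proof
    show "open (mball a (1 / real (Suc n)))" for n by (rule open_ball)
    show "a \<in> mball a (1 / real (Suc n))" for n by (simp add: S)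
    fix y assume "y \<noteq> a"
    then have r: "0 < d a y" by (simp add: S)
    then obtain n :: nat where n: "1 / real (Suc n) < d a y / 2"
      using nat_approx_posE[of "d a y / 2"] by auto
    have "mball y (d a y / 2) \<inter> mball a (1 / real (Suc n)) = {}"
    proof (rule ccontr)
      assume "\<not> ?thesis"
      then obtain z where "d y z < d a y / 2" "d a z < 1 / real (Suc n)" by auto
      then show False using n triangle[OF S S S, where x=a and y=z and z=y] commute[of z y] by linarith
    qed
    moreover have "y \<in> mball y (d a y / 2)" using r by (simp add: S)
    ultimately show "\<exists>V n. open V \<and> y \<in> V \<and> V \<inter> mball a (1 / real (Suc n)) = {}"
      using open_ball by blast
  qed
  then show thesis by (rule that)
qed

context borel_right
begin

lemma AE_of_emeasure_law_1:
  assumes "emeasure (law P (Some x)) E = 1"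
  shows "AE \<omega> in P x. \<omega> \<in> E"
proof -
  let ?Q = "completion (P x)"
  have E: "emeasure ?Q E = 1" using assms by (simp only: law_Some)
  then have sets: "E \<in> sets ?Q" by (intro emeasure_neq_0_sets) (simp only: one_neq_zero not_False_eq_True)
  have total: "emeasure ?Q (space ?Q) = 1"
  proof -
    have "emeasure ?Q (space ?Q) = (\<integral>\<^sup>+ \<omega>. 1 \<partial>?Q)" by simp
    also have "\<dots> = 1" unfolding nn_integral_completion by simp
    finally show ?thesis .
  qed
  have "emeasure ?Q (space ?Q - E) = emeasure ?Q (space ?Q) - emeasure ?Q E"
    by (rule emeasure_compl[OF sets]) (simp only: E, simp)
  then have "emeasure ?Q (space ?Q - E) = 0" by (simp only: E total) simp
  then have "AE \<omega> in ?Q. \<omega> \<notin> space ?Q - E"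
    by (rule AE_not_in[OF null_setsI[OF _ sets.compl_sets[OF sets]]])
  then have "AE \<omega> in ?Q. \<omega> \<in> E" using AE_space[of ?Q] by eventually_elim blast
  then show ?thesis by (simp only: AE_completion_iff)
qed

text \<open>Setting the functional to \<open>0\<close> on the exceptional set makes its paths continuous and
  nondecreasing without exception; additivity at a fixed time then only holds almost surely, because
  the shifted path may fall into the exceptional set.\<close>

lemma additive_functional_version:
  assumes L: "perfect_continuous_additive_functional P L"
  obtains A where "additive_functional P A"
    "\<And>x. AE \<omega> in P x. (\<forall>B\<in>sets (restrict_space borel {0..}).
        emeasure (functional_measure L \<omega>) B = growth_integral (\<lambda>t. A t \<omega>) (indicator B)) \<and>
      (\<forall>f\<in>borel_measurable borel. (\<integral>\<^sup>+ r. f r \<partial>functional_measure L \<omega>) = growth_integral (\<lambda>t. A t \<omega>) f)"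
proof -
  note L_def = L[unfolded perfect_continuous_additive_functional_def]
  have meas: "L t \<in> borel_measurable (completed_filtration P t)" if "0 \<le> t" for t
    using conjunct1[OF L_def] that by blast
  obtain \<Lambda> where \<Lambda>_events: "\<Lambda> \<in> sets (events P)" and \<Lambda>_full: "\<forall>x. emeasure (law P (Some x)) \<Lambda> = 1"
    and \<Lambda>_L: "\<forall>\<omega>\<in>\<Lambda>. L 0 \<omega> = 0 \<and> mono_on {0..} (\<lambda>t. L t \<omega>) \<and> continuous_on {0..} (\<lambda>t. L t \<omega>) \<and>
      (\<forall>s\<ge>0. \<forall>t\<ge>s. lifetime \<omega> \<le> ennreal s \<longrightarrow> L t \<omega> = L s \<omega>) \<and>
      (\<forall>s\<ge>0. \<forall>t\<ge>0. L (s + t) \<omega> = L s \<omega> + L t (shift s \<omega>))"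
    using conjunct2[OF L_def] by (elim bexE conjE) (rule that)
  note \<Lambda> = \<Lambda>_events \<Lambda>_full[rule_format] and L = bspec[OF \<Lambda>_L]
  have L_flat: "L t \<omega> = L s \<omega>" if "\<omega> \<in> \<Lambda>" "0 \<le> s" "s \<le> t" "lifetime \<omega> \<le> ennreal s" for s t \<omega>
    using L[OF that(1)] that(2,3,4) by blast
  have L_add: "L (s + t) \<omega> = L s \<omega> + L t (shift s \<omega>)" if "\<omega> \<in> \<Lambda>" "0 \<le> s" "0 \<le> t" for s t \<omega>
    using L[OF that(1)] that(2,3) by blast
  define A where "A t \<omega> = (if \<omega> \<in> \<Lambda> then L t \<omega> else 0)" for t \<omega>
  have AE_\<Lambda>: "AE \<omega> in P x. \<omega> \<in> \<Lambda>" for x by (rule AE_of_emeasure_law_1[OF \<Lambda>(2)])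
  have growth: "growth (\<lambda>t. A t \<omega>)" for \<omega>
    using L[of \<omega>] growth_zero by (cases "\<omega> \<in> \<Lambda>") (simp_all add: A_def growth_def)
  have "additive_functional P A"
  proof (rule additive_functional.intro[OF borel_right_axioms additive_functional_axioms.intro])
    show "A t \<in> borel_measurable (events P)" if "0 \<le> t" for t
    proof -
      have "{\<omega> \<in> space (events P). \<omega> \<in> \<Lambda>} = \<Lambda>" using sets.sets_into_space[OF \<Lambda>(1)] by auto
      then have "{\<omega> \<in> space (events P). \<omega> \<in> \<Lambda>} \<in> sets (events P)" using \<Lambda>(1) by simp
      from measurable_If[OF measurable_completed_filtration_events[OF meas[OF that]] borel_measurable_const[of 0] this]
      show ?thesis by (simp only: A_def[abs_def])
    qed
    show "growth (\<lambda>t. A t \<omega>)" for \<omega> by (rule growth)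
    show "AE \<omega> in P x. \<forall>r\<ge>0. A (t + r) \<omega> = A t \<omega> + (if \<omega> t = None then 0 else A r (shift t \<omega>))"
      if t: "0 \<le> t" for t x
      using AE_\<Lambda>[of x] AE_future[OF t \<Lambda>(1) AE_\<Lambda>, of x] AE_space[of "P x"]
    proof eventually_elim
      case (elim \<omega>)
      then have \<omega>: "\<omega> \<in> paths" by simp
      show ?case
      proof (intro allI impI)
        fix r :: real assume r: "0 \<le> r"
        show "A (t + r) \<omega> = A t \<omega> + (if \<omega> t = None then 0 else A r (shift t \<omega>))"
        proof (cases "\<omega> t")
          case None
          then have "lifetime \<omega> \<le> ennreal t" using path_None_iff[OF \<omega> t] by simp
          then have "L (t + r) \<omega> = L t \<omega>" using L_flat[OF elim(1) t, of "t + r"] r by simp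
          then show ?thesis using None elim(1) by (simp add: A_def)
        next
          case (Some y)
          then have "shift t \<omega> \<in> \<Lambda>" using elim(2) by blast
          then show ?thesis using Some elim(1) L_add[OF elim(1) t r] by (simp add: A_def)
        qed
      qed
    qed
  qed
  moreover have "AE \<omega> in P x. (\<forall>B\<in>sets (restrict_space borel {0..}).
        emeasure (functional_measure L \<omega>) B = growth_integral (\<lambda>t. A t \<omega>) (indicator B)) \<and>
      (\<forall>f\<in>borel_measurable borel. (\<integral>\<^sup>+ r. f r \<partial>functional_measure L \<omega>) = growth_integral (\<lambda>t. A t \<omega>) f)" for x
    using AE_\<Lambda>[of x]
  proof eventually_elim
    case (elim \<omega>)
    interpret growth "\<lambda>t. A t \<omega>" by (rule growth)
    have fm: "functional_measure L \<omega> = restrict_space (interval_measure (\<lambda>t. A (max 0 t) \<omega>)) {0..}"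
      using elim by (simp add: functional_measure_def A_def)
    have int: "(\<integral>\<^sup>+ r. f r \<partial>functional_measure L \<omega>) = growth_integral (\<lambda>t. A t \<omega>) f"
      if f: "f \<in> borel_measurable borel" for f
    proof -
      have "(\<integral>\<^sup>+ r. f r \<partial>functional_measure L \<omega>) = (\<integral>\<^sup>+ r. f r * indicator {0..} r \<partial>interval_measure (\<lambda>t. A (max 0 t) \<omega>))"
        unfolding fm by (rule nn_integral_restrict_space) simp
      also have "\<dots> = growth_integral (\<lambda>t. A t \<omega>) (\<lambda>r. f r * indicator {0..} r)"
        using f by (intro nn_integral_interval_measure) simp
      also have "\<dots> = growth_integral (\<lambda>t. A t \<omega>) f" by (rule growth_integral_cong) simp
      finally show ?thesis .
    qed
    have "emeasure (functional_measure L \<omega>) B = growth_integral (\<lambda>t. A t \<omega>) (indicator B)"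
      if B: "B \<in> sets (restrict_space borel {0..})" for B
    proof -
      have "B \<in> sets borel" using B by (simp add: sets_restrict_space_iff)
      moreover have "B \<in> sets (functional_measure L \<omega>)" using B by (simp add: fm sets_restrict_space)
      ultimately show ?thesis using int[of "indicator B"] by simp
    qed
    with int show ?case by blast
  qed
  ultimately show thesis by (rule that)
qed

end


theorem theorem1p2:
  fixes P :: "'a::topological_space \<Rightarrow> 'a path measure"
    and a :: 'a
    and L :: "real \<Rightarrow> 'a path \<Rightarrow> real"
    and Pbar :: "'a \<Rightarrow> ('a path \<times> real) measure"
  assumes lusin: "lusin_space (euclidean :: 'a topology)"
    and process: "borel_right_process P"
    and i: "emeasure (law P (Some a)) {\<omega> \<in> paths. last_exit a \<omega> < \<infinity>} = 1"
    and ii: "emeasure (law P (Some a)) {\<omega> \<in> paths. hitting_time a \<omega> = 0} = 1"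
    and iii: "\<And>x. emeasure (law P (Some x)) {\<omega> \<in> paths. hitting_time a \<omega> < \<infinity>} > 0"
    and local_time: "local_time P a L"
  defines "Pbar \<equiv> \<lambda>x. campbell_measure (events P) (law P (Some x)) (functional_measure L)"
  shows "(\<forall>t\<ge>0. \<forall>Z::'a path \<Rightarrow> ennreal. Z \<in> borel_measurable (completed_filtration P t) \<longrightarrow>
            (\<forall>x. (\<integral>\<^sup>+ (\<omega>, \<xi>). Z \<omega> * indicator {t<..} \<xi> \<partial>Pbar x) =
               1 / emeasure (law P (Some x)) {\<omega> \<in> paths. hitting_time a \<omega> < \<infinity>} *
               (\<integral>\<^sup>+ \<omega>. Z \<omega> * emeasure (law P (\<omega> t)) {\<omega>' \<in> paths. hitting_time a \<omega>' < \<infinity>}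
                  \<partial>law P (Some x)))) \<and>
         (\<forall>x. distr (Pbar x) (borel \<Otimes>\<^sub>M raw_events) (\<lambda>(\<omega>, \<xi>). (ennreal \<xi>, kill (ennreal \<xi>) \<omega>)) =
              distr (uniform_measure (law P (Some x)) {\<omega> \<in> paths. hitting_time a \<omega> < \<infinity>})
                (borel \<Otimes>\<^sub>M raw_events) (\<lambda>\<omega>. (last_exit a \<omega>, kill (last_exit a \<omega>) \<omega>)))"
proof -
  interpret borel_right P by standard (rule process)
  obtain U where "point_neighbourhoods a U"
    using metrizable_point_neighbourhoods[OF lusin_space_imp_metrizable[OF lusin]] .
  then interpret point_neighbourhoods a U .
  interpret regular_point P a U
  proof
    show "AE \<omega> in P a. hitting_time a \<omega> = 0"
      using AE_of_emeasure_law_1[OF ii] by eventually_elim simp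
  qed
  obtain A where "additive_functional P A"
    and fm: "\<And>x. AE \<omega> in P x. (\<forall>B\<in>sets (restrict_space borel {0..}).
        emeasure (functional_measure L \<omega>) B = growth_integral (\<lambda>t. A t \<omega>) (indicator B)) \<and>
      (\<forall>f\<in>borel_measurable borel. (\<integral>\<^sup>+ r. f r \<partial>functional_measure L \<omega>) = growth_integral (\<lambda>t. A t \<omega>) f)"
    using local_time additive_functional_version unfolding local_time_def by blast
  then interpret additive_functional P A by simp
  interpret local_time_process P a U A
  proof
    fix x
    have "(\<integral>\<^sup>+ \<omega>. exp_neg (hitting_time a \<omega>) \<partial>P x) =
        (\<integral>\<^sup>+ \<omega>. (\<integral>\<^sup>+ s. ennreal (exp (- s)) \<partial>functional_measure L \<omega>) \<partial>P x)"
      using local_time unfolding local_time_def law_Some nn_integral_completion by blast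
    also have "\<dots> = (\<integral>\<^sup>+ \<omega>. additive_integral (\<lambda>r. ennreal (exp (- (1 * r)))) \<omega> \<partial>P x)"
    proof (rule nn_integral_cong_AE)
      have exp: "(\<lambda>s::real. ennreal (exp (- s))) \<in> borel_measurable borel" by measurable
      show "AE \<omega> in P x. (\<integral>\<^sup>+ s. ennreal (exp (- s)) \<partial>functional_measure L \<omega>) =
          additive_integral (\<lambda>r. ennreal (exp (- (1 * r)))) \<omega>"
        using fm[of x]
      proof eventually_elim
        case (elim \<omega>)
        show ?case using bspec[OF conjunct2[OF elim] exp] by (simp add: additive_integral_def)
      qed
    qed
    finally show "potential 1 x = (\<integral>\<^sup>+ \<omega>. exp_neg (hitting_time a \<omega>) \<partial>P x)"
      by (simp only: potential_def)
    show "AE \<omega> in P a. last_exit a \<omega> < \<infinity>"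
      using AE_of_emeasure_law_1[OF i] by eventually_elim simp
  qed
  have pos: "hit_prob x > 0" for x
    using iii[of x] emeasure_law_hit[of x] by (simp only: hit_def)
  have campbell: "Pbar x = campbell_law x" "prob_space (campbell_law x)" for x
  proof -
    have M: "AE \<omega> in P x. \<forall>B\<in>sets (restrict_space borel {0..}).
        emeasure (functional_measure L \<omega>) B = additive_integral (indicator B) \<omega>"
      using fm[of x] by eventually_elim (simp add: additive_integral_def)
    obtain c where c: "1 \<le> c" "c < \<infinity>" "\<And>x. potential 0 x = c * hit_prob x" using potential_0_eq by blast
    have "hit_prob x < \<infinity>" using hit_prob_le_1[of x] by (rule le_less_trans) simp
    then have "potential 0 x \<noteq> \<infinity>" "potential 0 x \<noteq> 0"
      using c pos[of x] by (auto simp: ennreal_mult_eq_top_iff)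
    from campbell_measure_eq[OF M this(2,1)]
    show "Pbar x = campbell_law x" "prob_space (campbell_law x)"
      by (simp_all only: Pbar_def)
  qed
  show ?thesis
  proof (intro conjI allI impI)
    fix t :: real and Z :: "'a path \<Rightarrow> ennreal" and x
    assume t: "0 \<le> t" and Z: "Z \<in> borel_measurable (completed_filtration P t)"
    show "(\<integral>\<^sup>+ (\<omega>, \<xi>). Z \<omega> * indicator {t<..} \<xi> \<partial>Pbar x) =
        1 / emeasure (law P (Some x)) {\<omega> \<in> paths. hitting_time a \<omega> < \<infinity>} *
        (\<integral>\<^sup>+ \<omega>. Z \<omega> * emeasure (law P (\<omega> t)) {\<omega>' \<in> paths. hitting_time a \<omega>' < \<infinity>} \<partial>law P (Some x))"
      unfolding campbell(1) hit_def[symmetric] emeasure_law_hit_ext0 ext0_Some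
      unfolding law_Some nn_integral_completion by (rule campbell_law_tail[OF t Z pos])
  next
    fix x
    show "distr (Pbar x) (borel \<Otimes>\<^sub>M raw_events) (\<lambda>(\<omega>, \<xi>). (ennreal \<xi>, kill (ennreal \<xi>) \<omega>)) =
        distr (uniform_measure (law P (Some x)) {\<omega> \<in> paths. hitting_time a \<omega> < \<infinity>})
          (borel \<Otimes>\<^sub>M raw_events) (\<lambda>\<omega>. (last_exit a \<omega>, kill (last_exit a \<omega>) \<omega>))"
      unfolding campbell(1) hit_def[symmetric] by (rule killed_campbell_law[OF pos campbell(2)])
  qed
qed

end
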